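(* Let $\mathscr L$ be a self-similar Lie algebra in characteristic $p>0$, with finite-dimensional alphabet $X$, admitting two gradings $\deg_\lambda,\deg_\mu$ compatible with its self-similarity structure, of respective real dilations $\lambda,\mu$ with $\lambda>|\mu|>1$, and such that $\mathscr L$ is generated by finitely many elements of positive degree with respect to $\deg_\lambda$. Then there is a decomposition as a sum of subalgebras $$\mathbb U(\mathscr L)=\mathbb U_+\oplus\mathbb U_0\oplus\mathbb U_-,$$ in which $\mathbb U_+,\mathbb U_0,\mathbb U_-$ are respectively the spans of homogeneous elements $a$ with $\deg_\mu(a)>0$, respectively $=0$, respectively $<0$; and $\mathbb U_+$ and $\mathbb U_-$ are locally nilpotent. In particular, homogeneous elements with $\deg_\mu\neq0$ are nil.
   Context: $\Bbbk$ is a field of characteristic $p$; tensor products are over $\Bbbk$. All Lie algebras are restricted (with $p$-mapping $a\mapsto a^p$), and "generated" means as restricted Lie algebra. $\mathbb U(\mathscr L)$ is the restricted universal enveloping algebra $T(\mathscr L)/\langle a\otimes b-b\otimes a-[a,b],\ a^{\otimes p}-a^p\ (a,b\in\mathscr L)\rangle$, with the gradings induced from those of $\mathscr L$. **Self-similar Lie algebras.** Let $X$ be a commutative unital $\Bbbk$-algebra with Lie algebra of derivations $\mathrm{Der}\,X$. For a Lie algebra $\mathscr L$ put $\mathscr L\wr\mathrm{Der}\,X=(X\otimes\mathscr L)\rtimes\mathrm{Der}\,X$, with $[y\otimes a,z\otimes b]=yz\otimes[a,b]$, $[\delta,y\otimes a]=\delta(y)\otimes a$, $(y\otimes a)^p=y^p\otimes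 a^p$. $\mathscr L$ is *self-similar* with alphabet $X$ if it is endowed with a homomorphism of restricted Lie algebras $\psi:\mathscr L\to\mathscr L\wr\mathrm{Der}\,X$. It then acts by $\Bbbk$-linear endomorphisms on $T(X)=\bigoplus_{n\ge0}X^{\otimes n}$: $a$ acts as $0$ on $X^{\otimes0}$, and if $\psi(a)=\sum y_i\otimes a_i+\delta$ then $a\cdot(x_1\otimes\cdots\otimes x_n)=\sum x_1y_i\otimes a_i\cdot(x_2\otimes\cdots\otimes x_n)+\delta(x_1)\otimes x_2\otimes\cdots\otimes x_n$. This action is assumed faithful. **Gradings.** A grading of $\mathscr L$ (as a Lie algebra, by real degrees), together with a grading of $X$ (by real degrees), is compatible with the self-similarity structure, with *dilation* $\lambda\in\mathbb R$, if for every homogeneous $a\in\mathscr L$ one can write $\psi(a)=\sum y_i\otimes a_i+\delta$ with homogeneous terms satisfying $\deg(a)=\deg(y_i)+\lambda\deg(a_i)=\deg(\delta)$ for all $i$ (no condition from zero terms). By convention, for $\deg_\lambda$, $X$ is graded non-positively and $\mathscr L$ is graded in positive degree. An associative algebra is *locally nilpotent* if every finitely generated (non-unital) subalgebra is nilpotent; an element is *nil* if some power of it vanishes. *)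

theory Defs
  imports Complex_Main "HOL-Library.Poly_Mapping" "HOL-Computational_Algebra.Computational_Algebra"
begin

section \<open>Free vector spaces, free algebras and their quotients\<close>

text \<open>
  The free vector space on a type \<^typ>\<open>'i\<close> is \<^typ>\<open>'i \<Rightarrow>\<^sub>0 'k\<close>. Since lists form a monoid under
  concatenation, the convolution product makes \<^typ>\<open>'a list \<Rightarrow>\<^sub>0 'k\<close> the free unital associative
  algebra on the set \<^typ>\<open>'a\<close>.
\<close>

instantiation list :: (type) monoid_add
begin

definition zero_list :: "'a list" where "zero_list = []"
definition plus_list :: "'a list \<Rightarrow> 'a list \<Rightarrow> 'a list" where "plus_list = (@)"

instance by standard (simp_all add: zero_list_def plus_list_def)

end

abbreviation gen :: "'i \<Rightarrow> ('i \<Rightarrow>\<^sub>0 'k::field)" where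
  "gen i \<equiv> Poly_Mapping.single i 1"

definition fscale :: "'k::field \<Rightarrow> ('i \<Rightarrow>\<^sub>0 'k) \<Rightarrow> ('i \<Rightarrow>\<^sub>0 'k)" where
  "fscale c u = Poly_Mapping.map ((*) c) u"

lemma lookup_fscale: "Poly_Mapping.lookup (fscale c u) i = c * Poly_Mapping.lookup u i"
  by (simp add: fscale_def Poly_Mapping.map.rep_eq when_def)

global_interpretation free: vector_space fscale
  by standard (auto intro!: poly_mapping_eqI simp: lookup_fscale lookup_add algebra_simps)

definition lin_ext :: "('i \<Rightarrow> ('j \<Rightarrow>\<^sub>0 'k)) \<Rightarrow> ('i \<Rightarrow>\<^sub>0 'k::field) \<Rightarrow> ('j \<Rightarrow>\<^sub>0 'k)" where
  "lin_ext f u = (\<Sum>i\<in>Poly_Mapping.keys u. fscale (Poly_Mapping.lookup u i) (f i))"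

text \<open>
  The elements of a quotient by an additive subgroup \<open>N\<close> are cosets. \<open>lift1\<close> and \<open>lift2\<close> are the
  operations induced on cosets; they are used only for operations compatible with \<open>N\<close>, for which
  the union is over equal cosets.
\<close>

definition coset :: "'a::ab_group_add set \<Rightarrow> 'a \<Rightarrow> 'a set" where
  "coset N u = {v. v - u \<in> N}"

definition quotient_space :: "'a::ab_group_add set \<Rightarrow> 'a set set" where
  "quotient_space N = range (coset N)"

definition lift1 :: "'a::ab_group_add set \<Rightarrow> ('a \<Rightarrow> 'a) \<Rightarrow> 'a set \<Rightarrow> 'a set" where
  "lift1 N f U = (\<Union>u\<in>U. coset N (f u))"

definition lift2 :: "'a::ab_group_add set \<Rightarrow> ('a \<Rightarrow> 'a \<Rightarrow> 'a) \<Rightarrow> 'a set \<Rightarrow> 'a set \<Rightarrow> 'a set" where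
  "lift2 N f U V = (\<Union>u\<in>U. \<Union>v\<in>V. coset N (f u v))"

definition two_sided_ideal :: "'a::ring_1 set \<Rightarrow> bool" where
  "two_sided_ideal I \<longleftrightarrow> 0 \<in> I \<and> (\<forall>a\<in>I. \<forall>b\<in>I. a - b \<in> I) \<and> (\<forall>a\<in>I. \<forall>r. r * a \<in> I \<and> a * r \<in> I)"


section \<open>Quotients of free algebras\<close>

text \<open>
  In this section \<open>I\<close> is a two-sided ideal of a free algebra, and the algebra in question is the
  quotient by \<open>I\<close>.
\<close>

definition qsubspace :: "('a list \<Rightarrow>\<^sub>0 'k::field) set \<Rightarrow> ('a list \<Rightarrow>\<^sub>0 'k) set set \<Rightarrow> bool" where
  "qsubspace I A \<longleftrightarrow> A \<subseteq> quotient_space I \<and> coset I 0 \<in> A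
     \<and> (\<forall>U\<in>A. \<forall>V\<in>A. lift2 I (+) U V \<in> A) \<and> (\<forall>c. \<forall>U\<in>A. lift1 I (fscale c) U \<in> A)"

text \<open>Subalgebras are not required to contain the unit.\<close>

definition qsubalgebra :: "('a list \<Rightarrow>\<^sub>0 'k::field) set \<Rightarrow> ('a list \<Rightarrow>\<^sub>0 'k) set set \<Rightarrow> bool" where
  "qsubalgebra I A \<longleftrightarrow> qsubspace I A \<and> (\<forall>U\<in>A. \<forall>V\<in>A. lift2 I (*) U V \<in> A)"

definition qprod :: "('a list \<Rightarrow>\<^sub>0 'k::field) set \<Rightarrow> ('a list \<Rightarrow>\<^sub>0 'k) set list \<Rightarrow> ('a list \<Rightarrow>\<^sub>0 'k) set" where
  "qprod I Us = foldr (lift2 I (*)) Us (coset I 1)"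

definition qnil :: "('a list \<Rightarrow>\<^sub>0 'k::field) set \<Rightarrow> ('a list \<Rightarrow>\<^sub>0 'k) set \<Rightarrow> bool" where
  "qnil I U \<longleftrightarrow> (\<exists>n>0. qprod I (replicate n U) = coset I 0)"

definition qnilpotent :: "('a list \<Rightarrow>\<^sub>0 'k::field) set \<Rightarrow> ('a list \<Rightarrow>\<^sub>0 'k) set set \<Rightarrow> bool" where
  "qnilpotent I A \<longleftrightarrow> (\<exists>n>0. \<forall>Us. set Us \<subseteq> A \<and> length Us = n \<longrightarrow> qprod I Us = coset I 0)"

definition qlocally_nilpotent :: "('a list \<Rightarrow>\<^sub>0 'k::field) set \<Rightarrow> ('a list \<Rightarrow>\<^sub>0 'k) set set \<Rightarrow> bool" where
  "qlocally_nilpotent I A \<longleftrightarrow> (\<forall>F. finite F \<and> F \<subseteq> A \<longrightarrow> qnilpotent I (qsubalgebra I hull F))"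


section \<open>Tensor products\<close>

definition tensor_rel :: "('k::field \<Rightarrow> 'x::ab_group_add \<Rightarrow> 'x) \<Rightarrow> ('k \<Rightarrow> 'l::ab_group_add \<Rightarrow> 'l)
    \<Rightarrow> (('x \<times> 'l) \<Rightarrow>\<^sub>0 'k) set" where
  "tensor_rel sX sL = free.span
     (range (\<lambda>(y, z, a). gen (y + z, a) - gen (y, a) - gen (z, a))
    \<union> range (\<lambda>(y, a, b). gen (y, a + b) - gen (y, a) - gen (y, b))
    \<union> range (\<lambda>(c, y, a). gen (sX c y, a) - fscale c (gen (y, a)))
    \<union> range (\<lambda>(c, y, a). gen (y, sL c a) - fscale c (gen (y, a))))"

definition linearity_relations :: "('k::field \<Rightarrow> 'v::ab_group_add \<Rightarrow> 'v) \<Rightarrow> ('v list \<Rightarrow>\<^sub>0 'k) set" where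
  "linearity_relations s =
     range (\<lambda>(a, b). gen [a + b] - gen [a] - gen [b])
   \<union> range (\<lambda>(c, a). gen [s c a] - fscale c (gen [a]))"

text \<open>
  The tensor algebra of a vector space is the quotient of the free algebra on its underlying set by
  this ideal; \<open>x\<^sub>1 \<otimes> \<dots> \<otimes> x\<^sub>n\<close> is the class of the word \<open>[x\<^sub>1, \<dots>, x\<^sub>n]\<close>.
\<close>

definition tensor_algebra_ideal :: "('k::field \<Rightarrow> 'v::ab_group_add \<Rightarrow> 'v) \<Rightarrow> ('v list \<Rightarrow>\<^sub>0 'k) set" where
  "tensor_algebra_ideal s = two_sided_ideal hull linearity_relations s"


section \<open>Restricted Lie algebras\<close>

text \<open>
  The term \<open>s\<^sub>1(a,b) + \<dots> + s\<^bsub>p-1\<^esub>(a,b)\<close> of Jacobson's formula, where \<open>i s\<^sub>i(a,b)\<close> is the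
  coefficient of \<open>t\<^bsup>i-1\<^esup>\<close> in \<open>ad(ta + b)\<^bsup>p-1\<^esup>(a)\<close>. That coefficient is the sum of the
  \<open>ad(c\<^sub>1) \<dots> ad(c\<^bsub>p-1\<^esub>)(a)\<close> over the words \<open>c\<close> in \<open>a, b\<close> with exactly \<open>i - 1\<close> letters \<open>a\<close>;
  words are encoded by Booleans. The operations are arguments because the formula is
  needed both for a Lie algebra on a type and for the wreath product.
\<close>

definition jacobson_sum :: "nat \<Rightarrow> ('a \<Rightarrow> 'a \<Rightarrow> 'a) \<Rightarrow> 'a \<Rightarrow> ('k::field \<Rightarrow> 'a \<Rightarrow> 'a)
    \<Rightarrow> ('a \<Rightarrow> 'a \<Rightarrow> 'a) \<Rightarrow> 'a \<Rightarrow> 'a \<Rightarrow> 'a" where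
  "jacobson_sum p add zero scale brk a b =
     (let total = (\<lambda>cs. foldr add cs zero);
          coeff = (\<lambda>j. total (map (\<lambda>w. foldr (\<lambda>t. brk (if t then a else b)) w a)
                     (filter (\<lambda>w. count_list w True = j) (List.n_lists (p - 1) [True, False]))))
      in total (map (\<lambda>i. scale (1 / of_nat i) (coeff (i - 1))) [1..<p]))"

locale restricted_lie_algebra = vector_space scale
  for p :: nat
    and scale :: "'k::field \<Rightarrow> 'l::ab_group_add \<Rightarrow> 'l"
    and brk :: "'l \<Rightarrow> 'l \<Rightarrow> 'l"
    and pm :: "'l \<Rightarrow> 'l" +
  assumes char: "CHAR('k) = p" and p_pos: "p > 0"
    and brk_linear_left: "Vector_Spaces.linear scale scale (\<lambda>a. brk a b)"
    and brk_linear_right: "Vector_Spaces.linear scale scale (\<lambda>b. brk a b)"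
    and brk_self: "brk a a = 0"
    and jacobi: "\<And>a b c. brk a (brk b c) + brk b (brk c a) + brk c (brk a b) = 0"
    and pm_scale: "\<And>c a. pm (scale c a) = scale (c ^ p) (pm a)"
    and pm_ad: "brk (pm a) b = (brk a ^^ p) b"
    and pm_add: "pm (a + b) = pm a + pm b + jacobson_sum p (+) 0 scale brk a b"

definition restricted_lie_subalgebra :: "('k::field \<Rightarrow> 'l::ab_group_add \<Rightarrow> 'l) \<Rightarrow> ('l \<Rightarrow> 'l \<Rightarrow> 'l)
    \<Rightarrow> ('l \<Rightarrow> 'l) \<Rightarrow> 'l set \<Rightarrow> bool" where
  "restricted_lie_subalgebra scale brk pm A \<longleftrightarrow> module.subspace scale A
     \<and> (\<forall>a\<in>A. \<forall>b\<in>A. brk a b \<in> A) \<and> (\<forall>a\<in>A. pm a \<in> A)"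

text \<open>
  The restricted universal enveloping algebra is the quotient of the tensor algebra by the
  Lie and \<open>p\<close>-power relations; the two quotients of the free algebra are taken in one step.
\<close>

definition uea_ideal :: "nat \<Rightarrow> ('k::field \<Rightarrow> 'l::ab_group_add \<Rightarrow> 'l) \<Rightarrow> ('l \<Rightarrow> 'l \<Rightarrow> 'l)
    \<Rightarrow> ('l \<Rightarrow> 'l) \<Rightarrow> ('l list \<Rightarrow>\<^sub>0 'k) set" where
  "uea_ideal p scale brk pm = two_sided_ideal hull (linearity_relations scale
     \<union> range (\<lambda>(a, b). gen [a] * gen [b] - gen [b] * gen [a] - gen [brk a b])
     \<union> range (\<lambda>a. gen [a] ^ p - gen [pm a]))"


section \<open>Self-similar Lie algebras\<close>

locale comm_unital_algebra = vector_space scale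
  for scale :: "'k::field \<Rightarrow> 'x::comm_ring_1 \<Rightarrow> 'x" +
  assumes scale_mult: "scale c (x * y) = scale c x * y"

definition derivations :: "('k::field \<Rightarrow> 'x::comm_ring_1 \<Rightarrow> 'x) \<Rightarrow> ('x \<Rightarrow> 'x) set" where
  "derivations sX = {\<delta>. Vector_Spaces.linear sX sX \<delta> \<and> (\<forall>x y. \<delta> (x * y) = \<delta> x * y + x * \<delta> y)}"

text \<open>
  An element of the wreath product is a pair of an element of the tensor product of \<open>X\<close> and the
  Lie algebra (a coset of \<^const>\<open>tensor_rel\<close>) and a derivation of \<open>X\<close>.
\<close>

type_synonym ('k, 'x, 'l) wreath = "(('x \<times> 'l) \<Rightarrow>\<^sub>0 'k) set \<times> ('x \<Rightarrow> 'x)"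

definition tensor :: "('k::field \<Rightarrow> 'x::comm_ring_1 \<Rightarrow> 'x) \<Rightarrow> ('k \<Rightarrow> 'l::ab_group_add \<Rightarrow> 'l)
    \<Rightarrow> 'x \<Rightarrow> 'l \<Rightarrow> (('x \<times> 'l) \<Rightarrow>\<^sub>0 'k) set" where
  "tensor sX sL y a = coset (tensor_rel sX sL) (gen (y, a))"

definition wreath :: "('k::field \<Rightarrow> 'x::comm_ring_1 \<Rightarrow> 'x) \<Rightarrow> ('k \<Rightarrow> 'l::ab_group_add \<Rightarrow> 'l)
    \<Rightarrow> ('k, 'x, 'l) wreath set" where
  "wreath sX sL = quotient_space (tensor_rel sX sL) \<times> derivations sX"

definition wr_zero :: "('k::field \<Rightarrow> 'x::comm_ring_1 \<Rightarrow> 'x) \<Rightarrow> ('k \<Rightarrow> 'l::ab_group_add \<Rightarrow> 'l)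
    \<Rightarrow> ('k, 'x, 'l) wreath" where
  "wr_zero sX sL = (coset (tensor_rel sX sL) 0, \<lambda>x. 0)"

definition wr_add :: "('k::field \<Rightarrow> 'x::comm_ring_1 \<Rightarrow> 'x) \<Rightarrow> ('k \<Rightarrow> 'l::ab_group_add \<Rightarrow> 'l)
    \<Rightarrow> ('k, 'x, 'l) wreath \<Rightarrow> ('k, 'x, 'l) wreath \<Rightarrow> ('k, 'x, 'l) wreath" where
  "wr_add sX sL = (\<lambda>(U, \<delta>) (V, \<epsilon>). (lift2 (tensor_rel sX sL) (+) U V, \<lambda>x. \<delta> x + \<epsilon> x))"

definition wr_scale :: "('k::field \<Rightarrow> 'x::comm_ring_1 \<Rightarrow> 'x) \<Rightarrow> ('k \<Rightarrow> 'l::ab_group_add \<Rightarrow> 'l)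
    \<Rightarrow> 'k \<Rightarrow> ('k, 'x, 'l) wreath \<Rightarrow> ('k, 'x, 'l) wreath" where
  "wr_scale sX sL c = (\<lambda>(U, \<delta>). (lift1 (tensor_rel sX sL) (fscale c) U, \<lambda>x. sX c (\<delta> x)))"

text \<open>
  \<open>tensor_brk\<close> and \<open>tensor_der\<close> extend \<open>[y \<otimes> a, z \<otimes> b] = yz \<otimes> [a, b]\<close> and
  \<open>[\<delta>, y \<otimes> a] = \<delta>(y) \<otimes> a\<close> to formal linear combinations of elementary tensors.
\<close>

definition tensor_brk :: "('l \<Rightarrow> 'l \<Rightarrow> 'l) \<Rightarrow> (('x::comm_ring_1 \<times> 'l) \<Rightarrow>\<^sub>0 'k::field)
    \<Rightarrow> (('x \<times> 'l) \<Rightarrow>\<^sub>0 'k) \<Rightarrow> (('x \<times> 'l) \<Rightarrow>\<^sub>0 'k)" where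
  "tensor_brk brk u v = lin_ext (\<lambda>(y, a). lin_ext (\<lambda>(z, b). gen (y * z, brk a b)) v) u"

definition tensor_der :: "('x \<Rightarrow> 'x) \<Rightarrow> (('x \<times> 'l) \<Rightarrow>\<^sub>0 'k::field) \<Rightarrow> (('x \<times> 'l) \<Rightarrow>\<^sub>0 'k)" where
  "tensor_der \<delta> = lin_ext (\<lambda>(y, a). gen (\<delta> y, a))"

definition wr_brk :: "('k::field \<Rightarrow> 'x::comm_ring_1 \<Rightarrow> 'x) \<Rightarrow> ('k \<Rightarrow> 'l::ab_group_add \<Rightarrow> 'l)
    \<Rightarrow> ('l \<Rightarrow> 'l \<Rightarrow> 'l) \<Rightarrow> ('k, 'x, 'l) wreath \<Rightarrow> ('k, 'x, 'l) wreath \<Rightarrow> ('k, 'x, 'l) wreath" where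
  "wr_brk sX sL brk = (\<lambda>(U, \<delta>) (V, \<epsilon>).
     (lift2 (tensor_rel sX sL) (\<lambda>u v. tensor_brk brk u v + tensor_der \<delta> v - tensor_der \<epsilon> u) U V,
      \<lambda>x. \<delta> (\<epsilon> x) - \<epsilon> (\<delta> x)))"

text \<open>
  The graph of the \<open>p\<close>-mapping of the wreath product. It is determined by
  \<open>(y \<otimes> a)\<^sup>p = y\<^sup>p \<otimes> a\<^sup>p\<close>, by the \<open>p\<close>-fold composition on derivations, and by Jacobson's formula
  for sums. Scalars are absorbed into the elementary tensors and derivations, which
  therefore generate the wreath product additively.
\<close>

inductive wr_pm :: "nat \<Rightarrow> ('k::field \<Rightarrow> 'x::comm_ring_1 \<Rightarrow> 'x) \<Rightarrow> ('k \<Rightarrow> 'l::ab_group_add \<Rightarrow> 'l)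
    \<Rightarrow> ('l \<Rightarrow> 'l \<Rightarrow> 'l) \<Rightarrow> ('l \<Rightarrow> 'l) \<Rightarrow> ('k, 'x, 'l) wreath \<Rightarrow> ('k, 'x, 'l) wreath \<Rightarrow> bool"
  for p sX sL brk pm where
  tensor: "wr_pm p sX sL brk pm (tensor sX sL y a, \<lambda>x. 0) (tensor sX sL (y ^ p) (pm a), \<lambda>x. 0)"
| derivation: "\<delta> \<in> derivations sX \<Longrightarrow>
    wr_pm p sX sL brk pm (coset (tensor_rel sX sL) 0, \<delta>) (coset (tensor_rel sX sL) 0, \<delta> ^^ p)"
| add: "wr_pm p sX sL brk pm v v' \<Longrightarrow> wr_pm p sX sL brk pm w w' \<Longrightarrow>
    wr_pm p sX sL brk pm (wr_add sX sL v w)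
      (wr_add sX sL (wr_add sX sL v' w')
        (jacobson_sum p (wr_add sX sL) (wr_zero sX sL) (wr_scale sX sL) (wr_brk sX sL brk) v w))"

text \<open>
  The action on words. The formal sum \<open>\<Sum> y\<^sub>i \<otimes> a\<^sub>i\<close> representing the first component of \<open>\<psi>(a)\<close> is
  chosen arbitrarily; for linear \<open>\<psi>\<close> the class of the result in the tensor algebra does not depend
  on it. The factor \<open>gen [x * y]\<close> prepends \<open>x y\<close> to words.
\<close>

primrec act_word :: "('l \<Rightarrow> ('k::field, 'x::comm_ring_1, 'l) wreath) \<Rightarrow> 'x list \<Rightarrow> 'l \<Rightarrow> ('x list \<Rightarrow>\<^sub>0 'k)" where
  "act_word \<psi> [] a = 0"
| "act_word \<psi> (x # xs) a =
     lin_ext (\<lambda>(y, b). gen [x * y] * act_word \<psi> xs b) (SOME u. u \<in> fst (\<psi> a))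
     + gen (snd (\<psi> a) x # xs)"

definition act :: "('k::field \<Rightarrow> 'x::comm_ring_1 \<Rightarrow> 'x) \<Rightarrow> ('l \<Rightarrow> ('k, 'x, 'l) wreath)
    \<Rightarrow> 'l \<Rightarrow> ('x list \<Rightarrow>\<^sub>0 'k) set \<Rightarrow> ('x list \<Rightarrow>\<^sub>0 'k) set" where
  "act sX \<psi> a = lift1 (tensor_algebra_ideal sX) (lin_ext (\<lambda>xs. act_word \<psi> xs a))"

locale self_similar_lie_algebra =
  L: restricted_lie_algebra p sL brk pm + X: comm_unital_algebra sX
  for p :: nat
    and sL :: "'k::field \<Rightarrow> 'l::ab_group_add \<Rightarrow> 'l"
    and brk :: "'l \<Rightarrow> 'l \<Rightarrow> 'l"
    and pm :: "'l \<Rightarrow> 'l"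
    and sX :: "'k \<Rightarrow> 'x::comm_ring_1 \<Rightarrow> 'x" +
  fixes \<psi> :: "'l \<Rightarrow> ('k, 'x, 'l) wreath"
  assumes psi_wreath: "\<psi> a \<in> wreath sX sL"
    and psi_add: "\<psi> (a + b) = wr_add sX sL (\<psi> a) (\<psi> b)"
    and psi_scale: "\<psi> (sL c a) = wr_scale sX sL c (\<psi> a)"
    and psi_brk: "\<psi> (brk a b) = wr_brk sX sL brk (\<psi> a) (\<psi> b)"
    and psi_pm: "wr_pm p sX sL brk pm (\<psi> a) (\<psi> (pm a))"
    and faithful: "(\<And>t. t \<in> quotient_space (tensor_algebra_ideal sX) \<Longrightarrow>
        act sX \<psi> a t = coset (tensor_algebra_ideal sX) 0) \<Longrightarrow> a = 0"


section \<open>Gradings\<close>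

definition grading :: "('k::field \<Rightarrow> 'v::ab_group_add \<Rightarrow> 'v) \<Rightarrow> (real \<Rightarrow> 'v set) \<Rightarrow> bool" where
  "grading s G \<longleftrightarrow> (\<forall>d. module.subspace s (G d))
     \<and> (\<forall>v. \<exists>!f :: real \<Rightarrow>\<^sub>0 'v. (\<forall>d. Poly_Mapping.lookup f d \<in> G d)
          \<and> v = (\<Sum>d\<in>Poly_Mapping.keys f. Poly_Mapping.lookup f d))"

definition product_grading :: "('k::field \<Rightarrow> 'v::ab_group_add \<Rightarrow> 'v) \<Rightarrow> ('v \<Rightarrow> 'v \<Rightarrow> 'v)
    \<Rightarrow> (real \<Rightarrow> 'v set) \<Rightarrow> bool" where
  "product_grading s m G \<longleftrightarrow> grading s G \<and> (\<forall>d e. \<forall>a\<in>G d. \<forall>b\<in>G e. m a b \<in> G (d + e))"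

text \<open>
  A zero elementary tensor imposes no condition here, because \<open>0\<close> is homogeneous of every degree;
  likewise the zero derivation. Scalar coefficients of \<open>u\<close> do not affect homogeneity.
\<close>

definition compatible_gradings :: "('k::field \<Rightarrow> 'l::ab_group_add \<Rightarrow> 'l) \<Rightarrow> ('l \<Rightarrow> 'l \<Rightarrow> 'l)
    \<Rightarrow> ('k \<Rightarrow> 'x::comm_ring_1 \<Rightarrow> 'x) \<Rightarrow> ('l \<Rightarrow> ('k, 'x, 'l) wreath)
    \<Rightarrow> real \<Rightarrow> (real \<Rightarrow> 'l set) \<Rightarrow> (real \<Rightarrow> 'x set) \<Rightarrow> bool" where
  "compatible_gradings sL brk sX \<psi> dil GL GX \<longleftrightarrow>
     product_grading sL brk GL \<and> product_grading sX (*) GX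
     \<and> (\<forall>d. \<forall>a\<in>GL d.
          (\<exists>u\<in>fst (\<psi> a). \<forall>(y, b)\<in>Poly_Mapping.keys u. \<exists>e f. y \<in> GX e \<and> b \<in> GL f \<and> d = e + dil * f)
        \<and> (\<forall>e. \<forall>x\<in>GX e. snd (\<psi> a) x \<in> GX (e + d)))"

text \<open>
  The homogeneous elements of degree \<open>d\<close> in the quotient of the free algebra by \<open>I\<close>, for the
  grading induced by \<open>G\<close>: linear combinations of products \<open>a\<^sub>1 \<dots> a\<^sub>n\<close> (\<open>n \<ge> 0\<close>) of homogeneous elements
  whose degrees add up to \<open>d\<close>.
\<close>

definition induced_homogeneous :: "('a list \<Rightarrow>\<^sub>0 'k::field) set \<Rightarrow> (real \<Rightarrow> 'a set) \<Rightarrow> real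
    \<Rightarrow> ('a list \<Rightarrow>\<^sub>0 'k) set set" where
  "induced_homogeneous I G d = qsubspace I hull
     {coset I (gen as) | as. \<exists>ds. list_all2 (\<lambda>a e. a \<in> G e) as ds \<and> sum_list ds = d}"

definition homogeneous_span :: "('a list \<Rightarrow>\<^sub>0 'k::field) set \<Rightarrow> (real \<Rightarrow> 'a set) \<Rightarrow> real set
    \<Rightarrow> ('a list \<Rightarrow>\<^sub>0 'k) set set" where
  "homogeneous_span I G D = qsubspace I hull (\<Union>d\<in>D. induced_homogeneous I G d)"

end

theory Submission
  imports Defs
begin

text \<open>
  The action on words is faithful and, after choosing a homogeneous basis of the alphabet, every
  homogeneous element shifts the degree of words. Hence the \<open>p\<close>-mapping multiplies degrees by \<open>p\<close>,
  and the recursion \<open>\<psi>\<close> bounds the \<open>\<mu>\<close>-degrees occurring in \<open>\<lambda>\<close>-degree at most \<open>n\<close> by a constant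
  plus \<open>\<bar>\<mu>\<bar>\<close> times the bound for \<open>(n + K) / \<lambda>\<close>; as \<open>\<bar>\<mu>\<bar> < \<lambda>\<close>, they grow sublinearly in \<open>n\<close>.

  The iterated brackets and \<open>p\<close>-powers of the generators (the letters) span the Lie algebra, and
  there are finitely many of each weight. In the restricted enveloping algebra, a word in the letters
  can be rewritten, keeping its weight, so that no letter of small weight occurs \<open>p\<close> times; it then contains boundedly
  many letters of small weight, so \<open>\<mu>\<close>-degrees grow sublinearly in the weight here too. A long
  product of elements of positive \<open>\<mu>\<close>-degree would have to grow linearly and therefore vanishes.
\<close>

section \<open>Jacobson's formula\<close>

text \<open>The gradings are compatible with the bracket only, so the effect of \<open>pm\<close> on
  degrees must be proved, by recovering an element from its action. The \<open>p\<close>-mapping of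
  the wreath product is known on elementary tensors and derivations, and otherwise through
  Jacobson's formula; hence that formula comes first, for rings and for operators. The action lives
  on a quotient; expanding letters in a basis of \<open>X\<close> turns congruences there into
  equalities of linear operators. The letters are homogeneous for the first grading but need not be
  so for the second, as nothing is assumed about the second degrees of the generators. Growth is
  therefore measured by intervals in which the homogeneous components lie. In the enveloping
  algebra, components come from a coaction with values in a group algebra: it is checked on the
  relations alone, without a basis of the enveloping algebra. The integer weight of a letter,
  comparable with its first degree, is what rewriting preserves and what finiteness counts.\<close>

lemma jacobson_sum_rel:
  assumes "R z z'"
    and "\<And>x x' y y'. R x x' \<Longrightarrow> R y y' \<Longrightarrow> R (add x y) (add' x' y')"
    and "\<And>c x x'. R x x' \<Longrightarrow> R (sc c x) (sc' c x')"
    and "\<And>x x' y y'. R x x' \<Longrightarrow> R y y' \<Longrightarrow> R (brk x y) (brk' x' y')"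
    and "R a a'" "R b b'"
  shows "R (jacobson_sum p add z sc brk a b) (jacobson_sum p add' z' sc' brk' a' b')"
proof -
  \<comment> \<open>Parametricity: the sum is a term in the four operations, so a relation that they
    respect passes through its folds. Below, \<open>R\<close> is evaluation of a free algebra at
    operators, the action of the wreath product on words, membership in a subspace, and congruence
    modulo an ideal.\<close>
  have total: "R (foldr add (map f xs) z) (foldr add' (map f' xs) z')"
    if "\<And>x. R (f x) (f' x)" for xs :: "'x list" and f f'
    using that by (induction xs) (auto intro: assms)
  have ad: "R (foldr (\<lambda>t. brk (if t then a else b)) w a) (foldr (\<lambda>t. brk' (if t then a' else b')) w a')" for w
    by (induction w) (auto intro: assms)
  show ?thesis
    unfolding jacobson_sum_def Let_def by (intro total assms(3) ad)
qed

text \<open>Left and right multiplication by \<open>c\<close> commute, so this is the binomial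
  theorem for their difference; the induction is Pascal's rule.\<close>

lemma ad_power:
  fixes a c :: "'a::ring_1"
  shows "((\<lambda>x. c * x - x * c) ^^ n) a
    = (\<Sum>j\<le>n. (-1) ^ (n - j) * of_nat (n choose j) * (c ^ j * a * c ^ (n - j)))"
proof (induction n)
  case (Suc n)
  let ?t = "\<lambda>i j. c ^ i * a * c ^ j"
  have m1: "c * ((-1) ^ k * x) = (-1) ^ k * (c * x)" for k :: nat and x
    by (cases "even k") simp_all
  have m2: "c * (of_nat m * x) = of_nat m * (c * x)" for m :: nat and x
    by (metis mult.assoc mult_of_nat_commute)
  have pw: "c ^ i * c = c * c ^ i" for i by (simp add: power_commutes)
  have "((\<lambda>x. c * x - x * c) ^^ Suc n) a
      = (\<Sum>j\<le>n. (-1) ^ (n - j) * of_nat (n choose j) * ?t (Suc j) (n - j))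
      - (\<Sum>j\<le>n. (-1) ^ (n - j) * of_nat (n choose j) * ?t j (Suc n - j))"
    using Suc.IH by (simp add: sum_distrib_left sum_distrib_right mult.assoc m1 m2 Suc_diff_le pw)
  also have "(\<Sum>j\<le>n. (-1) ^ (n - j) * of_nat (n choose j) * ?t (Suc j) (n - j))
      = (\<Sum>j\<le>Suc n. (if j = 0 then 0 else (-1) ^ (Suc n - j) * of_nat (n choose (j - 1)) * ?t j (Suc n - j)))"
    by (subst sum.atMost_Suc_shift) simp
  also have "(\<Sum>j\<le>n. (-1) ^ (n - j) * of_nat (n choose j) * ?t j (Suc n - j))
      = (\<Sum>j\<le>Suc n. - ((-1) ^ (Suc n - j) * of_nat (n choose j) * ?t j (Suc n - j)))"
    by (simp add: Suc_diff_le binomial_eq_0)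
  finally have eq: "((\<lambda>x. c * x - x * c) ^^ Suc n) a
      = (\<Sum>j\<le>Suc n. (if j = 0 then 0 else (-1) ^ (Suc n - j) * of_nat (n choose (j - 1)) * ?t j (Suc n - j))
          - - ((-1) ^ (Suc n - j) * of_nat (n choose j) * ?t j (Suc n - j)))"
    by (simp only: sum_subtractf)
  show ?case
    unfolding eq
  proof (intro sum.cong refl)
    fix j
    show "(if j = 0 then 0 else (-1) ^ (Suc n - j) * of_nat (n choose (j - 1)) * ?t j (Suc n - j))
          - - ((-1) ^ (Suc n - j) * of_nat (n choose j) * ?t j (Suc n - j))
        = (-1) ^ (Suc n - j) * of_nat (Suc n choose j) * ?t j (Suc n - j)"
      by (cases j) (simp_all add: distrib_left distrib_right)
  qed
qed simp

text \<open>The prime \<open>p\<close> divides \<open>p choose Suc j\<close>, so by Pascal's rule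
  neighbours in row \<open>p - 1\<close> of Pascal's triangle are opposite modulo
  \<open>p\<close>.\<close>

lemma of_nat_choose_prime_minus_one:
  assumes "prime p" "of_nat p = (0::'a::ring_1)" "j \<le> p - 1"
  shows "of_nat ((p - 1) choose j) = ((-1) ^ j :: 'a)"
  using assms(3)
proof (induction j)
  case (Suc j)
  have p: "p > 0" using assms(1) prime_gt_0_nat by blast
  then have "p choose Suc j = (p - 1 choose j) + (p - 1 choose Suc j)"
    by (metis Suc_pred' binomial_Suc_Suc)
  moreover have "p dvd p choose Suc j"
    using Suc.prems p by (intro dvd_choose_prime assms(1)) auto
  then have "of_nat (p choose Suc j) = (0::'a)"
    using assms(2) by (auto simp: dvd_def)
  ultimately have "of_nat (p - 1 choose j) + of_nat (p - 1 choose Suc j) = (0::'a)"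
    by (metis of_nat_add)
  with Suc show ?case by (simp add: add_eq_0_iff)
qed simp

text \<open>The binomial coefficient \<open>(-1) ^ j\<close> completes the sign to
  \<open>(-1) ^ (p - 1)\<close>, which is \<open>1\<close>: for odd \<open>p\<close> by parity, for
  \<open>p = 2\<close> because \<open>-1 = 1\<close>.\<close>

lemma ad_power_prime:
  fixes a c :: "'a::ring_1"
  assumes "prime p" "of_nat p = (0::'a)"
  shows "((\<lambda>x. c * x - x * c) ^^ (p - 1)) a = (\<Sum>j\<le>p - 1. c ^ j * a * c ^ (p - 1 - j))"
proof -
  have sgn: "(-1) ^ (p - 1) = (1::'a)"
  proof (cases "p = 2")
    case True
    then have "(2::'a) = 0" using assms(2) by simp
    then have "(-1::'a) = 1" by (simp add: eq_neg_iff_add_eq_0 neg_eq_iff_add_eq_0)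
    with True show ?thesis by simp
  next
    case False
    then have "odd p" using assms(1) primes_dvd_imp_eq two_is_prime_nat by blast
    then show ?thesis by simp
  qed
  have "(-1) ^ (p - 1 - j) * of_nat (p - 1 choose j) = (1::'a)" if "j \<le> p - 1" for j
    using that of_nat_choose_prime_minus_one[OF assms that] sgn
    by (metis le_add_diff_inverse2 power_add)
  then show ?thesis unfolding ad_power by (intro sum.cong) auto
qed

text \<open>Leibniz' rule without commutativity. For exponent \<open>p\<close> the sum is the one in
  \<open>ad_power_prime\<close>, so the derivative of a \<open>p\<close>-th power is an iterated
  commutator.\<close>

lemma fps_deriv_power_noncomm:
  fixes c :: "'a::ring_1 fps"
  shows "fps_deriv (c ^ Suc n) = (\<Sum>j\<le>n. c ^ j * fps_deriv c * c ^ (n - j))"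
proof (induction n)
  case (Suc n)
  have "fps_deriv (c ^ Suc (Suc n)) = c ^ Suc n * fps_deriv c + fps_deriv (c ^ Suc n) * c"
    by (metis fps_deriv_mult power_Suc2)
  also have "fps_deriv (c ^ Suc n) * c = (\<Sum>j\<le>n. c ^ j * fps_deriv c * c ^ (Suc n - j))"
    unfolding Suc.IH sum_distrib_right
    by (intro sum.cong refl) (simp add: mult.assoc Suc_diff_le power_commutes)
  finally show ?case by (simp add: add.commute)
qed simp


section \<open>Jacobson's formula in an associative ring\<close>

context
  fixes a b :: "'a::ring_1"
begin

text \<open>The element \<open>ta + b\<close> with a central variable \<open>t\<close>, taken as a
  power series so that it can be differentiated while \<open>a\<close> and \<open>b\<close> do not
  commute.\<close>

definition jacobson_fps :: "'a fps" where
  "jacobson_fps = fps_const b + fps_X * fps_const a"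

lemma fps_X_commute: "fps_X * f = f * (fps_X :: 'a fps)"
  by (rule fps_ext) simp

lemma jacobson_fps_mult_nth:
  "(jacobson_fps * f) $ j = b * f $ j + (if j = 0 then 0 else a * f $ (j - 1))"
  "(f * jacobson_fps) $ j = f $ j * b + (if j = 0 then 0 else f $ (j - 1) * a)"
proof -
  have "jacobson_fps * f = fps_const b * f + fps_X * (fps_const a * f)"
    by (simp add: jacobson_fps_def algebra_simps)
  then show "(jacobson_fps * f) $ j = b * f $ j + (if j = 0 then 0 else a * f $ (j - 1))" by simp
  have "f * jacobson_fps = f * fps_const b + fps_X * (f * fps_const a)"
    by (simp add: jacobson_fps_def distrib_left fps_X_commute mult.assoc)
  then show "(f * jacobson_fps) $ j = f $ j * b + (if j = 0 then 0 else f $ (j - 1) * a)" by simp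
qed

text \<open>Each commutator with \<open>ta + b\<close> contributes a letter \<open>a\<close> with
  one power of \<open>t\<close> or a letter \<open>b\<close> with none, so the coefficient of
  \<open>t ^ j\<close> collects the words with exactly \<open>j\<close> letters \<open>a\<close>.
  This is the shape of \<open>jacobson_sum\<close>.\<close>

lemma jacobson_fps_ad_nth:
  "((\<lambda>x. jacobson_fps * x - x * jacobson_fps) ^^ m) (fps_const a) $ j
    = sum_list (map (\<lambda>w. foldr (\<lambda>t x. (if t then a else b) * x - x * (if t then a else b)) w a)
        (filter (\<lambda>w. count_list w True = j) (List.n_lists m [True, False])))"
proof (induction m arbitrary: j)
  case (Suc m)
  let ?g = "\<lambda>w. foldr (\<lambda>t x. (if t then a else b) * x - x * (if t then a else b)) w a"
  let ?S = "\<lambda>ws j. sum_list (map ?g (filter (\<lambda>w. count_list w True = j) ws))"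
  have "?S (concat (map (\<lambda>ys. map (\<lambda>y. y # ys) [True, False]) ws)) j
      = (if j = 0 then 0 else a * ?S ws (j - 1) - ?S ws (j - 1) * a) + (b * ?S ws j - ?S ws j * b)" for ws
    by (induction ws) (auto simp: algebra_simps)
  then show ?case
    by (simp add: jacobson_fps_mult_nth Suc.IH)
qed simp

text \<open>The sum of the coefficients is the value at \<open>t = 1\<close>. Once the two end
  coefficients are split off, the inner ones are the mixed terms of
  \<open>(a + b) ^ n\<close>.\<close>

lemma jacobson_fps_power_nth:
  "(jacobson_fps ^ n) $ 0 = b ^ n" "(jacobson_fps ^ n) $ n = a ^ n"
  "j > n \<Longrightarrow> (jacobson_fps ^ n) $ j = 0" "(\<Sum>j\<le>n. (jacobson_fps ^ n) $ j) = (a + b) ^ n"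
proof -
  show 0: "(jacobson_fps ^ n) $ 0 = b ^ n" for n
    by (induction n) (simp_all add: jacobson_fps_mult_nth del: fps_mult_nth_0)
  show big: "(jacobson_fps ^ n) $ j = 0" if "j > n" for n j
    using that by (induction n arbitrary: j) (simp_all add: jacobson_fps_mult_nth)
  show "(jacobson_fps ^ n) $ n = a ^ n"
    by (induction n) (simp_all add: jacobson_fps_mult_nth big)
  show "(\<Sum>j\<le>n. (jacobson_fps ^ n) $ j) = (a + b) ^ n"
  proof (induction n)
    case (Suc n)
    have "(\<Sum>j\<le>Suc n. (jacobson_fps ^ Suc n) $ j)
        = (\<Sum>j\<le>Suc n. b * (jacobson_fps ^ n) $ j)
        + (\<Sum>j\<le>Suc n. if j = 0 then 0 else a * (jacobson_fps ^ n) $ (j - 1))"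
      by (simp only: power_Suc jacobson_fps_mult_nth sum.distrib)
    also have "(\<Sum>j\<le>Suc n. if j = 0 then 0 else a * (jacobson_fps ^ n) $ (j - 1))
        = (\<Sum>j\<le>n. a * (jacobson_fps ^ n) $ j)"
      by (subst sum.atMost_Suc_shift) simp
    finally show ?case
      using Suc.IH by (simp add: big algebra_simps flip: sum_distrib_left)
  qed simp
qed

text \<open>The derivative of the \<open>p\<close>-th power of \<open>ta + b\<close> is \<open>ad(ta + b)\<^bsup>p-1\<^esup>(a)\<close>.\<close>

lemma jacobson_formula:
  fixes sc :: "'k::field \<Rightarrow> 'a \<Rightarrow> 'a"
  assumes "prime p" "CHAR('k) = p" "of_nat p = (0::'a)"
    and sc_of_nat: "\<And>n x. sc (of_nat n) x = of_nat n * x"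
    and sc_sc: "\<And>c d x. sc c (sc d x) = sc (c * d) x"
  shows "(a + b) ^ p = a ^ p + b ^ p + jacobson_sum p (+) 0 sc (\<lambda>x y. x * y - y * x) a b"
proof -
  let ?c = "jacobson_fps"
  let ?S = "\<lambda>j. sum_list (map (\<lambda>w. foldr (\<lambda>t x. (if t then a else b) * x - x * (if t then a else b)) w a)
        (filter (\<lambda>w. count_list w True = j) (List.n_lists (p - 1) [True, False])))"
  have p: "p = Suc (p - 1)" using assms(1) prime_gt_0_nat by fastforce
  have char: "of_nat p = (0::'a fps)"
    by (simp add: fps_of_nat[symmetric] assms(3))
  have dc: "fps_deriv ?c = fps_const a"
    by (rule fps_ext) (simp add: jacobson_fps_def)
  \<comment> \<open>Coefficient \<open>i - 1\<close> of the derivative of the \<open>p\<close>-th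
    power, computed in two ways.\<close>
  have S: "of_nat i * (?c ^ p) $ i = ?S (i - 1)" if "i > 0" for i
  proof -
    have "fps_deriv (?c ^ p) = ((\<lambda>x. ?c * x - x * ?c) ^^ (p - 1)) (fps_const a)"
      unfolding ad_power_prime[OF assms(1) char] dc[symmetric] using fps_deriv_power_noncomm p by metis
    then have "fps_deriv (?c ^ p) $ (i - 1) = ?S (i - 1)"
      unfolding jacobson_fps_ad_nth[symmetric] by simp
    with that show ?thesis by simp
  qed
  \<comment> \<open>Division by \<open>i\<close> happens in the field, through \<open>sc\<close>:
    for \<open>0 < i < p\<close> the scalar \<open>of_nat i\<close> is invertible.\<close>
  have S': "sc (1 / of_nat i) (?S (i - 1)) = (?c ^ p) $ i" if "i \<in> {1..<p}" for i
  proof -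
    have "of_nat i \<noteq> (0::'k)"
      using that assms(2) of_nat_eq_0_iff_char_dvd[where ?'a = 'k, of i] by (auto dest: dvd_imp_le)
    then have "sc (1 / of_nat i) (sc (of_nat i) ((?c ^ p) $ i)) = sc (of_nat 1) ((?c ^ p) $ i)"
      by (simp add: sc_sc)
    then show ?thesis using S[of i] that unfolding sc_of_nat by simp
  qed
  have "jacobson_sum p (+) 0 sc (\<lambda>x y. x * y - y * x) a b
      = sum_list (map (\<lambda>i. sc (1 / of_nat i) (?S (i - 1))) [1..<p])"
    unfolding jacobson_sum_def Let_def sum_list.eq_foldr[symmetric] ..
  also have "\<dots> = (\<Sum>i\<in>{1..<p}. (?c ^ p) $ i)"
    using S' by (simp only: interv_sum_list_conv_sum_set_nat set_upt cong: sum.cong)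
  finally have J: "jacobson_sum p (+) 0 sc (\<lambda>x y. x * y - y * x) a b = (\<Sum>i\<in>{1..<p}. (?c ^ p) $ i)" .
  have "{..p} = insert 0 (insert p {1..<p})" using p by auto
  then have "(\<Sum>i\<le>p. (?c ^ p) $ i) = b ^ p + (a ^ p + (\<Sum>i\<in>{1..<p}. (?c ^ p) $ i))"
    using p by (simp add: jacobson_fps_power_nth)
  then show ?thesis
    using J jacobson_fps_power_nth(4)[of p] by (simp add: algebra_simps)
qed

end

section \<open>Free vector spaces and quotients\<close>

lemma free_sum_gen: "u = (\<Sum>i\<in>Poly_Mapping.keys u. fscale (Poly_Mapping.lookup u i) (gen i))"
proof (rule poly_mapping_eqI)
  fix k
  have "(\<Sum>i\<in>Poly_Mapping.keys u. Poly_Mapping.lookup u i * (if i = k then 1 else 0)) = Poly_Mapping.lookup u k"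
    by (cases "k \<in> Poly_Mapping.keys u")
      (simp_all add: sum.delta' if_distrib[where f = "\<lambda>x. _ * x"] in_keys_iff cong: if_cong)
  then show "Poly_Mapping.lookup u k
      = Poly_Mapping.lookup (\<Sum>i\<in>Poly_Mapping.keys u. fscale (Poly_Mapping.lookup u i) (gen i)) k"
    by (simp add: lookup_sum lookup_fscale lookup_single when_def)
qed

lemma free_induct [case_names gen zero add scale]:
  assumes "\<And>i. P (gen i)" "P 0" "\<And>u v. P u \<Longrightarrow> P v \<Longrightarrow> P (u + v)" "\<And>c u. P u \<Longrightarrow> P (fscale c u)"
  shows "P u"
proof -
  have "P (\<Sum>i\<in>S. fscale (Poly_Mapping.lookup u i) (gen i))" if "finite S" for S
    using that by (induction S) (auto intro: assms)
  then show ?thesis by (subst free_sum_gen) simp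
qed

lemma lin_ext_linear:
  fixes f :: "'i \<Rightarrow> ('j \<Rightarrow>\<^sub>0 'k::field)"
  shows "Vector_Spaces.linear fscale fscale (lin_ext f)"
proof -
  \<comment> \<open>Keys may disappear in sums and multiples, so linear combinations are compared
    over one common finite superset.\<close>
  have sup: "lin_ext f u = (\<Sum>i\<in>S. fscale (Poly_Mapping.lookup u i) (f i))"
    if "finite S" "Poly_Mapping.keys u \<subseteq> S" for u :: "'i \<Rightarrow>\<^sub>0 'k" and S
    unfolding lin_ext_def using that by (intro sum.mono_neutral_left) (auto simp: in_keys_iff)
  show ?thesis
  proof (unfold_locales)
    fix u v :: "'i \<Rightarrow>\<^sub>0 'k" and c
    let ?S = "Poly_Mapping.keys u \<union> Poly_Mapping.keys v"
    have "lin_ext f (u + v) = (\<Sum>i\<in>?S. fscale (Poly_Mapping.lookup (u + v) i) (f i))"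
      by (rule sup) (use keys_add[of u v] in auto)
    then show "lin_ext f (u + v) = lin_ext f u + lin_ext f v"
      by (simp add: sup[of ?S] lookup_add free.scale_left_distrib sum.distrib)
    have "lin_ext f (fscale c u) = (\<Sum>i\<in>Poly_Mapping.keys u. fscale (Poly_Mapping.lookup (fscale c u) i) (f i))"
      by (rule sup) (auto simp: in_keys_iff lookup_fscale)
    then show "lin_ext f (fscale c u) = fscale c (lin_ext f u)"
      by (simp add: lookup_fscale lin_ext_def free.scale_sum_right)
  qed
qed

lemma lin_ext_add: "lin_ext f (u + v) = lin_ext f u + lin_ext f v"
  and lin_ext_fscale: "lin_ext f (fscale c u) = fscale c (lin_ext f u)"
proof -
  interpret Vector_Spaces.linear fscale fscale "lin_ext f" by (rule lin_ext_linear)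
  show "lin_ext f (u + v) = lin_ext f u + lin_ext f v" by (rule add)
  show "lin_ext f (fscale c u) = fscale c (lin_ext f u)" by (rule scale)
qed

lemma lin_ext_zero [simp]: "lin_ext f 0 = 0"
  by (simp add: lin_ext_def)

lemma lin_ext_diff: "lin_ext f (u - v) = lin_ext f u - lin_ext f v"
  by (metis add_diff_cancel_right' diff_add_cancel lin_ext_add)

lemma lin_ext_sum: "lin_ext f (sum g S) = (\<Sum>i\<in>S. lin_ext f (g i))"
  by (induction S rule: infinite_finite_induct) (simp_all add: lin_ext_add)

lemma lin_ext_gen [simp]: "lin_ext f (gen i) = f i"
  by (simp add: lin_ext_def)

lemma lin_ext_cong_keys: "(\<And>i. i \<in> Poly_Mapping.keys u \<Longrightarrow> f i = g i) \<Longrightarrow> lin_ext f u = lin_ext g u"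
  by (simp add: lin_ext_def)

lemma lin_ext_fun_add: "lin_ext (\<lambda>i. f i + g i) u = lin_ext f u + lin_ext g u"
  by (simp add: lin_ext_def free.scale_right_distrib sum.distrib)

lemma lin_ext_fun_diff: "lin_ext (\<lambda>i. f i - g i) u = lin_ext f u - lin_ext g u"
  by (simp add: lin_ext_def free.scale_right_diff_distrib sum_subtractf)

lemma lin_ext_fun_fscale: "lin_ext (\<lambda>i. fscale c (f i)) u = fscale c (lin_ext f u)"
  by (simp add: lin_ext_def free.scale_sum_right mult.commute)

lemma lin_ext_fun_zero: "lin_ext (\<lambda>i. 0) u = 0"
  by (simp add: lin_ext_def)

lemma linear_lin_ext:
  assumes "Vector_Spaces.linear fscale fscale F"
  shows "F (lin_ext f u) = lin_ext (\<lambda>i. F (f i)) u"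
proof -
  interpret Vector_Spaces.linear fscale fscale F by fact
  show ?thesis by (simp add: lin_ext_def sum scale)
qed

lemma linear_eq_lin_ext:
  assumes "Vector_Spaces.linear fscale fscale F"
  shows "F u = lin_ext (\<lambda>i. F (gen i)) u"
proof -
  interpret Vector_Spaces.linear fscale fscale F by fact
  show ?thesis by (subst free_sum_gen) (simp add: lin_ext_def sum scale)
qed

lemma lin_ext_swap:
  "lin_ext (\<lambda>i. lin_ext (f i) v) u = lin_ext (\<lambda>j. lin_ext (\<lambda>i. f i j) u) v"
  unfolding lin_ext_def
  by (simp add: free.scale_sum_right sum.swap[of _ "Poly_Mapping.keys u"] mult.commute)

lemma lin_ext_in_subspace:
  assumes "free.subspace S" "\<And>i. i \<in> Poly_Mapping.keys u \<Longrightarrow> f i \<in> S"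
  shows "lin_ext f u \<in> S"
  unfolding lin_ext_def by (intro free.subspace_sum free.subspace_scale assms)

lemma fscale_eq_mult: "fscale c u = Poly_Mapping.single 0 c * u"
  by (simp add: fscale_def mult_map_scale_conv_mult)

lemma single_0_mult_commute: "Poly_Mapping.single 0 c * u = u * Poly_Mapping.single 0 (c::'k::field)"
proof (induction u rule: free_induct)
  case (scale d u)
  have "Poly_Mapping.single 0 c * fscale d u = fscale d (Poly_Mapping.single 0 c * u)"
    unfolding fscale_eq_mult mult.assoc[symmetric] by (simp add: mult_single mult.commute)
  with scale show ?case by (simp add: fscale_eq_mult mult.assoc)
qed (simp_all add: mult_single algebra_simps)

lemma fscale_mult_left: "fscale c u * v = fscale c (u * v)"
  and fscale_mult_right: "u * fscale c v = fscale c (u * v)"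
proof -
  show "fscale c u * v = fscale c (u * v)" by (simp add: fscale_eq_mult mult.assoc)
  show "u * fscale c v = fscale c (u * v)"
    unfolding fscale_eq_mult by (metis mult.assoc single_0_mult_commute)
qed

lemma fscale_of_nat: "fscale (of_nat n) u = of_nat n * u"
  by (simp add: fscale_eq_mult flip: single_of_nat)

lemma free_algebra_char: "CHAR('k::field) = p \<Longrightarrow> of_nat p = (0 :: 'a::monoid_add \<Rightarrow>\<^sub>0 'k)"
  by (metis of_nat_CHAR single_of_nat single_zero)

lemma zero_eq_Nil: "(0::'a list) = []" and plus_eq_append: "(as::'a list) + bs = as @ bs"
  by (simp_all add: zero_list_def plus_list_def)

lemma gen_Nil: "gen [] = 1"
  by (metis single_one zero_eq_Nil)

lemma gen_append: "gen (as @ bs) = gen as * gen bs"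
  by (simp add: mult_single plus_eq_append)

lemma gen_Cons: "gen (a # as) = gen [a] * gen as"
  by (simp add: mult_single plus_eq_append)

text \<open>The parameter \<open>h\<close> plays the role of the structure map of a \<open>'k\<close>-algebra \<open>'b\<close>.\<close>

definition alg_ext :: "('k::field \<Rightarrow> 'b::ring_1) \<Rightarrow> ('i \<Rightarrow> 'b) \<Rightarrow> ('i \<Rightarrow>\<^sub>0 'k) \<Rightarrow> 'b" where
  "alg_ext h f u = (\<Sum>i\<in>Poly_Mapping.keys u. h (Poly_Mapping.lookup u i) * f i)"

text \<open>The universal property of a monoid algebra: a multiplicative \<open>f\<close> and a
  central \<open>h\<close> extend to a ring homomorphism. It is used for normal forms, with values
  in the free algebra itself, and for the coaction, with values in a group algebra over it.\<close>

locale alg_hom =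
  fixes h :: "'k::field \<Rightarrow> 'b::ring_1" and f :: "'i::monoid_add \<Rightarrow> 'b"
  assumes h_add: "h (c + d) = h c + h d" and h_mult: "h (c * d) = h c * h d" and h_1: "h 1 = 1"
    and h_central: "h c * x = x * h c"
    and f_0: "f 0 = 1" and f_add: "f (i + j) = f i * f j"
begin

lemma h_0: "h 0 = 0"
  using h_add[of 0 0] by simp

lemma superset:
  assumes "finite S" "Poly_Mapping.keys u \<subseteq> S"
  shows "alg_ext h f u = (\<Sum>i\<in>S. h (Poly_Mapping.lookup u i) * f i)"
  unfolding alg_ext_def using assms by (intro sum.mono_neutral_left) (auto simp: in_keys_iff h_0)

lemma ext_add: "alg_ext h f (u + v) = alg_ext h f u + alg_ext h f v"
proof -
  let ?S = "Poly_Mapping.keys u \<union> Poly_Mapping.keys v"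
  have "alg_ext h f (u + v) = (\<Sum>i\<in>?S. h (Poly_Mapping.lookup (u + v) i) * f i)"
    by (rule superset) (use keys_add[of u v] in auto)
  then show ?thesis
    by (simp add: superset[of ?S] lookup_add h_add distrib_right sum.distrib)
qed

lemma ext_zero: "alg_ext h f 0 = 0"
  by (simp add: alg_ext_def)

lemma ext_diff: "alg_ext h f (u - v) = alg_ext h f u - alg_ext h f v"
  by (metis ext_add add_diff_cancel_right' diff_add_cancel)

lemma ext_gen: "alg_ext h f (gen i) = f i"
  by (simp add: alg_ext_def h_1)

lemma ext_scale: "alg_ext h f (fscale c u) = h c * alg_ext h f u"
proof -
  have "alg_ext h f (fscale c u) = (\<Sum>i\<in>Poly_Mapping.keys u. h (Poly_Mapping.lookup (fscale c u) i) * f i)"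
    by (rule superset) (auto simp: in_keys_iff lookup_fscale)
  then show ?thesis by (simp add: lookup_fscale h_mult mult.assoc alg_ext_def sum_distrib_left)
qed

lemma ext_mult: "alg_ext h f (u * v) = alg_ext h f u * alg_ext h f v"
proof (induction u rule: free_induct)
  case (gen i)
  show ?case
  proof (induction v rule: free_induct)
    case (gen j)
    then show ?case by (simp add: mult_single ext_gen f_add)
  next
    case (scale c u)
    then show ?case by (simp add: fscale_mult_right ext_scale) (metis h_central mult.assoc)
  qed (simp_all add: ext_zero ext_add algebra_simps)
next
  case (scale c u)
  then show ?case by (simp add: fscale_mult_left ext_scale mult.assoc)
qed (simp_all add: ext_zero ext_add algebra_simps)

lemma ext_one: "alg_ext h f 1 = 1"
  using ext_gen[of 0] f_0 by simp

lemma ext_power: "alg_ext h f (u ^ n) = alg_ext h f u ^ n"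
  by (induction n) (simp_all add: ext_one ext_mult)

end

lemma alg_ext_single_0: "alg_ext (Poly_Mapping.single 0) f = lin_ext f"
  by (simp add: alg_ext_def lin_ext_def fscale_eq_mult fun_eq_iff)


section \<open>Cosets of additive subgroups and ideals\<close>

definition add_subgroup :: "'a::ab_group_add set \<Rightarrow> bool" where
  "add_subgroup N \<longleftrightarrow> 0 \<in> N \<and> (\<forall>a\<in>N. \<forall>b\<in>N. a - b \<in> N)"

lemma add_subgroup_neg: "add_subgroup N \<Longrightarrow> a \<in> N \<Longrightarrow> - a \<in> N"
  and add_subgroup_add: "add_subgroup N \<Longrightarrow> a \<in> N \<Longrightarrow> b \<in> N \<Longrightarrow> a + b \<in> N"
proof -
  show neg: "- a \<in> N" if "add_subgroup N" "a \<in> N" for a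
    using that unfolding add_subgroup_def by (metis diff_0)
  show "a + b \<in> N" if "add_subgroup N" "a \<in> N" "b \<in> N"
    using that neg[of b] unfolding add_subgroup_def by (metis diff_minus_eq_add)
qed

lemma coset_eq_iff:
  assumes "add_subgroup N"
  shows "coset N u = coset N v \<longleftrightarrow> u - v \<in> N"
proof
  assume "coset N u = coset N v"
  moreover have "u \<in> coset N u" using assms by (simp add: coset_def add_subgroup_def)
  ultimately show "u - v \<in> N" by (auto simp: coset_def)
next
  assume "u - v \<in> N"
  then have "w - u \<in> N \<longleftrightarrow> w - v \<in> N" for w
    using add_subgroup_add[OF assms, of "w - u" "u - v"] add_subgroup_add[OF assms, of "w - v" "v - u"]
      add_subgroup_neg[OF assms, of "u - v"] by auto
  then show "coset N u = coset N v" by (auto simp: coset_def)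
qed

lemma coset_self: "add_subgroup N \<Longrightarrow> u \<in> coset N u"
  by (simp add: coset_def add_subgroup_def)

lemma coset_eq_0_iff: "add_subgroup N \<Longrightarrow> coset N u = coset N 0 \<longleftrightarrow> u \<in> N"
  by (simp add: coset_eq_iff)

lemma lift1_coset:
  assumes "add_subgroup N" "\<And>v. v - u \<in> N \<Longrightarrow> f v - f u \<in> N"
  shows "lift1 N f (coset N u) = coset N (f u)"
proof -
  have "lift1 N f (coset N u) = (\<Union>v\<in>coset N u. coset N (f u))"
    unfolding lift1_def
  proof (intro SUP_cong refl)
    fix v assume "v \<in> coset N u"
    then show "coset N (f v) = coset N (f u)"
      unfolding coset_eq_iff[OF assms(1)] by (intro assms(2)) (simp add: coset_def)
  qed
  then show ?thesis using coset_self[OF assms(1), of u] by auto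
qed

lemma lift2_coset:
  assumes "add_subgroup N" "\<And>u' v'. u' - u \<in> N \<Longrightarrow> v' - v \<in> N \<Longrightarrow> f u' v' - f u v \<in> N"
  shows "lift2 N f (coset N u) (coset N v) = coset N (f u v)"
proof -
  have "lift2 N f (coset N u) (coset N v) = (\<Union>u'\<in>coset N u. \<Union>v'\<in>coset N v. coset N (f u v))"
    unfolding lift2_def
  proof (intro SUP_cong refl)
    fix u' v' assume "u' \<in> coset N u" "v' \<in> coset N v"
    then show "coset N (f u' v') = coset N (f u v)"
      unfolding coset_eq_iff[OF assms(1)] by (intro assms(2)) (simp_all add: coset_def)
  qed
  then show ?thesis using coset_self[OF assms(1), of u] coset_self[OF assms(1), of v] by auto
qed

lemma two_sided_ideal_hull: "two_sided_ideal (two_sided_ideal hull X)"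
  by (rule hull_in) (auto simp: two_sided_ideal_def)

lemma two_sided_idealD:
  assumes "two_sided_ideal I"
  shows "add_subgroup I" "a \<in> I \<Longrightarrow> r * a \<in> I" "a \<in> I \<Longrightarrow> a * r \<in> I"
  using assms by (auto simp: two_sided_ideal_def add_subgroup_def)

lemma two_sided_ideal_subspace:
  fixes I :: "('a::monoid_add \<Rightarrow>\<^sub>0 'k::field) set"
  assumes "two_sided_ideal I"
  shows "free.subspace I"
  unfolding free.subspace_def fscale_eq_mult
  using two_sided_idealD[OF assms] add_subgroup_add[OF two_sided_idealD(1)[OF assms]]
  by (simp add: add_subgroup_def)

lemma free_subspace_add_subgroup: "free.subspace N \<Longrightarrow> add_subgroup N"
  by (auto simp: add_subgroup_def free.subspace_0 free.subspace_diff)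

lemma two_sided_ideal_mult_cong:
  assumes "two_sided_ideal I" "u' - u \<in> I" "v' - v \<in> I"
  shows "u' * v' - u * v \<in> I"
proof -
  have "u' * v' - u * v = (u' - u) * v' + u * (v' - v)" by (simp add: algebra_simps)
  then show ?thesis
    using two_sided_idealD[OF assms(1)] assms by (simp add: add_subgroup_add)
qed

lemma two_sided_ideal_power_cong:
  assumes "two_sided_ideal I" "u' - u \<in> I"
  shows "u' ^ n - u ^ n \<in> I"
proof (induction n)
  case (Suc n)
  then show ?case
    unfolding power_Suc by (intro two_sided_ideal_mult_cong assms)
qed (use two_sided_idealD(1)[OF assms(1)] in \<open>simp add: add_subgroup_def\<close>)

lemma lift_ideal_coset:
  fixes I :: "('a::monoid_add \<Rightarrow>\<^sub>0 'k::field) set"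
  assumes "two_sided_ideal I"
  shows "lift2 I (+) (coset I u) (coset I v) = coset I (u + v)"
    and "lift2 I (*) (coset I u) (coset I v) = coset I (u * v)"
    and "lift1 I (fscale c) (coset I u) = coset I (fscale c u)"
proof -
  note I = two_sided_idealD[OF assms]
  show "lift2 I (+) (coset I u) (coset I v) = coset I (u + v)"
    by (rule lift2_coset[OF I(1)]) (simp add: add_diff_add add_subgroup_add I(1))
  show "lift2 I (*) (coset I u) (coset I v) = coset I (u * v)"
    by (rule lift2_coset[OF I(1)]) (rule two_sided_ideal_mult_cong[OF assms])
  show "lift1 I (fscale c) (coset I u) = coset I (fscale c u)"
    by (rule lift1_coset[OF I(1)])
      (simp add: free.subspace_scale two_sided_ideal_subspace[OF assms] flip: free.scale_right_diff_distrib)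
qed


section \<open>Gradings\<close>

definition hcomp :: "(real \<Rightarrow> 'v::ab_group_add set) \<Rightarrow> 'v \<Rightarrow> real \<Rightarrow>\<^sub>0 'v" where
  "hcomp G v = (THE f. (\<forall>d. Poly_Mapping.lookup f d \<in> G d)
     \<and> v = (\<Sum>d\<in>Poly_Mapping.keys f. Poly_Mapping.lookup f d))"

lemma sum_lookup_superset:
  assumes "finite S" "Poly_Mapping.keys f \<subseteq> S"
  shows "(\<Sum>d\<in>Poly_Mapping.keys f. Poly_Mapping.lookup f d) = (\<Sum>d\<in>S. Poly_Mapping.lookup f d)"
  using assms by (intro sum.mono_neutral_left) (auto simp: in_keys_iff)

locale graded_space = vector_space s for s :: "'k::field \<Rightarrow> 'v::ab_group_add \<Rightarrow> 'v" +
  fixes G :: "real \<Rightarrow> 'v set"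
  assumes grading: "grading s G"
begin

lemma subspace_G: "subspace (G d)"
  using grading by (simp add: grading_def)

lemma hcomp_props:
  "Poly_Mapping.lookup (hcomp G v) d \<in> G d"
  "(\<Sum>d\<in>Poly_Mapping.keys (hcomp G v). Poly_Mapping.lookup (hcomp G v) d) = v"
proof -
  have "\<exists>!f. (\<forall>d. Poly_Mapping.lookup f d \<in> G d) \<and> v = (\<Sum>d\<in>Poly_Mapping.keys f. Poly_Mapping.lookup f d)"
    using grading by (simp add: grading_def)
  from theI'[OF this] show "Poly_Mapping.lookup (hcomp G v) d \<in> G d"
    "(\<Sum>d\<in>Poly_Mapping.keys (hcomp G v). Poly_Mapping.lookup (hcomp G v) d) = v"
    unfolding hcomp_def by auto
qed

lemma hcomp_eqI:
  assumes "\<And>d. Poly_Mapping.lookup f d \<in> G d" "v = (\<Sum>d\<in>Poly_Mapping.keys f. Poly_Mapping.lookup f d)"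
  shows "hcomp G v = f"
proof -
  have "\<exists>!f. (\<forall>d. Poly_Mapping.lookup f d \<in> G d) \<and> v = (\<Sum>d\<in>Poly_Mapping.keys f. Poly_Mapping.lookup f d)"
    using grading by (simp add: grading_def)
  with assms show ?thesis unfolding hcomp_def by (intro the1_equality) auto
qed

lemma hcomp_add: "hcomp G (u + v) = hcomp G u + hcomp G v"
proof (rule hcomp_eqI)
  show "Poly_Mapping.lookup (hcomp G u + hcomp G v) d \<in> G d" for d
    by (simp add: lookup_add hcomp_props subspace_add[OF subspace_G])
  let ?S = "Poly_Mapping.keys (hcomp G u) \<union> Poly_Mapping.keys (hcomp G v)"
  have "u + v = (\<Sum>d\<in>?S. Poly_Mapping.lookup (hcomp G u) d) + (\<Sum>d\<in>?S. Poly_Mapping.lookup (hcomp G v) d)"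
    using hcomp_props(2)[of u] hcomp_props(2)[of v]
      sum_lookup_superset[of ?S "hcomp G u"] sum_lookup_superset[of ?S "hcomp G v"] by simp
  then show "u + v = (\<Sum>d\<in>Poly_Mapping.keys (hcomp G u + hcomp G v).
      Poly_Mapping.lookup (hcomp G u + hcomp G v) d)"
    using sum_lookup_superset[of ?S "hcomp G u + hcomp G v"] keys_add[of "hcomp G u" "hcomp G v"]
    by (simp add: lookup_add sum.distrib)
qed

lemma hcomp_homogeneous:
  assumes "v \<in> G d"
  shows "hcomp G v = Poly_Mapping.single d v"
  by (rule hcomp_eqI) (use assms subspace_0[OF subspace_G] in \<open>auto simp: lookup_single when_def\<close>)

lemma hcomp_zero: "hcomp G 0 = 0"
  using hcomp_homogeneous[of 0] subspace_0[OF subspace_G] by simp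

lemma hcomp_scale: "Poly_Mapping.lookup (hcomp G (s c v)) d = s c (Poly_Mapping.lookup (hcomp G v) d)"
proof -
  let ?f = "Poly_Mapping.map (s c) (hcomp G v)"
  have look: "Poly_Mapping.lookup ?f d = s c (Poly_Mapping.lookup (hcomp G v) d)" for d
    by (simp add: Poly_Mapping.map.rep_eq when_def)
  have "hcomp G (s c v) = ?f"
  proof (rule hcomp_eqI)
    show "Poly_Mapping.lookup ?f d \<in> G d" for d
      by (simp add: look hcomp_props subspace_scale[OF subspace_G])
    have "(\<Sum>d\<in>Poly_Mapping.keys ?f. Poly_Mapping.lookup ?f d)
        = (\<Sum>d\<in>Poly_Mapping.keys (hcomp G v). Poly_Mapping.lookup ?f d)"
      by (rule sum_lookup_superset) (auto simp: in_keys_iff look)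
    then show "s c v = (\<Sum>d\<in>Poly_Mapping.keys ?f. Poly_Mapping.lookup ?f d)"
      by (simp only: look hcomp_props flip: scale_sum_right)
  qed
  then show ?thesis by (simp add: look)
qed

lemma hcomp_sum: "hcomp G (sum f S) = (\<Sum>i\<in>S. hcomp G (f i))"
  by (induction S rule: infinite_finite_induct) (simp_all add: hcomp_zero hcomp_add)

text \<open>The substitute for a degree when an element is not homogeneous: letters have components
  of several second degrees, and only an interval containing these is controlled.\<close>

definition supported :: "real set \<Rightarrow> 'v set" where
  "supported D = {v. Poly_Mapping.keys (hcomp G v) \<subseteq> D}"

lemma supported_iff: "v \<in> supported D \<longleftrightarrow> (\<forall>d. d \<notin> D \<longrightarrow> Poly_Mapping.lookup (hcomp G v) d = 0)"
  by (auto simp: supported_def in_keys_iff)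

lemma subspace_supported: "subspace (supported D)"
  by (auto simp: subspace_def supported_iff hcomp_zero hcomp_add hcomp_scale lookup_add)

lemma homogeneous_supported: "v \<in> G d \<Longrightarrow> d \<in> D \<Longrightarrow> v \<in> supported D"
  by (auto simp: supported_iff hcomp_homogeneous lookup_single when_def)

lemma supported_mono: "D \<subseteq> D' \<Longrightarrow> supported D \<subseteq> supported D'"
  by (auto simp: supported_def)

lemma supported_induct:
  assumes "v \<in> supported D" "subspace S" "\<And>d x. d \<in> D \<Longrightarrow> x \<in> G d \<Longrightarrow> x \<in> S"
  shows "v \<in> S"
proof -
  have "(\<Sum>d\<in>Poly_Mapping.keys (hcomp G v). Poly_Mapping.lookup (hcomp G v) d) \<in> S"
    using assms(1) by (intro subspace_sum assms(2)) (auto simp: supported_def intro!: assms(3) hcomp_props)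
  then show ?thesis by (simp add: hcomp_props)
qed

lemma hcomp_induct:
  assumes "subspace S" "\<And>d x. x \<in> G d \<Longrightarrow> x \<in> S"
  shows "v \<in> S"
  by (rule supported_induct[of v UNIV]) (auto simp: supported_def intro: assms)

text \<open>A maximal independent set of homogeneous elements spans, because the homogeneous
  elements do.\<close>

lemma homogeneous_basis:
  assumes "finite_dimensional_vector_space s B'"
  obtains B deg where "finite B" "independent B" "span B = UNIV" "\<And>b. b \<in> B \<Longrightarrow> b \<in> G (deg b)"
proof -
  obtain B where B: "B \<subseteq> (\<Union>d. G d)" "independent B" "(\<Union>d. G d) \<subseteq> span B"
    using maximal_independent_subset by blast
  have "span B = UNIV"
    using hcomp_induct[OF subspace_span[of B]] B(3) by auto
  moreover have "finite B"
    using finite_dimensional_vector_space.finiteI_independent[OF assms B(2)] .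
  moreover have "\<forall>b\<in>B. \<exists>d. b \<in> G d" using B(1) by auto
  then obtain deg where "\<And>b. b \<in> B \<Longrightarrow> b \<in> G (deg b)" by metis
  ultimately show ?thesis using B(2) that by blast
qed

text \<open>Projecting the basis expansion of \<open>x\<close> to degree \<open>d\<close> gives a
  second expansion of \<open>x\<close>, and coordinates are unique.\<close>

lemma representation_homogeneous:
  assumes B: "finite B" "independent B" "span B = UNIV" "\<And>b. b \<in> B \<Longrightarrow> b \<in> G (deg b)"
    and "x \<in> G d" "b \<in> B" "deg b \<noteq> d"
  shows "representation B x b = 0"
proof -
  let ?c = "representation B x"
  have x: "x = (\<Sum>b\<in>B. s (?c b) b)"
    using sum_representation_eq[of B x B] B by simp
  have "hcomp G (s (?c b) b) = Poly_Mapping.single (deg b) (s (?c b) b)" if "b \<in> B" for b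
    using that by (intro hcomp_homogeneous subspace_scale[OF subspace_G] B(4))
  then have "Poly_Mapping.lookup (hcomp G x) d = (\<Sum>b\<in>B. Poly_Mapping.lookup (Poly_Mapping.single (deg b) (s (?c b) b)) d)"
    by (subst x) (simp add: hcomp_sum lookup_sum)
  also have "Poly_Mapping.lookup (hcomp G x) d = x"
    using assms(5) by (simp add: hcomp_homogeneous)
  finally have x': "x = (\<Sum>b\<in>B. s (if deg b = d then ?c b else 0) b)"
    by (simp add: lookup_single when_def if_distrib[where f = "\<lambda>c. s c _"] cong: if_cong)
  have "representation B x = (\<lambda>b. if b \<in> B \<and> deg b = d then ?c b else 0)"
  proof (rule representation_eqI[OF B(2)])
    let ?f = "\<lambda>b. if b \<in> B \<and> deg b = d then ?c b else 0"
    show "finite {b. ?f b \<noteq> 0}" by (rule finite_subset[OF _ B(1)]) auto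
    have "(\<Sum>b | ?f b \<noteq> 0. s (?f b) b) = (\<Sum>b\<in>B. s (if deg b = d then ?c b else 0) b)"
      by (rule sum.mono_neutral_cong_left[OF B(1)]) auto
    then show "(\<Sum>b | ?f b \<noteq> 0. s (?f b) b) = x" using x' by simp
  qed (use B(3) in \<open>auto split: if_splits\<close>)
  then show ?thesis using assms(7) by (metis (mono_tags, lifting))
qed

end

section \<open>Jacobson's formula for operators\<close>

lemma linear_iteration:
  assumes "Vector_Spaces.linear fscale fscale f" "Vector_Spaces.linear fscale fscale g"
  shows "Vector_Spaces.linear fscale fscale (foldr (\<lambda>t. if t then f else g) w)"
proof (induction w)
  case Nil
  show ?case using free.linear_ident by simp
next
  case (Cons t w)
  then show ?case
    using Vector_Spaces.linear_compose[OF Cons assms(1)] Vector_Spaces.linear_compose[OF Cons assms(2)]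
    by (simp add: comp_def)
qed

text \<open>Transferred from the free algebra on two letters, which acts through \<open>f\<close> and \<open>g\<close>.\<close>

lemma jacobson_operators:
  fixes f g :: "('i \<Rightarrow>\<^sub>0 'k::field) \<Rightarrow> ('i \<Rightarrow>\<^sub>0 'k)"
  assumes f: "Vector_Spaces.linear fscale fscale f" and g: "Vector_Spaces.linear fscale fscale g"
    and p: "prime p" "CHAR('k) = p"
  shows "((\<lambda>v. f v + g v) ^^ p) v = (f ^^ p) v + (g ^^ p) v
    + jacobson_sum p (\<lambda>f g v. f v + g v) (\<lambda>v. 0) (\<lambda>c f v. fscale c (f v)) (\<lambda>f g v. f (g v) - g (f v)) f g v"
proof -
  define W where "W = foldr (\<lambda>t. if t then f else g)"
  define ev where "ev u v = lin_ext (\<lambda>w. W w v) u" for u :: "bool list \<Rightarrow>\<^sub>0 'k" and v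
  have linW: "Vector_Spaces.linear fscale fscale (W w)" for w
    unfolding W_def by (rule linear_iteration[OF f g])
  have W_add: "W w (u + v) = W w u + W w v" for w u v
    using linW[of w] by (rule Vector_Spaces.linear.axioms(3)[THEN module_hom.add])
  have W_scale: "W w (fscale c u) = fscale c (W w u)" for w u c
    using linW[of w] by (rule Vector_Spaces.linear.axioms(3)[THEN module_hom.scale])
  have ev_gen: "ev (gen w) v = W w v" for w v by (simp add: ev_def)
  have ev_add: "ev (x + y) v = ev x v + ev y v" for x y v by (simp add: ev_def lin_ext_add)
  have ev_diff: "ev (x - y) v = ev x v - ev y v" for x y v by (simp add: ev_def lin_ext_diff)
  have ev_scale: "ev (fscale c x) v = fscale c (ev x v)" for c x v by (simp add: ev_def lin_ext_fscale)
  have ev_zero: "ev 0 v = 0" for v by (simp add: ev_def)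
  have ev_v_add: "ev x (u + v) = ev x u + ev x v" for x u v
    unfolding ev_def by (simp add: W_add lin_ext_fun_add)
  have ev_v_scale: "ev x (fscale c u) = fscale c (ev x u)" for x u c
    unfolding ev_def by (simp add: W_scale lin_ext_fun_fscale)
  have ev_v_zero: "ev x 0 = 0" for x
    using ev_v_scale[of x 0 0] by simp
  have ev_mult: "ev (x * y) v = ev x (ev y v)" for x y v
  proof (induction x rule: free_induct)
    case (gen w)
    show ?case
    proof (induction y rule: free_induct)
      case (gen w')
      show ?case by (simp add: mult_single ev_gen plus_eq_append W_def)
    qed (simp_all add: ev_add ev_scale ev_zero ev_v_add ev_v_scale ev_v_zero distrib_left fscale_mult_right)
  qed (simp_all add: ev_add ev_scale ev_zero distrib_right fscale_mult_left)
  have ev_power: "ev (x ^ n) v = (ev x ^^ n) v" for x n v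
  proof (induction n)
    case 0
    have "ev (gen []) v = v" by (simp add: ev_gen W_def)
    then show ?case by (simp add: gen_Nil)
  qed (simp add: ev_mult)
  define R where "R x h \<longleftrightarrow> ev x = h" for x :: "bool list \<Rightarrow>\<^sub>0 'k" and h
  let ?a = "gen [True] :: bool list \<Rightarrow>\<^sub>0 'k" and ?b = "gen [False] :: bool list \<Rightarrow>\<^sub>0 'k"
  have ab: "ev ?a = f" "ev ?b = g" by (simp_all add: ev_gen W_def fun_eq_iff)
  have "R (jacobson_sum p (+) 0 fscale (\<lambda>x y. x * y - y * x) ?a ?b)
    (jacobson_sum p (\<lambda>f g v. f v + g v) (\<lambda>v. 0) (\<lambda>c f v. fscale c (f v)) (\<lambda>f g v. f (g v) - g (f v)) f g)"
    by (rule jacobson_sum_rel[where R = R]) (auto simp: R_def ev_zero ev_add ev_scale ev_diff ev_mult ab)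
  moreover have "(?a + ?b) ^ p = ?a ^ p + ?b ^ p + jacobson_sum p (+) 0 fscale (\<lambda>x y. x * y - y * x) ?a ?b"
    by (rule jacobson_formula[OF p]) (simp_all add: free_algebra_char p fscale_of_nat)
  moreover have "ev (?a + ?b) = (\<lambda>v. f v + g v)" by (auto simp: ev_add ab)
  ultimately show ?thesis
    using ev_power[of "?a + ?b" p v] by (simp add: ev_add ev_power R_def ab)
qed


section \<open>The action on words\<close>

text \<open>The universal property of the tensor product, in a form relative to a subspace: a map
  that is bilinear modulo \<open>S\<close> sends the tensor relations into \<open>S\<close>.\<close>

lemma tensor_rel_mapsto:
  fixes F :: "'x::ab_group_add \<times> 'l::ab_group_add \<Rightarrow> ('i \<Rightarrow>\<^sub>0 'k::field)"
  assumes u: "u \<in> tensor_rel sX sL" and S: "free.subspace S"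
    and "\<And>y z a. F (y + z, a) - F (y, a) - F (z, a) \<in> S"
    and "\<And>y a b. F (y, a + b) - F (y, a) - F (y, b) \<in> S"
    and "\<And>c y a. F (sX c y, a) - fscale c (F (y, a)) \<in> S"
    and "\<And>c y a. F (y, sL c a) - fscale c (F (y, a)) \<in> S"
  shows "lin_ext F u \<in> S"
proof (rule free.span_subspace_induct[OF u[unfolded tensor_rel_def], of "{u. lin_ext F u \<in> S}", simplified])
  show "free.subspace {u. lin_ext F u \<in> S}"
    using S by (auto simp: free.subspace_def lin_ext_add lin_ext_fscale)
qed (use assms in \<open>auto simp: lin_ext_diff lin_ext_fscale\<close>)

lemma tensor_rel_subspace: "free.subspace (tensor_rel sX sL)"
  unfolding tensor_rel_def by (rule free.subspace_span)

lemma tensor_rel_gens: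
  "gen (y + z, a) - gen (y, a) - gen (z, a) \<in> tensor_rel sX sL"
  "gen (y, a + b) - gen (y, a) - gen (y, b) \<in> tensor_rel sX sL"
  "gen (sX c y, a) - fscale c (gen (y, a)) \<in> tensor_rel sX sL"
  "gen (y, sL c a) - fscale c (gen (y, a)) \<in> tensor_rel sX sL"
  unfolding tensor_rel_def
     apply (rule free.span_base, intro UnI1, rule range_eqI[of _ _ "(y, z, a)"], simp)
    apply (rule free.span_base, rule UnI1, rule UnI1, rule UnI2, rule range_eqI[of _ _ "(y, a, b)"], simp)
   apply (rule free.span_base, rule UnI1, rule UnI2, rule range_eqI[of _ _ "(c, y, a)"], simp)
  apply (rule free.span_base, rule UnI2, rule range_eqI[of _ _ "(c, y, a)"], simp)
  done

lemma tensor_rel_add_subgroup: "add_subgroup (tensor_rel sX sL)"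
  by (rule free_subspace_add_subgroup[OF tensor_rel_subspace])

context restricted_lie_algebra
begin

lemma prime_p: "prime p"
  using char p_pos prime_CHAR_semidom[where 'a = 'k] by simp

lemma brk_zero: "brk 0 b = 0" "brk a 0 = 0"
  and brk_plus: "brk (a + a') b = brk a b + brk a' b" "brk a (b + b') = brk a b + brk a b'"
  and brk_scale: "brk (scale c a) b = scale c (brk a b)" "brk a (scale c b) = scale c (brk a b)"
proof -
  interpret l: Vector_Spaces.linear scale scale "\<lambda>a. brk a b" by (rule brk_linear_left)
  interpret r: Vector_Spaces.linear scale scale "\<lambda>b. brk a b" by (rule brk_linear_right)
  show "brk 0 b = 0" "brk a 0 = 0" "brk (a + a') b = brk a b + brk a' b" "brk a (b + b') = brk a b + brk a b'"
    "brk (scale c a) b = scale c (brk a b)" "brk a (scale c b) = scale c (brk a b)"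
    by (simp_all add: l.zero r.zero l.add r.add l.scale r.scale)
qed

end

section \<open>The wreath product on representatives\<close>

context self_similar_lie_algebra
begin

abbreviation "N \<equiv> tensor_rel sX sL"

lemma derivation_linear:
  assumes "\<delta> \<in> derivations sX"
  shows "\<delta> (x + y) = \<delta> x + \<delta> y" "\<delta> (sX c x) = sX c (\<delta> x)" "\<delta> (x * y) = \<delta> x * y + x * \<delta> y"
proof -
  interpret Vector_Spaces.linear sX sX \<delta> using assms by (simp add: derivations_def)
  show "\<delta> (x + y) = \<delta> x + \<delta> y" "\<delta> (sX c x) = sX c (\<delta> x)" by (rule add, rule scale)
  show "\<delta> (x * y) = \<delta> x * y + x * \<delta> y" using assms by (simp add: derivations_def)
qed

lemma scale_mult_right: "x * sX c y = sX c (x * y)"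
  using X.scale_mult[of c y x] by (simp add: mult.commute)

text \<open>The very representative that \<open>act_word\<close> chooses.\<close>

definition rep :: "'l \<Rightarrow> 'x \<times> 'l \<Rightarrow>\<^sub>0 'k" where
  "rep a = (SOME u. u \<in> fst (\<psi> a))"

lemma psi_derivation: "snd (\<psi> a) \<in> derivations sX"
  using psi_wreath[of a] by (auto simp: wreath_def)

lemma psi_rep: "fst (\<psi> a) = coset N (rep a)"
proof -
  obtain u where u: "fst (\<psi> a) = coset N u"
    using psi_wreath[of a] by (auto simp: wreath_def quotient_space_def)
  then have "u \<in> fst (\<psi> a)" by (simp add: coset_self tensor_rel_add_subgroup)
  then have "rep a \<in> coset N u" unfolding rep_def u[symmetric] by (rule someI)
  then show ?thesis
    unfolding u coset_eq_iff[OF tensor_rel_add_subgroup]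
    using add_subgroup_neg[OF tensor_rel_add_subgroup, of "rep a - u"] by (simp add: coset_def)
qed

text \<open>The bracket of formal sums is bilinear, so it is enough that it lies in \<open>N\<close>
  as soon as one argument does.\<close>

lemma tensor_brk_cong:
  assumes "u' - u \<in> N" "v' - v \<in> N"
  shows "tensor_brk brk u' v' - tensor_brk brk u v \<in> N"
proof -
  note S = tensor_rel_subspace[of sX sL]
  have l: "tensor_brk brk u v \<in> N" if "u \<in> N" for u v
    unfolding tensor_brk_def
  proof (rule tensor_rel_mapsto[OF that S], unfold prod.case)
    fix y z :: 'x and a b :: 'l and c :: 'k
    show "lin_ext (\<lambda>(z', b). gen ((y + z) * z', brk a b)) v - lin_ext (\<lambda>(z', b). gen (y * z', brk a b)) v
        - lin_ext (\<lambda>(z', b). gen (z * z', brk a b)) v \<in> N"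
      unfolding lin_ext_fun_diff[symmetric]
      by (rule lin_ext_in_subspace[OF S]) (auto simp: distrib_right tensor_rel_gens)
    show "lin_ext (\<lambda>(z', b'). gen (y * z', brk (a + b) b')) v - lin_ext (\<lambda>(z', b'). gen (y * z', brk a b')) v
        - lin_ext (\<lambda>(z', b'). gen (y * z', brk b b')) v \<in> N"
      unfolding lin_ext_fun_diff[symmetric]
      by (rule lin_ext_in_subspace[OF S]) (auto simp: L.brk_plus tensor_rel_gens)
    show "lin_ext (\<lambda>(z', b). gen (sX c y * z', brk a b)) v
        - fscale c (lin_ext (\<lambda>(z', b). gen (y * z', brk a b)) v) \<in> N"
      unfolding lin_ext_fun_diff[symmetric] lin_ext_fun_fscale[symmetric]
      by (rule lin_ext_in_subspace[OF S]) (auto simp: X.scale_mult[symmetric] tensor_rel_gens)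
    show "lin_ext (\<lambda>(z', b'). gen (y * z', brk (sL c a) b')) v
        - fscale c (lin_ext (\<lambda>(z', b'). gen (y * z', brk a b')) v) \<in> N"
      unfolding lin_ext_fun_diff[symmetric] lin_ext_fun_fscale[symmetric]
      by (rule lin_ext_in_subspace[OF S]) (auto simp: L.brk_scale tensor_rel_gens)
  qed
  have r: "tensor_brk brk u v \<in> N" if "v \<in> N" for u v
    unfolding tensor_brk_def
  proof (rule lin_ext_in_subspace[OF S], clarify)
    fix y a
    show "lin_ext (\<lambda>(z, b). gen (y * z, brk a b)) v \<in> N"
      by (rule tensor_rel_mapsto[OF that S])
        (auto simp: distrib_left L.brk_plus L.brk_scale scale_mult_right tensor_rel_gens)
  qed
  have "tensor_brk brk u' v' - tensor_brk brk u v
      = tensor_brk brk (u' - u) v' + tensor_brk brk u (v' - v)"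
    by (simp add: tensor_brk_def lin_ext_diff lin_ext_fun_diff split_def)
  then show ?thesis using l[OF assms(1)] r[OF assms(2)] by (simp add: free.subspace_add[OF S])
qed

lemma tensor_der_cong:
  assumes "\<delta> \<in> derivations sX" "u' - u \<in> N"
  shows "tensor_der \<delta> u' - tensor_der \<delta> u \<in> N"
proof -
  have "tensor_der \<delta> (u' - u) \<in> N"
    unfolding tensor_der_def
    by (rule tensor_rel_mapsto[OF assms(2) tensor_rel_subspace])
      (auto simp: derivation_linear[OF assms(1)] tensor_rel_gens)
  then show ?thesis by (simp add: tensor_der_def lin_ext_diff)
qed

lemma wr_brk_coset:
  assumes "\<delta> \<in> derivations sX" "\<epsilon> \<in> derivations sX"
  shows "wr_brk sX sL brk (coset N u, \<delta>) (coset N v, \<epsilon>)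
    = (coset N (tensor_brk brk u v + tensor_der \<delta> v - tensor_der \<epsilon> u), \<lambda>x. \<delta> (\<epsilon> x) - \<epsilon> (\<delta> x))"
proof -
  have "lift2 N (\<lambda>u v. tensor_brk brk u v + tensor_der \<delta> v - tensor_der \<epsilon> u) (coset N u) (coset N v)
    = coset N (tensor_brk brk u v + tensor_der \<delta> v - tensor_der \<epsilon> u)"
  proof (rule lift2_coset[OF tensor_rel_add_subgroup])
    fix u' v' assume *: "u' - u \<in> N" "v' - v \<in> N"
    have "(tensor_brk brk u' v' - tensor_brk brk u v) + (tensor_der \<delta> v' - tensor_der \<delta> v)
        - (tensor_der \<epsilon> u' - tensor_der \<epsilon> u) \<in> N"
      by (intro free.subspace_add[OF tensor_rel_subspace] free.subspace_diff[OF tensor_rel_subspace]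
        tensor_brk_cong tensor_der_cong assms *)
    then show "tensor_brk brk u' v' + tensor_der \<delta> v' - tensor_der \<epsilon> u'
        - (tensor_brk brk u v + tensor_der \<delta> v - tensor_der \<epsilon> u) \<in> N"
      by (simp add: algebra_simps)
  qed
  then show ?thesis by (simp add: wr_brk_def)
qed

lemma wr_add_coset: "wr_add sX sL (coset N u, \<delta>) (coset N v, \<epsilon>) = (coset N (u + v), \<lambda>x. \<delta> x + \<epsilon> x)"
proof -
  have "lift2 N (+) (coset N u) (coset N v) = coset N (u + v)"
    by (rule lift2_coset[OF tensor_rel_add_subgroup])
      (simp add: add_diff_add add_subgroup_add tensor_rel_add_subgroup)
  then show ?thesis by (simp add: wr_add_def)
qed

lemma wr_scale_coset: "wr_scale sX sL c (coset N u, \<delta>) = (coset N (fscale c u), \<lambda>x. sX c (\<delta> x))"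
proof -
  have "lift1 N (fscale c) (coset N u) = coset N (fscale c u)"
    by (rule lift1_coset[OF tensor_rel_add_subgroup])
      (simp add: free.subspace_scale tensor_rel_subspace flip: free.scale_right_diff_distrib)
  then show ?thesis by (simp add: wr_scale_def)
qed

lemma psi_pair: "\<psi> a = (coset N (rep a), snd (\<psi> a))"
  by (simp add: prod_eq_iff psi_rep)

text \<open>Representatives are chosen separately for each element, so the tensor component of
  \<psi> is additive only modulo \<open>N\<close>, while the derivations add exactly.\<close>

lemma rep_add: "rep (a + b) - (rep a + rep b) \<in> N" "snd (\<psi> (a + b)) x = snd (\<psi> a) x + snd (\<psi> b) x"
proof -
  have eq: "\<psi> (a + b) = (coset N (rep a + rep b), \<lambda>x. snd (\<psi> a) x + snd (\<psi> b) x)"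
    using wr_add_coset[of "rep a" "snd (\<psi> a)" "rep b" "snd (\<psi> b)"]
    unfolding psi_pair[symmetric] psi_add .
  then show "snd (\<psi> (a + b)) x = snd (\<psi> a) x + snd (\<psi> b) x" by simp
  show "rep (a + b) - (rep a + rep b) \<in> N"
    using psi_rep[of "a + b"] unfolding eq fst_conv coset_eq_iff[OF tensor_rel_add_subgroup, symmetric]
    by (rule sym)
qed

lemma rep_scale: "rep (sL c a) - fscale c (rep a) \<in> N" "snd (\<psi> (sL c a)) x = sX c (snd (\<psi> a) x)"
proof -
  have eq: "\<psi> (sL c a) = (coset N (fscale c (rep a)), \<lambda>x. sX c (snd (\<psi> a) x))"
    using wr_scale_coset[of c "rep a" "snd (\<psi> a)"]
    unfolding psi_pair[symmetric] psi_scale .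
  then show "snd (\<psi> (sL c a)) x = sX c (snd (\<psi> a) x)" by simp
  show "rep (sL c a) - fscale c (rep a) \<in> N"
    using psi_rep[of "sL c a"] unfolding eq fst_conv coset_eq_iff[OF tensor_rel_add_subgroup, symmetric]
    by (rule sym)
qed

lemma rep_brk:
  "rep (brk a b) - (tensor_brk brk (rep a) (rep b) + tensor_der (snd (\<psi> a)) (rep b)
      - tensor_der (snd (\<psi> b)) (rep a)) \<in> N"
  "snd (\<psi> (brk a b)) x = snd (\<psi> a) (snd (\<psi> b) x) - snd (\<psi> b) (snd (\<psi> a) x)"
proof -
  have eq: "\<psi> (brk a b) = (coset N (tensor_brk brk (rep a) (rep b) + tensor_der (snd (\<psi> a)) (rep b)
      - tensor_der (snd (\<psi> b)) (rep a)), \<lambda>x. snd (\<psi> a) (snd (\<psi> b) x) - snd (\<psi> b) (snd (\<psi> a) x))"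
    using wr_brk_coset[OF psi_derivation[of a] psi_derivation[of b], of "rep a" "rep b"]
    unfolding psi_pair[symmetric] psi_brk .
  then show "snd (\<psi> (brk a b)) x = snd (\<psi> a) (snd (\<psi> b) x) - snd (\<psi> b) (snd (\<psi> a) x)" by simp
  show "rep (brk a b) - (tensor_brk brk (rep a) (rep b) + tensor_der (snd (\<psi> a)) (rep b)
      - tensor_der (snd (\<psi> b)) (rep a)) \<in> N"
    using psi_rep[of "brk a b"] unfolding eq fst_conv coset_eq_iff[OF tensor_rel_add_subgroup, symmetric]
    by (rule sym)
qed

end

section \<open>Operators on normal forms over a basis of the alphabet\<close>

locale alphabet_basis = self_similar_lie_algebra p sL brk pm sX \<psi>
  for p :: nat
    and sL :: "'k::field \<Rightarrow> 'l::ab_group_add \<Rightarrow> 'l"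
    and brk :: "'l \<Rightarrow> 'l \<Rightarrow> 'l"
    and pm :: "'l \<Rightarrow> 'l"
    and sX :: "'k \<Rightarrow> 'x::comm_ring_1 \<Rightarrow> 'x"
    and \<psi> :: "'l \<Rightarrow> ('k, 'x, 'l) wreath" +
  fixes B :: "'x set"
  assumes finite_B: "finite B" and independent_B: "X.independent B" and span_B: "X.span B = UNIV"
begin

definition coord :: "'x \<Rightarrow> 'x list \<Rightarrow>\<^sub>0 'k" where
  "coord x = (\<Sum>b\<in>B. fscale (X.representation B x b) (gen [b]))"

lemma coord_add: "coord (x + y) = coord x + coord y"
  by (simp add: coord_def X.representation_add[OF independent_B] span_B free.scale_left_distrib sum.distrib)

lemma coord_scale: "coord (sX c x) = fscale c (coord x)"
  by (simp add: coord_def X.representation_scale[OF independent_B] span_B free.scale_sum_right)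

lemma coord_zero: "coord 0 = 0"
  using coord_scale[of 0 0] by simp

lemma coord_diff: "coord (x - y) = coord x - coord y"
  by (metis add_diff_cancel_right' coord_add diff_add_cancel)

lemma basis_expansion: "(\<Sum>b\<in>B. sX (X.representation B x b) b) = x"
  by (rule X.sum_representation_eq) (simp_all add: finite_B independent_B span_B)

lemma coord_expansion:
  fixes H :: "'x \<Rightarrow> ('i \<Rightarrow>\<^sub>0 'k)"
  assumes "\<And>x y. H (x + y) = H x + H y" "\<And>c x. H (sX c x) = fscale c (H x)"
  shows "H x = (\<Sum>b\<in>B. fscale (X.representation B x b) (H b))"
proof -
  have H0: "H 0 = 0" using assms(2)[of 0 0] by simp
  have "H (\<Sum>b\<in>S. sX (X.representation B x b) b) = (\<Sum>b\<in>S. fscale (X.representation B x b) (H b))"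
    if "finite S" for S
    using that by (induction S) (simp_all add: assms H0)
  then show ?thesis using finite_B basis_expansion[of x] by metis
qed

text \<open>Normal forms in the tensor algebra: \<open>nf v\<close> has the class of
  \<open>v\<close> (\<open>nf_cong\<close>) and involves only words over \<open>B\<close>.\<close>

definition nf :: "('x list \<Rightarrow>\<^sub>0 'k) \<Rightarrow> ('x list \<Rightarrow>\<^sub>0 'k)" where
  "nf = lin_ext (\<lambda>xs. prod_list (map coord xs))"

lemma nf_hom: "alg_hom (Poly_Mapping.single 0 :: 'k \<Rightarrow> 'x list \<Rightarrow>\<^sub>0 'k) (\<lambda>xs. prod_list (map coord xs))"
proof unfold_locales
  show "Poly_Mapping.single 0 c * u = u * (Poly_Mapping.single 0 c :: 'x list \<Rightarrow>\<^sub>0 'k)" for c u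
    by (rule single_0_mult_commute)
  show "prod_list (map coord 0) = 1" by (simp add: zero_eq_Nil)
  show "Poly_Mapping.single 0 (c * d) = (Poly_Mapping.single 0 c * Poly_Mapping.single 0 d :: 'x list \<Rightarrow>\<^sub>0 'k)" for c d
    by (simp add: mult_single)
qed (simp_all add: single_add plus_eq_append)

lemma nf_alg_ext: "nf = alg_ext (Poly_Mapping.single 0) (\<lambda>xs. prod_list (map coord xs))"
  by (simp add: nf_def alg_ext_single_0)

lemma nf_mult: "nf (u * v) = nf u * nf v"
  and nf_add: "nf (u + v) = nf u + nf v"
  and nf_scale: "nf (fscale c u) = fscale c (nf u)"
  and nf_zero: "nf 0 = 0"
  and nf_gen: "nf (gen xs) = prod_list (map coord xs)"
  by (simp_all add: nf_alg_ext alg_hom.ext_mult[OF nf_hom]) (simp_all add: nf_def lin_ext_add lin_ext_fscale flip: nf_alg_ext)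

lemma nf_linear: "Vector_Spaces.linear fscale fscale nf"
  unfolding nf_def by (rule lin_ext_linear)

lemma nf_sum: "nf (sum f S) = (\<Sum>i\<in>S. nf (f i))"
  by (simp add: nf_def lin_ext_sum)

lemma coord_basis: "b \<in> B \<Longrightarrow> coord b = gen [b]"
  by (simp add: coord_def X.representation_basis[OF independent_B] finite_B
    if_distrib[where f = "\<lambda>c. fscale c _"] cong: if_cong)

lemma nf_coord: "nf (coord x) = coord x"
proof -
  have "nf (coord x) = (\<Sum>b\<in>B. fscale (X.representation B x b) (coord b))"
    unfolding coord_def[of x] nf_sum nf_scale nf_gen by simp
  also have "\<dots> = coord x"
    unfolding coord_def[of x] by (intro sum.cong refl) (simp add: coord_basis)
  finally show ?thesis .
qed

lemma nf_nf: "nf (nf u) = nf u"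
proof -
  have "nf (prod_list (map coord xs)) = prod_list (map coord xs)" for xs
  proof (induction xs)
    case Nil
    show ?case using nf_gen[of "[]"] by (simp add: gen_Nil)
  qed (simp add: nf_mult nf_coord)
  then show ?thesis
    by (induction u rule: free_induct) (simp_all add: nf_gen nf_add nf_scale nf_zero)
qed

text \<open>The raw action depends on the representatives chosen in \<open>act_word\<close>; after
  normalisation it becomes linear in \<open>a\<close> and respects brackets and
  \<open>p\<close>-powers as an identity of operators.\<close>

definition opr :: "'l \<Rightarrow> ('x list \<Rightarrow>\<^sub>0 'k) \<Rightarrow> ('x list \<Rightarrow>\<^sub>0 'k)" where
  "opr a = lin_ext (\<lambda>xs. nf (act_word \<psi> xs a))"

text \<open>The effect of the tensor component on \<open>x \<otimes> v\<close>. It is kept apart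
  from the derivation because only this part depends on a representative.\<close>

definition tail_op :: "'x \<Rightarrow> ('x list \<Rightarrow>\<^sub>0 'k) \<Rightarrow> ('x \<times> 'l \<Rightarrow>\<^sub>0 'k) \<Rightarrow> ('x list \<Rightarrow>\<^sub>0 'k)" where
  "tail_op x v = lin_ext (\<lambda>(y, b). coord (x * y) * opr b v)"

text \<open>The operator of the element of the wreath product with components \<open>u\<close> (modulo
  \<^const>\<open>tensor_rel\<close>) and \<open>\<delta>\<close>.\<close>

definition wr_opr :: "('x \<times> 'l \<Rightarrow>\<^sub>0 'k) \<Rightarrow> ('x \<Rightarrow> 'x) \<Rightarrow> ('x list \<Rightarrow>\<^sub>0 'k) \<Rightarrow> ('x list \<Rightarrow>\<^sub>0 'k)" where
  "wr_opr u \<delta> = lin_ext (\<lambda>xs. case xs of [] \<Rightarrow> 0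
     | x # xs \<Rightarrow> tail_op x (gen xs) u + coord (\<delta> x) * nf (gen xs))"

lemma opr_linear: "Vector_Spaces.linear fscale fscale (opr a)"
  and wr_opr_linear: "Vector_Spaces.linear fscale fscale (wr_opr u \<delta>)"
  unfolding opr_def wr_opr_def by (rule lin_ext_linear)+

lemma opr_add: "opr a (u + v) = opr a u + opr a v"
  and opr_scale: "opr a (fscale c u) = fscale c (opr a u)"
  and opr_zero: "opr a 0 = 0"
  by (simp_all add: opr_def lin_ext_add lin_ext_fscale)

lemma wr_opr_add: "wr_opr u \<delta> (v + w) = wr_opr u \<delta> v + wr_opr u \<delta> w"
  and wr_opr_scale: "wr_opr u \<delta> (fscale c v) = fscale c (wr_opr u \<delta> v)"
  and wr_opr_zero: "wr_opr u \<delta> 0 = 0"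
  and wr_opr_sum: "wr_opr u \<delta> (sum f S) = (\<Sum>i\<in>S. wr_opr u \<delta> (f i))"
  by (simp_all add: wr_opr_def lin_ext_add lin_ext_fscale lin_ext_sum)

lemma tail_op_u_add: "tail_op x v (u + w) = tail_op x v u + tail_op x v w"
  and tail_op_u_diff: "tail_op x v (u - w) = tail_op x v u - tail_op x v w"
  and tail_op_u_scale: "tail_op x v (fscale c u) = fscale c (tail_op x v u)"
  and tail_op_gen: "tail_op x v (gen (y, b)) = coord (x * y) * opr b v"
  by (simp_all add: tail_op_def lin_ext_add lin_ext_fscale lin_ext_diff)

lemma tail_op_v_add: "tail_op x (v + w) u = tail_op x v u + tail_op x w u"
  and tail_op_v_scale: "tail_op x (fscale c v) u = fscale c (tail_op x v u)"
  and tail_op_v_zero: "tail_op x 0 u = 0"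
  by (simp_all add: tail_op_def opr_add opr_scale opr_zero distrib_left fscale_mult_right split_def
    lin_ext_fun_add lin_ext_fun_fscale lin_ext_fun_zero)

lemma tail_op_x_add: "tail_op (x + y) v u = tail_op x v u + tail_op y v u"
  and tail_op_x_scale: "tail_op (sX c x) v u = fscale c (tail_op x v u)"
  by (simp_all add: tail_op_def distrib_right coord_add coord_scale fscale_mult_left split_def
    lin_ext_fun_add lin_ext_fun_fscale X.scale_mult[symmetric])

lemma opr_Nil: "opr a 1 = 0"
  by (simp add: opr_def nf_zero flip: gen_Nil)

lemma wr_opr_Nil: "wr_opr u \<delta> 1 = 0"
  by (simp add: wr_opr_def flip: gen_Nil)

lemma wr_opr_Cons: "wr_opr u \<delta> (gen [x] * v) = tail_op x v u + coord (\<delta> x) * nf v"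
proof (induction v rule: free_induct)
  case (gen xs)
  show ?case by (simp add: wr_opr_def flip: gen_Cons)
qed (simp_all add: distrib_left fscale_mult_right wr_opr_add wr_opr_scale wr_opr_zero
    tail_op_v_add tail_op_v_scale tail_op_v_zero nf_add nf_scale nf_zero free.scale_right_distrib)

lemma opr_wr_opr: "opr a = wr_opr (rep a) (snd (\<psi> a))"
proof
  fix v
  show "opr a v = wr_opr (rep a) (snd (\<psi> a)) v"
  proof (induction v rule: free_induct)
    case (gen xs)
    show ?case
    proof (cases xs)
      case Nil
      then show ?thesis by (simp add: gen_Nil opr_Nil wr_opr_Nil)
    next
      case (Cons x xs')
      have "nf (lin_ext (\<lambda>(y, b). gen [x * y] * act_word \<psi> xs' b) (rep a))
          = lin_ext (\<lambda>(y, b). coord (x * y) * opr b (gen xs')) (rep a)"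
        by (subst linear_lin_ext[OF nf_linear]) (simp add: split_def nf_mult nf_gen opr_def)
      then show ?thesis
        by (simp add: Cons gen_Cons[of x xs'] wr_opr_Cons)
          (simp add: opr_def nf_add nf_gen tail_op_def rep_def flip: gen_Cons)
    qed
  qed (simp_all add: opr_add opr_scale opr_zero wr_opr_add wr_opr_scale wr_opr_zero)
qed

lemma opr_Cons: "opr a (gen [x] * v) = tail_op x v (rep a) + coord (snd (\<psi> a) x) * nf v"
  unfolding opr_wr_opr[of a] by (rule wr_opr_Cons)

lemma wr_opr_coord:
  assumes "\<delta> \<in> derivations sX"
  shows "wr_opr u \<delta> (coord x * v) = tail_op x v u + coord (\<delta> x) * nf v"
proof -
  have "wr_opr u \<delta> (coord x * v) = (\<Sum>b\<in>B. fscale (X.representation B x b) (tail_op b v u + coord (\<delta> b) * nf v))"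
    by (simp add: coord_def[of x] sum_distrib_right wr_opr_sum fscale_mult_left wr_opr_scale wr_opr_Cons)
  also have "\<dots> = tail_op x v u + coord (\<delta> x) * nf v"
    by (rule coord_expansion[symmetric])
      (simp_all add: tail_op_x_add tail_op_x_scale derivation_linear[OF assms] coord_add coord_scale
        distrib_right fscale_mult_left free.scale_right_distrib)
  finally show ?thesis .
qed

text \<open>The induction over words runs for all \<open>a\<close> at once, since the tail of the
  word is acted on by the elements that occur in \<open>rep a\<close>.\<close>

lemma opr_nf: "opr a (nf v) = opr a v"
proof (induction v arbitrary: a rule: free_induct)
  case (gen xs)
  show ?case
  proof (induction xs arbitrary: a)
    case Nil
    show ?case using nf_gen[of "[]"] by (simp add: gen_Nil)
  next
    case (Cons x xs)
    have "opr a (nf (gen (x # xs))) = opr a (coord x * nf (gen xs))"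
      by (simp add: nf_gen)
    also have "\<dots> = tail_op x (nf (gen xs)) (rep a) + coord (snd (\<psi> a) x) * nf (nf (gen xs))"
      unfolding opr_wr_opr[of a] by (rule wr_opr_coord[OF psi_derivation])
    also have "tail_op x (nf (gen xs)) (rep a) = tail_op x (gen xs) (rep a)"
      by (simp add: tail_op_def Cons.IH)
    finally show ?case by (simp add: nf_nf gen_Cons[of x xs] opr_Cons)
  qed
qed (simp_all add: nf_add nf_scale nf_zero opr_add opr_scale)

lemma nf_opr: "nf (opr a v) = opr a v"
proof (induction v rule: free_induct)
  case (gen xs)
  show ?case by (simp add: opr_def nf_nf)
qed (simp_all add: nf_add nf_scale opr_add opr_scale opr_zero nf_zero)

text \<open>Linearity in the Lie algebra argument, word by word: this makes \<^const>\<open>wr_opr\<close>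
  independent of the representative \<open>u\<close>.\<close>

lemma tail_op_rel:
  assumes "\<And>a b. opr (a + b) v = opr a v + opr b v" "\<And>c a. opr (sL c a) v = fscale c (opr a v)"
    and "u \<in> N"
  shows "tail_op x v u = 0"
  using tensor_rel_mapsto[OF assms(3), of "{0}" "\<lambda>(y, b). coord (x * y) * opr b v"]
  by (simp add: tail_op_def assms distrib_left coord_add distrib_right scale_mult_right coord_scale
    fscale_mult_left fscale_mult_right free.subspace_single_0)

text \<open>Additivity and homogeneity are proved together: replacing a representative on
  \<open>x # xs\<close> uses both of them on \<open>xs\<close>, and either of them on
  \<open>x # xs\<close> uses such a replacement.\<close>

lemma opr_lie_linear_gen:
  "opr (a + b) (gen xs) = opr a (gen xs) + opr b (gen xs) \<and> opr (sL c a) (gen xs) = fscale c (opr a (gen xs))"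
proof (induction xs arbitrary: a b c)
  case Nil
  show ?case by (simp add: gen_Nil opr_Nil)
next
  case (Cons x xs)
  have rel: "tail_op x (gen xs) u = tail_op x (gen xs) u'" if "u - u' \<in> N" for u u'
    using tail_op_rel[of "gen xs" "u - u'" x] Cons.IH that by (simp add: tail_op_u_diff)
  have "opr (a + b) (gen (x # xs)) = opr a (gen (x # xs)) + opr b (gen (x # xs))"
    unfolding gen_Cons[of x xs] opr_Cons rep_add(2) rel[OF rep_add(1)]
    by (simp add: tail_op_u_add coord_add distrib_right)
  moreover have "opr (sL c a) (gen (x # xs)) = fscale c (opr a (gen (x # xs)))"
    unfolding gen_Cons[of x xs] opr_Cons rep_scale(2) rel[OF rep_scale(1)]
    by (simp add: tail_op_u_scale coord_scale fscale_mult_left free.scale_right_distrib)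
  ultimately show ?case ..
qed

lemma opr_lie_add: "opr (a + b) v = opr a v + opr b v"
  by (induction v rule: free_induct)
    (simp_all add: opr_lie_linear_gen opr_add opr_scale opr_zero free.scale_right_distrib)

lemma opr_lie_scale: "opr (sL c a) v = fscale c (opr a v)"
  by (induction v rule: free_induct)
    (simp_all add: opr_lie_linear_gen opr_add opr_scale opr_zero free.scale_right_distrib mult.commute)

lemma opr_lie_zero: "opr 0 v = 0"
  using opr_lie_scale[of 0 0 v] by simp

lemma tail_op_cong: "u - u' \<in> N \<Longrightarrow> tail_op x v u = tail_op x v u'"
  using tail_op_rel[of v "u - u'" x] by (simp add: tail_op_u_diff opr_lie_add opr_lie_scale)

lemma wr_opr_cong: "u - u' \<in> N \<Longrightarrow> wr_opr u \<delta> = wr_opr u' \<delta>"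
  unfolding wr_opr_def using tail_op_cong by (intro arg_cong[where f = lin_ext] ext) (simp split: list.split)

text \<open>The terms with \<open>\<delta> x * z\<close> and \<open>\<delta>' x * y\<close> reappear
  when the two operators change places, so they cancel in the commutator; what remains is the
  bracket of the wreath product.\<close>

lemma wr_opr_comp:
  assumes "\<delta> \<in> derivations sX"
  shows "wr_opr u \<delta> (wr_opr u' \<delta>' (gen [x] * v))
    = lin_ext (\<lambda>(z, b). lin_ext (\<lambda>(y, a). coord (x * y * z) * opr a (opr b v)) u) u'
      + lin_ext (\<lambda>(z, b). coord (\<delta> x * z) * opr b v) u' + lin_ext (\<lambda>(z, b). coord (x * \<delta> z) * opr b v) u'
      + lin_ext (\<lambda>(y, a). coord (\<delta>' x * y) * opr a v) u + coord (\<delta> (\<delta>' x)) * nf v"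
proof -
  have "wr_opr u \<delta> (tail_op x v u') = lin_ext (\<lambda>(z, b). wr_opr u \<delta> (coord (x * z) * opr b v)) u'"
    unfolding tail_op_def by (subst linear_lin_ext[OF wr_opr_linear]) (simp add: split_def)
  also have "\<dots> = lin_ext (\<lambda>(z, b). lin_ext (\<lambda>(y, a). coord (x * y * z) * opr a (opr b v)) u
      + coord (\<delta> x * z) * opr b v + coord (x * \<delta> z) * opr b v) u'"
    by (simp add: wr_opr_coord[OF assms] tail_op_def nf_opr derivation_linear(3)[OF assms] coord_add
      distrib_right mult.assoc mult.commute[of _ "_ :: 'x"] add.assoc)
      (simp add: mult.left_commute[of _ "_ :: 'x"] mult.commute[of _ "_ :: 'x"] add.commute)
  finally show ?thesis
    by (simp add: wr_opr_Cons wr_opr_add wr_opr_coord[OF assms] nf_nf split_def lin_ext_fun_add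
      tail_op_def opr_nf add.assoc)
qed


lemma tail_op_tensor_brk:
  "tail_op x v (tensor_brk brk u u')
    = lin_ext (\<lambda>(y, a). lin_ext (\<lambda>(z, b). coord (x * y * z) * opr (brk a b) v) u') u"
  unfolding tail_op_def tensor_brk_def
  by (simp add: linear_lin_ext[OF lin_ext_linear] split_def mult.assoc)

lemma tail_op_tensor_der:
  "tail_op x v (tensor_der \<delta> u) = lin_ext (\<lambda>(z, b). coord (x * \<delta> z) * opr b v) u"
  unfolding tail_op_def tensor_der_def
  by (simp add: linear_lin_ext[OF lin_ext_linear] split_def)

text \<open>The bracket relation is assumed for the tail \<open>v\<close> only, which is what the
  induction over words in \<open>opr_brk\<close> supplies.\<close>

lemma wr_opr_brk:
  assumes "\<delta> \<in> derivations sX" "\<delta>' \<in> derivations sX"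
    and brk: "\<And>a b. opr (brk a b) v = opr a (opr b v) - opr b (opr a v)"
  shows "wr_opr (tensor_brk brk u u' + tensor_der \<delta> u' - tensor_der \<delta>' u) (\<lambda>x. \<delta> (\<delta>' x) - \<delta>' (\<delta> x)) (gen [x] * v)
    = wr_opr u \<delta> (wr_opr u' \<delta>' (gen [x] * v)) - wr_opr u' \<delta>' (wr_opr u \<delta> (gen [x] * v))"
proof -
  let ?D = "lin_ext (\<lambda>(y, a). lin_ext (\<lambda>(z, b). coord (x * y * z) * opr a (opr b v)) u') u"
  let ?D' = "lin_ext (\<lambda>(y, a). lin_ext (\<lambda>(z, b). coord (x * y * z) * opr b (opr a v)) u') u"
  have D: "lin_ext (\<lambda>(z, b). lin_ext (\<lambda>(y, a). coord (x * y * z) * opr a (opr b v)) u) u' = ?D"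
    using lin_ext_swap[of "\<lambda>(z, b) (y, a). coord (x * y * z) * opr a (opr b v)" u u'] by (simp add: split_def)
  \<comment> \<open>Commutativity of \<open>X\<close> enters here: the two products of
    \<open>y\<close> and \<open>z\<close> agree.\<close>
  have D': "lin_ext (\<lambda>(z, b). lin_ext (\<lambda>(y, a). coord (x * y * z) * opr a (opr b v)) u') u = ?D'"
    by (intro lin_ext_cong_keys, clarify, intro lin_ext_cong_keys, clarify) (simp add: mult_ac)
  have "tail_op x v (tensor_brk brk u u') = ?D - ?D'"
    by (simp add: tail_op_tensor_brk brk right_diff_distrib split_def lin_ext_fun_diff)
  then show ?thesis
    unfolding wr_opr_comp[OF assms(1)] wr_opr_comp[OF assms(2)] D D'
    by (simp add: wr_opr_Cons tail_op_u_add tail_op_u_diff tail_op_tensor_der coord_diff left_diff_distrib)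
qed

lemma opr_brk: "opr (brk a b) v = opr a (opr b v) - opr b (opr a v)"
proof (induction v arbitrary: a b rule: free_induct)
  case (gen xs)
  show ?case
  proof (induction xs arbitrary: a b)
    case Nil
    show ?case by (simp add: gen_Nil opr_Nil opr_zero)
  next
    case (Cons x xs)
    have "snd (\<psi> (brk a b)) = (\<lambda>x. snd (\<psi> a) (snd (\<psi> b) x) - snd (\<psi> b) (snd (\<psi> a) x))"
      by (rule ext) (rule rep_brk(2))
    then have "opr (brk a b) = wr_opr (tensor_brk brk (rep a) (rep b) + tensor_der (snd (\<psi> a)) (rep b)
      - tensor_der (snd (\<psi> b)) (rep a)) (\<lambda>x. snd (\<psi> a) (snd (\<psi> b) x) - snd (\<psi> b) (snd (\<psi> a) x))"
      unfolding opr_wr_opr[of "brk a b"] using wr_opr_cong[OF rep_brk(1)] by simp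
    then show ?case
      unfolding gen_Cons[of x xs] by (simp only: wr_opr_brk[OF psi_derivation psi_derivation Cons.IH] opr_wr_opr[symmetric])
  qed
qed (simp_all add: opr_add opr_scale opr_zero free.scale_right_diff_distrib)


subsection \<open>The \<open>p\<close>-mapping acts as the \<open>p\<close>-th power\<close>

lemma derivationI:
  assumes "\<And>x y. \<delta> (x + y) = \<delta> x + \<delta> y" "\<And>c x. \<delta> (sX c x) = sX c (\<delta> x)"
    "\<And>x y. \<delta> (x * y) = \<delta> x * y + x * \<delta> y"
  shows "\<delta> \<in> derivations sX"
  unfolding derivations_def using assms by (auto simp: Vector_Spaces.linear_iff X.vector_space_axioms)

text \<open>The relation for the values of the \<open>p\<close>-mapping, whose second component may
  be \<open>\<delta> ^^ p\<close>. In contrast, \<open>wr_rel\<close> demands a derivation, as the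
  computation of brackets does.\<close>

definition wr_val :: "('k, 'x, 'l) wreath \<Rightarrow> (('x list \<Rightarrow>\<^sub>0 'k) \<Rightarrow> ('x list \<Rightarrow>\<^sub>0 'k)) \<Rightarrow> bool" where
  "wr_val w f \<longleftrightarrow> (\<exists>u \<delta>. w = (coset N u, \<delta>) \<and> f = wr_opr u \<delta>)"

lemma wr_valI: "f = wr_opr u \<delta> \<Longrightarrow> wr_val (coset N u, \<delta>) f"
  by (auto simp: wr_val_def)

lemma wr_val_unique: "wr_val w f \<Longrightarrow> wr_val w g \<Longrightarrow> f = g"
  by (auto simp: wr_val_def coset_eq_iff tensor_rel_add_subgroup intro: wr_opr_cong)

definition wr_rel :: "('k, 'x, 'l) wreath \<Rightarrow> (('x list \<Rightarrow>\<^sub>0 'k) \<Rightarrow> ('x list \<Rightarrow>\<^sub>0 'k)) \<Rightarrow> bool" where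
  "wr_rel w f \<longleftrightarrow> (\<exists>u \<delta>. \<delta> \<in> derivations sX \<and> w = (coset N u, \<delta>) \<and> f = wr_opr u \<delta>)"

lemma wr_relI: "\<delta> \<in> derivations sX \<Longrightarrow> f = wr_opr u \<delta> \<Longrightarrow> wr_rel (coset N u, \<delta>) f"
  by (auto simp: wr_rel_def)

lemma wr_rel_val: "wr_rel w f \<Longrightarrow> wr_val w f"
  by (auto simp: wr_rel_def wr_val_def)

lemma wr_rel_psi: "wr_rel (\<psi> a) (opr a)"
  unfolding wr_rel_def using psi_pair psi_derivation opr_wr_opr by blast

lemma wr_rel_linear: "wr_rel w f \<Longrightarrow> Vector_Spaces.linear fscale fscale f"
  by (auto simp: wr_rel_def wr_opr_linear)

lemma word_ext:
  assumes "Vector_Spaces.linear fscale fscale f" "Vector_Spaces.linear fscale fscale g"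
    and "f 1 = g 1" "\<And>x v. f (gen [x] * v) = g (gen [x] * v)"
  shows "f = g"
proof
  fix v
  have "f (gen xs) = g (gen xs)" for xs
  proof (cases xs)
    case Nil
    then show ?thesis using assms(3) by (simp add: gen_Nil)
  next
    case (Cons x xs')
    then show ?thesis using assms(4)[of x "gen xs'"] by (simp add: gen_Cons[of x xs'])
  qed
  then show "f v = g v"
    using linear_eq_lin_ext[OF assms(1), of v] linear_eq_lin_ext[OF assms(2), of v] by simp
qed

lemma wr_rel_zero: "wr_rel (wr_zero sX sL) (\<lambda>v. 0)"
  unfolding wr_zero_def
proof (rule wr_relI)
  show "(\<lambda>v. 0) = wr_opr 0 (\<lambda>x. 0)"
  proof (rule word_ext)
    show "Vector_Spaces.linear fscale fscale (\<lambda>v. 0)"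
      by (simp add: Vector_Spaces.linear_iff free.vector_space_axioms)
  qed (simp_all add: wr_opr_linear wr_opr_Nil wr_opr_Cons tail_op_def coord_zero)
qed (rule derivationI, simp_all)

lemma wr_opr_plus: "wr_opr (u + u') (\<lambda>x. \<delta> x + \<delta>' x) = (\<lambda>v. wr_opr u \<delta> v + wr_opr u' \<delta>' v)"
proof (rule word_ext)
  show "Vector_Spaces.linear fscale fscale (\<lambda>v. wr_opr u \<delta> v + wr_opr u' \<delta>' v)"
    by (simp add: Vector_Spaces.linear_iff free.vector_space_axioms wr_opr_add wr_opr_scale free.scale_right_distrib)
qed (simp_all add: wr_opr_linear wr_opr_Nil wr_opr_Cons tail_op_u_add coord_add distrib_right)

lemma wr_val_add:
  assumes "wr_val w f" "wr_val w' f'"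
  shows "wr_val (wr_add sX sL w w') (\<lambda>v. f v + f' v)"
proof -
  obtain u \<delta> u' \<delta>' where w: "w = (coset N u, \<delta>)" "w' = (coset N u', \<delta>')"
    and f: "f = wr_opr u \<delta>" "f' = wr_opr u' \<delta>'"
    using assms by (auto simp: wr_val_def)
  show ?thesis
    unfolding w f wr_add_coset by (rule wr_valI) (rule wr_opr_plus[symmetric])
qed

lemma wr_rel_add:
  assumes "wr_rel w f" "wr_rel w' f'"
  shows "wr_rel (wr_add sX sL w w') (\<lambda>v. f v + f' v)"
proof -
  obtain u \<delta> u' \<delta>' where d: "\<delta> \<in> derivations sX" "\<delta>' \<in> derivations sX"
    and w: "w = (coset N u, \<delta>)" "w' = (coset N u', \<delta>')" and f: "f = wr_opr u \<delta>" "f' = wr_opr u' \<delta>'"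
    using assms by (auto simp: wr_rel_def)
  show ?thesis
    unfolding w f wr_add_coset wr_opr_plus[symmetric]
    by (intro wr_relI derivationI refl)
      (simp_all add: derivation_linear[OF d(1)] derivation_linear[OF d(2)] X.scale_right_distrib algebra_simps)
qed

lemma wr_rel_scale: "wr_rel w f \<Longrightarrow> wr_rel (wr_scale sX sL c w) (\<lambda>v. fscale c (f v))"
proof -
  assume "wr_rel w f"
  then obtain u \<delta> where d: "\<delta> \<in> derivations sX" and w: "w = (coset N u, \<delta>)" and f: "f = wr_opr u \<delta>"
    by (auto simp: wr_rel_def)
  have "(\<lambda>v. fscale c (f v)) = wr_opr (fscale c u) (\<lambda>x. sX c (\<delta> x))"
    unfolding f
  proof (rule word_ext)
    show "Vector_Spaces.linear fscale fscale (\<lambda>v. fscale c (wr_opr u \<delta> v))"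
      by (simp add: Vector_Spaces.linear_iff free.vector_space_axioms wr_opr_add wr_opr_scale
        free.scale_right_distrib mult.commute)
  qed (simp_all add: wr_opr_linear wr_opr_Nil wr_opr_Cons tail_op_u_scale coord_scale fscale_mult_left
      free.scale_right_distrib)
  then show ?thesis
    unfolding w wr_scale_coset
    by (intro wr_relI derivationI)
      (simp_all add: derivation_linear[OF d] X.scale_right_distrib scale_mult_right mult.commute
        flip: X.scale_mult)
qed

lemma wr_rel_brk:
  "wr_rel w f \<Longrightarrow> wr_rel w' f' \<Longrightarrow> wr_rel (wr_brk sX sL brk w w') (\<lambda>v. f (f' v) - f' (f v))"
proof -
  assume "wr_rel w f" "wr_rel w' f'"
  then obtain u \<delta> u' \<delta>' where d: "\<delta> \<in> derivations sX" "\<delta>' \<in> derivations sX"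
    and w: "w = (coset N u, \<delta>)" "w' = (coset N u', \<delta>')" and f: "f = wr_opr u \<delta>" "f' = wr_opr u' \<delta>'"
    by (auto simp: wr_rel_def)
  have "(\<lambda>v. f (f' v) - f' (f v)) = wr_opr (tensor_brk brk u u' + tensor_der \<delta> u' - tensor_der \<delta>' u)
      (\<lambda>x. \<delta> (\<delta>' x) - \<delta>' (\<delta> x))"
    unfolding f
  proof (rule word_ext)
    show "Vector_Spaces.linear fscale fscale (\<lambda>v. wr_opr u \<delta> (wr_opr u' \<delta>' v) - wr_opr u' \<delta>' (wr_opr u \<delta> v))"
      by (simp add: Vector_Spaces.linear_iff free.vector_space_axioms wr_opr_add wr_opr_scale
        free.scale_right_diff_distrib)
  qed (simp_all add: wr_opr_linear wr_opr_Nil wr_opr_zero wr_opr_brk[OF d opr_brk])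
  moreover have "(\<lambda>x. \<delta> (\<delta>' x) - \<delta>' (\<delta> x)) \<in> derivations sX"
    by (rule derivationI) (simp_all add: derivation_linear[OF d(1)] derivation_linear[OF d(2)] X.scale_right_diff_distrib algebra_simps)
  ultimately show ?thesis
    unfolding w wr_brk_coset[OF d] by (intro wr_relI)
qed

text \<open>Induction along the graph of the \<open>p\<close>-mapping. Knowledge of the tail
  \<open>v\<close> gives knowledge of \<open>gen [x] * v\<close>; the case of a sum is Jacobson's
  formula for operators, carried to the wreath product by \<open>jacobson_sum_rel\<close>.\<close>

lemma wr_pm_opr:
  assumes "wr_pm p sX sL brk pm w w'" and pm: "\<And>a. opr (pm a) v = (opr a ^^ p) v"
  shows "\<exists>f f'. wr_rel w f \<and> wr_val w' f' \<and> (\<forall>x. f' (gen [x] * v) = (f ^^ p) (gen [x] * v))"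
  using assms(1)
proof induction
  \<comment> \<open>The closed forms for the iterates below start at exponent one: the operator
    expands the letter \<open>x\<close> in the basis, while its zeroth iterate leaves
    \<open>x\<close> as it is.\<close>
  obtain q where p: "p = Suc q" using L.p_pos gr0_conv_Suc by blast
  {
    case (tensor y a)
    have zero: "(\<lambda>x. 0) \<in> derivations sX" by (rule derivationI) simp_all
    let ?f = "wr_opr (gen (y, a)) (\<lambda>x. 0)"
    have "(?f ^^ Suc n) (gen [x] * v) = coord (x * y ^ Suc n) * (opr a ^^ Suc n) v" for n x
    proof (induction n)
      case (Suc n)
      have "(?f ^^ Suc (Suc n)) (gen [x] * v) = ?f (coord (x * y ^ Suc n) * (opr a ^^ Suc n) v)"
        using Suc by simp
      also have "\<dots> = coord (x * y ^ Suc n * y) * opr a ((opr a ^^ Suc n) v)"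
        by (simp only: wr_opr_coord[OF zero] tail_op_gen coord_zero mult_zero_left add_0_right)
      finally show ?case by (simp add: mult_ac)
    qed (simp add: wr_opr_Cons tail_op_gen coord_zero)
    then have "wr_opr (gen (y ^ p, pm a)) (\<lambda>x. 0) (gen [x] * v) = (?f ^^ p) (gen [x] * v)" for x
      unfolding p by (simp only: wr_opr_Cons tail_op_gen coord_zero pm[unfolded p]) simp
    then show ?case
      unfolding tensor_def using wr_relI[OF zero] wr_valI by blast
  next
    case (derivation \<delta>)
    have t0: "tail_op x v 0 = 0" for x v by (simp add: tail_op_def)
    let ?f = "wr_opr 0 \<delta>"
    have *: "(?f ^^ Suc n) (gen [x] * v) = coord ((\<delta> ^^ Suc n) x) * nf v" for n x
    proof (induction n)
      case (Suc n)
      have "(?f ^^ Suc (Suc n)) (gen [x] * v) = ?f (coord ((\<delta> ^^ Suc n) x) * nf v)"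
        using Suc by simp
      also have "\<dots> = coord (\<delta> ((\<delta> ^^ Suc n) x)) * nf v"
        by (simp only: wr_opr_coord[OF derivation] t0 nf_nf add_0)
      finally show ?case by simp
    qed (simp add: wr_opr_Cons t0)
    have "\<forall>x. wr_opr 0 (\<delta> ^^ p) (gen [x] * v) = (?f ^^ p) (gen [x] * v)"
      unfolding p * by (simp add: wr_opr_Cons t0)
    then show ?case
      using wr_relI[OF derivation refl, of 0] wr_valI[OF refl, of 0 "\<delta> ^^ p"] by blast
  next
    case (add w w' z z')
    then obtain f f' g g' where fg: "wr_rel w f" "wr_val w' f'" "wr_rel z g" "wr_val z' g'"
      and eq: "\<And>x. f' (gen [x] * v) = (f ^^ p) (gen [x] * v)" "\<And>x. g' (gen [x] * v) = (g ^^ p) (gen [x] * v)"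
      by blast
    let ?J = "jacobson_sum p (\<lambda>f g v. f v + g v) (\<lambda>v. 0) (\<lambda>c f v. fscale c (f v)) (\<lambda>f g v. f (g v) - g (f v)) f g"
    have "wr_rel (jacobson_sum p (wr_add sX sL) (wr_zero sX sL) (wr_scale sX sL) (wr_brk sX sL brk) w z) ?J"
      by (rule jacobson_sum_rel[where R = wr_rel])
        (auto intro: wr_rel_zero wr_rel_add wr_rel_scale wr_rel_brk fg)
    then have "wr_val (wr_add sX sL (wr_add sX sL w' z')
        (jacobson_sum p (wr_add sX sL) (wr_zero sX sL) (wr_scale sX sL) (wr_brk sX sL brk) w z))
        (\<lambda>v. f' v + g' v + ?J v)"
      by (intro wr_val_add fg wr_rel_val)
    moreover have "f' (gen [x] * v) + g' (gen [x] * v) + ?J (gen [x] * v)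
        = ((\<lambda>v. f v + g v) ^^ p) (gen [x] * v)" for x
      unfolding eq by (rule jacobson_operators[symmetric])
        (auto intro: wr_rel_linear fg L.prime_p L.char)
    ultimately show ?case using wr_rel_add[OF fg(1,3)] by blast
  }
qed

text \<open>Again all \<open>a\<close> at once: \<open>wr_pm_opr\<close> asks for the claim about
  the tail for every element. By \<open>wr_val_unique\<close> the operators that it produces are
  \<open>opr a\<close> and \<open>opr (pm a)\<close>.\<close>

lemma opr_pm: "opr (pm a) v = (opr a ^^ p) v"
proof (induction v arbitrary: a rule: free_induct)
  case (gen xs)
  show ?case
  proof (induction xs arbitrary: a)
    case Nil
    have "(opr a ^^ n) 1 = (if n = 0 then 1 else 0)" for n
      by (induction n) (simp_all add: opr_Nil opr_zero)
    then show ?case using L.p_pos by (simp add: gen_Nil opr_Nil)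
  next
    case (Cons x xs)
    obtain f f' where f: "wr_rel (\<psi> a) f" "wr_val (\<psi> (pm a)) f'"
      and eq: "f' (gen [x] * gen xs) = (f ^^ p) (gen [x] * gen xs)"
      using wr_pm_opr[OF psi_pm Cons.IH] by blast
    have "f = opr a" "f' = opr (pm a)"
      using f wr_val_unique wr_rel_val wr_rel_psi by blast+
    with eq show ?case by (simp add: gen_Cons[of x xs])
  qed
next
  case zero
  have "(opr a ^^ n) 0 = 0" for n by (induction n) (simp_all add: opr_zero)
  then show ?case by (simp add: opr_zero)
next
  case (add u v)
  have "(opr a ^^ n) (u + v) = (opr a ^^ n) u + (opr a ^^ n) v" for n by (induction n) (simp_all add: opr_add)
  with add show ?case by (simp add: opr_add)
next
  case (scale c u)
  have "(opr a ^^ n) (fscale c u) = fscale c ((opr a ^^ n) u)" for n by (induction n) (simp_all add: opr_scale)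
  with scale show ?case by (simp add: opr_scale)
qed


subsection \<open>Faithfulness\<close>

lemma nf_cong: "v - nf v \<in> tensor_algebra_ideal sX"
proof -
  let ?J = "tensor_algebra_ideal sX"
  have J: "two_sided_ideal ?J" unfolding tensor_algebra_ideal_def by (rule two_sided_ideal_hull)
  note S = two_sided_ideal_subspace[OF J]
  have rel_add: "gen [x + y] - gen [x] - gen [y] \<in> ?J" for x y
    unfolding tensor_algebra_ideal_def
    by (rule hull_inc) (auto simp: linearity_relations_def intro!: range_eqI[of _ _ "(x, y)"])
  have rel_scale: "gen [sX c x] - fscale c (gen [x]) \<in> ?J" for c x
    unfolding tensor_algebra_ideal_def
    by (rule hull_inc) (auto simp: linearity_relations_def intro!: range_eqI[of _ _ "(c, x)"])
  have zero: "gen [0] \<in> ?J" using rel_scale[of 0 0] by simp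
  have sum: "gen [\<Sum>b\<in>S. sX (c b) b] - (\<Sum>b\<in>S. fscale (c b) (gen [b])) \<in> ?J" if "finite S" for S c
    using that
  proof (induction S)
    case (insert b S)
    let ?x = "sX (c b) b" and ?y = "\<Sum>b\<in>S. sX (c b) b"
    have "(gen [?x + ?y] - gen [?x] - gen [?y]) + (gen [?x] - fscale (c b) (gen [b]))
        + (gen [?y] - (\<Sum>b\<in>S. fscale (c b) (gen [b]))) \<in> ?J"
      by (intro free.subspace_add[OF S] rel_add rel_scale insert)
    then show ?case using insert(1,2) by (simp add: diff_diff_eq)
  qed (simp add: zero)
  have letter: "gen [x] - coord x \<in> ?J" for x
    using sum[OF finite_B, of "X.representation B x"] unfolding basis_expansion coord_def .
  have word: "gen xs - prod_list (map coord xs) \<in> ?J" for xs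
  proof (induction xs)
    case Nil
    show ?case by (simp add: gen_Nil free.subspace_0[OF S])
  next
    case (Cons x xs)
    then show ?case
      using two_sided_ideal_mult_cong[OF J letter[of x] Cons] by (simp add: gen_Cons[of x xs])
  qed
  show ?thesis
  proof (induction v rule: free_induct)
    case (add u v)
    then show ?case using free.subspace_add[OF S add] by (simp add: nf_add add_diff_add)
  next
    case (scale c v)
    then show ?case using free.subspace_scale[OF S scale] by (simp add: nf_scale free.scale_right_diff_distrib)
  qed (simp_all add: word nf_gen nf_zero free.subspace_0[OF S])
qed

text \<open>If the normal form of the raw action vanishes, the raw action takes values in the tensor
  ideal, so \<open>a\<close> acts as zero on classes.\<close>

lemma opr_faithful:
  assumes "\<And>v. opr a v = 0"
  shows "a = 0"
proof (rule faithful)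
  let ?J = "tensor_algebra_ideal sX"
  have J: "two_sided_ideal ?J" unfolding tensor_algebra_ideal_def by (rule two_sided_ideal_hull)
  note S = two_sided_ideal_subspace[OF J]
  let ?A = "lin_ext (\<lambda>xs. act_word \<psi> xs a)"
  fix t assume "t \<in> quotient_space ?J"
  then obtain u where u: "t = coset ?J u" by (auto simp: quotient_space_def)
  have A: "?A v \<in> ?J" for v
  proof -
    have "nf (?A v) = opr a v" by (simp add: linear_lin_ext[OF nf_linear] opr_def)
    then show ?thesis using nf_cong[of "?A v"] assms by simp
  qed
  have "lift1 ?J ?A (coset ?J u) = coset ?J (?A u)"
    by (rule lift1_coset) (auto intro: two_sided_idealD(1)[OF J] free.subspace_diff[OF S] A)
  then show "act sX \<psi> a t = coset ?J 0"
    using A[of u] coset_eq_0_iff[OF two_sided_idealD(1)[OF J]] unfolding act_def u by auto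
qed

end

section \<open>Homogeneous operators\<close>

locale graded_alphabet = alphabet_basis p sL brk pm sX \<psi> B
  for p :: nat
    and sL :: "'k::field \<Rightarrow> 'l::ab_group_add \<Rightarrow> 'l"
    and brk :: "'l \<Rightarrow> 'l \<Rightarrow> 'l"
    and pm :: "'l \<Rightarrow> 'l"
    and sX :: "'k \<Rightarrow> 'x::comm_ring_1 \<Rightarrow> 'x"
    and \<psi> :: "'l \<Rightarrow> ('k, 'x, 'l) wreath"
    and B :: "'x set" +
  fixes r :: real and GL :: "real \<Rightarrow> 'l set" and GX :: "real \<Rightarrow> 'x set" and deg :: "'x \<Rightarrow> real"
  assumes compat: "compatible_gradings sL brk sX \<psi> r GL GX"
    and B_deg: "b \<in> B \<Longrightarrow> b \<in> GX (deg b)"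
begin

sublocale GL: graded_space sL GL
  using compat by unfold_locales (simp add: compatible_gradings_def product_grading_def)

sublocale GX: graded_space sX GX
  using compat by unfold_locales (simp add: compatible_gradings_def product_grading_def)

lemma GX_mult: "x \<in> GX d \<Longrightarrow> y \<in> GX e \<Longrightarrow> x * y \<in> GX (d + e)"
  using compat by (simp add: compatible_gradings_def product_grading_def)

lemma psi_homogeneous:
  assumes "a \<in> GL d"
  obtains u where "u \<in> fst (\<psi> a)"
    and "\<And>y b. (y, b) \<in> Poly_Mapping.keys u \<Longrightarrow> \<exists>e f. y \<in> GX e \<and> b \<in> GL f \<and> d = e + r * f"
proof -
  have "\<exists>u\<in>fst (\<psi> a). \<forall>(y, b)\<in>Poly_Mapping.keys u. \<exists>e f. y \<in> GX e \<and> b \<in> GL f \<and> d = e + r * f"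
    using assms compat by (simp add: compatible_gradings_def)
  then show ?thesis using that by fastforce
qed

lemma psi_derivation_homogeneous: "a \<in> GL d \<Longrightarrow> x \<in> GX e \<Longrightarrow> snd (\<psi> a) x \<in> GX (e + d)"
  using compat unfolding compatible_gradings_def by blast

text \<open>The letter in position \<open>i\<close>, counted from \<open>0\<close>, is scaled by
  \<open>r ^ i\<close>. With this convention the compatibility of \<psi> says that an element of
  degree \<open>d\<close> shifts the degree of words by exactly \<open>d\<close>.\<close>

primrec wdeg :: "'x list \<Rightarrow> real" where
  "wdeg [] = 0"
| "wdeg (b # bs) = deg b + r * wdeg bs"

definition words :: "real set \<Rightarrow> ('x list \<Rightarrow>\<^sub>0 'k) set" where
  "words S = {v. \<forall>w\<in>Poly_Mapping.keys v. w \<in> lists B \<and> wdeg w \<in> S}"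

lemma subspace_words: "free.subspace (words S)"
proof (rule free.subspaceI)
  show "u + v \<in> words S" if "u \<in> words S" "v \<in> words S" for u v
    using that keys_add[of u v] by (auto simp: words_def)
  show "fscale c u \<in> words S" if "u \<in> words S" for c u
    using that by (auto simp: words_def in_keys_iff lookup_fscale)
qed (simp add: words_def)

lemma words_gen: "w \<in> lists B \<Longrightarrow> wdeg w \<in> S \<Longrightarrow> gen w \<in> words S"
  by (simp add: words_def)

lemma words_mono: "v \<in> words S \<Longrightarrow> S \<subseteq> T \<Longrightarrow> v \<in> words T"
  by (auto simp: words_def)

lemma words_linear:
  assumes "Vector_Spaces.linear fscale fscale F" "v \<in> words S"
    and "\<And>w. w \<in> lists B \<Longrightarrow> wdeg w \<in> S \<Longrightarrow> F (gen w) \<in> words T"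
  shows "F v \<in> words T"
  unfolding linear_eq_lin_ext[OF assms(1), of v]
  using assms(2) by (intro lin_ext_in_subspace subspace_words assms(3)) (auto simp: words_def)

lemma coord_mult_words:
  assumes "v \<in> words S"
    and "\<And>b s. b \<in> B \<Longrightarrow> X.representation B x b \<noteq> 0 \<Longrightarrow> s \<in> S \<Longrightarrow> deg b + r * s \<in> T"
  shows "coord x * v \<in> words T"
proof (rule words_linear[OF _ assms(1)])
  show "Vector_Spaces.linear fscale fscale (\<lambda>v. coord x * v)"
    by (simp add: Vector_Spaces.linear_iff free.vector_space_axioms distrib_left fscale_mult_right)
  fix w assume w: "w \<in> lists B" "wdeg w \<in> S"
  have "fscale (X.representation B x b) (gen [b]) * gen w \<in> words T" if "b \<in> B" for b
  proof (cases "X.representation B x b = 0")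
    case True
    then show ?thesis by (simp add: free.subspace_0[OF subspace_words])
  next
    case False
    then have "gen (b # w) \<in> words T"
      using that w assms(2) by (intro words_gen) auto
    then show ?thesis
      unfolding fscale_mult_left gen_Cons[of b w] by (rule free.subspace_scale[OF subspace_words])
  qed
  then show "coord x * gen w \<in> words T"
    unfolding coord_def sum_distrib_right by (rule free.subspace_sum[OF subspace_words])
qed

lemma coord_mult_homogeneous:
  assumes "v \<in> words S" "x \<in> GX e" "\<And>s. s \<in> S \<Longrightarrow> e + r * s \<in> T"
  shows "coord x * v \<in> words T"
proof (rule coord_mult_words[OF assms(1)])
  fix b s assume "b \<in> B" "X.representation B x b \<noteq> 0" "s \<in> S"
  then show "deg b + r * s \<in> T"
    using GX.representation_homogeneous[OF finite_B independent_B span_B B_deg assms(2)] assms(3) by metis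
qed

lemma nf_gen_basis: "w \<in> lists B \<Longrightarrow> nf (gen w) = gen w"
proof (induction w)
  case Nil
  show ?case using nf_gen[of "[]"] by (simp add: gen_Nil)
next
  case (Cons b w)
  then show ?case using nf_gen[of "b # w"] nf_gen[of w] by (simp add: coord_basis gen_Cons[of b w])
qed

lemma nf_words: "nf v \<in> words UNIV"
proof (induction v rule: free_induct)
  case (gen xs)
  show ?case
  proof (induction xs)
    case Nil
    show ?case using words_gen[of "[]" UNIV] by (simp add: nf_gen_basis)
  next
    case (Cons x xs)
    then show ?case using coord_mult_words[OF Cons, of x UNIV] by (simp add: nf_gen)
  qed
qed (simp_all add: nf_zero nf_add nf_scale free.subspace_0[OF subspace_words]
    free.subspace_add[OF subspace_words] free.subspace_scale[OF subspace_words])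

lemma opr_basis_Cons:
  assumes "b # w \<in> lists B" "u \<in> fst (\<psi> a)"
  shows "opr a (gen (b # w)) = lin_ext (\<lambda>(y, c). coord (b * y) * opr c (gen w)) u + coord (snd (\<psi> a) b) * gen w"
proof -
  have "u - rep a \<in> N" using assms(2) psi_rep[of a] by (simp add: coset_def)
  from tail_op_cong[OF this, of b "gen w"] show ?thesis
    using assms(1) by (simp add: gen_Cons[of b w] opr_Cons nf_gen_basis tail_op_def)
qed

lemma opr_homogeneous:
  assumes "w \<in> lists B" "a \<in> GL d"
  shows "opr a (gen w) \<in> words {wdeg w + d}"
  using assms
proof (induction w arbitrary: a d rule: list.induct)
  case Nil
  show ?case by (simp add: gen_Nil opr_Nil free.subspace_0[OF subspace_words])
next
  case (Cons b w)
  then have b: "b \<in> GX (deg b)" and w: "w \<in> lists B" using B_deg by auto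
  obtain u where u: "u \<in> fst (\<psi> a)"
    and hom: "\<And>y c. (y, c) \<in> Poly_Mapping.keys u \<Longrightarrow> \<exists>e f. y \<in> GX e \<and> c \<in> GL f \<and> d = e + r * f"
    using psi_homogeneous[OF Cons.prems(2)] by blast
  have "lin_ext (\<lambda>(y, c). coord (b * y) * opr c (gen w)) u \<in> words {wdeg (b # w) + d}"
  proof (rule lin_ext_in_subspace[OF subspace_words], clarify)
    fix y c assume "(y, c) \<in> Poly_Mapping.keys u"
    then obtain e f where ef: "y \<in> GX e" "c \<in> GL f" "d = e + r * f" using hom by blast
    show "coord (b * y) * opr c (gen w) \<in> words {wdeg (b # w) + d}"
      by (rule coord_mult_homogeneous[OF Cons.IH[OF w ef(2)] GX_mult[OF b ef(1)]])
        (simp add: ef(3) algebra_simps)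
  qed
  moreover have "coord (snd (\<psi> a) b) * gen w \<in> words {wdeg (b # w) + d}"
    by (rule coord_mult_homogeneous[of _ "{wdeg w}", OF words_gen[OF w]
          psi_derivation_homogeneous[OF Cons.prems(2) b]]) simp_all
  ultimately show ?case
    unfolding opr_basis_Cons[OF Cons.prems(1) u] by (rule free.subspace_add[OF subspace_words])
qed

lemma opr_supported:
  assumes "w \<in> lists B" "a \<in> GL.supported D"
  shows "opr a (gen w) \<in> words {s. s - wdeg w \<in> D}"
proof -
  have "a \<in> {a. opr a (gen w) \<in> words {s. s - wdeg w \<in> D}}"
  proof (rule GL.supported_induct[OF assms(2)])
    show "L.subspace {a. opr a (gen w) \<in> words {s. s - wdeg w \<in> D}}"
      by (auto simp: L.subspace_def opr_lie_zero opr_lie_add opr_lie_scale free.subspace_0[OF subspace_words]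
        free.subspace_add[OF subspace_words] free.subspace_scale[OF subspace_words])
    show "x \<in> {a. opr a (gen w) \<in> words {s. s - wdeg w \<in> D}}" if "d \<in> D" "x \<in> GL d" for d x
      using words_mono[OF opr_homogeneous[OF assms(1) that(2)]] that(1) by auto
  qed
  then show ?thesis by simp
qed

lemma opr_eq_zeroI:
  assumes "\<And>w. w \<in> lists B \<Longrightarrow> opr a (gen w) = 0"
  shows "a = 0"
proof (rule opr_faithful)
  fix v
  have "opr a (nf v) = lin_ext (\<lambda>w. opr a (gen w)) (nf v)"
    by (rule linear_eq_lin_ext[OF opr_linear])
  also have "\<dots> = lin_ext (\<lambda>w. 0) (nf v)"
    using nf_words[of v] by (intro lin_ext_cong_keys assms) (simp add: words_def)
  finally show "opr a v = 0" by (simp add: opr_nf lin_ext_fun_zero)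
qed

text \<open>Components of different degrees send \<open>w\<close> to words of different degrees, so
  nothing cancels between them. A component with degree outside \<open>D\<close> must then kill
  every word, and faithfulness makes it zero.\<close>

lemma supportedI:
  assumes "\<And>w. w \<in> lists B \<Longrightarrow> opr a (gen w) \<in> words {s. s - wdeg w \<in> D}"
  shows "a \<in> GL.supported D"
  unfolding GL.supported_iff
proof (intro allI impI opr_eq_zeroI)
  fix d w assume d: "d \<notin> D" and w: "w \<in> lists B"
  let ?c = "\<lambda>e. Poly_Mapping.lookup (hcomp GL a) e"
  have hom: "opr (?c e) (gen w) \<in> words {wdeg w + e}" for e
    by (rule opr_homogeneous[OF w GL.hcomp_props(1)])
  show "opr (?c d) (gen w) = 0"
  proof (rule ccontr)
    assume "opr (?c d) (gen w) \<noteq> 0"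
    then obtain z where z: "z \<in> Poly_Mapping.keys (opr (?c d) (gen w))"
      by (metis keys_eq_empty ex_in_conv)
    then have wz: "wdeg z = wdeg w + d" using hom[of d] by (auto simp: words_def)
    have "opr (\<Sum>e\<in>S. ?c e) (gen w) = (\<Sum>e\<in>S. opr (?c e) (gen w))" for S
      by (induction S rule: infinite_finite_induct) (simp_all add: opr_lie_zero opr_lie_add)
    then have "opr a (gen w) = (\<Sum>e\<in>Poly_Mapping.keys (hcomp GL a). opr (?c e) (gen w))"
      by (metis GL.hcomp_props(2))
    then have "Poly_Mapping.lookup (opr a (gen w)) z
        = (\<Sum>e\<in>Poly_Mapping.keys (hcomp GL a). Poly_Mapping.lookup (opr (?c e) (gen w)) z)"
      by (simp add: lookup_sum)
    also have "\<dots> = (\<Sum>e\<in>Poly_Mapping.keys (hcomp GL a).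
        if e = d then Poly_Mapping.lookup (opr (?c d) (gen w)) z else 0)"
    proof (rule sum.cong[OF refl])
      fix e
      show "Poly_Mapping.lookup (opr (?c e) (gen w)) z
          = (if e = d then Poly_Mapping.lookup (opr (?c d) (gen w)) z else 0)"
        by (cases "e = d") (use hom[of e] wz in \<open>auto simp: words_def simp flip: not_in_keys_iff_lookup_eq_zero\<close>)
    qed
    also have "\<dots> = Poly_Mapping.lookup (opr (?c d) (gen w)) z"
      using z by (auto simp: in_keys_iff opr_lie_zero)
    finally have "z \<in> Poly_Mapping.keys (opr a (gen w))" using z by (simp add: in_keys_iff)
    then show False using assms[OF w] wz d by (auto simp: words_def)
  qed
qed

text \<open>On words \<open>pm a\<close> is the \<open>p\<close>-fold iterate of \<open>a\<close>,
  and each application shifts degrees by \<open>d\<close>; \<open>supportedI\<close> carries this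
  back to the Lie algebra.\<close>

lemma pm_homogeneous:
  assumes "a \<in> GL d"
  shows "pm a \<in> GL (real p * d)"
proof -
  have "pm a \<in> GL.supported {real p * d}"
  proof (rule supportedI)
    fix w assume w: "w \<in> lists B"
    have "(opr a ^^ n) (gen w) \<in> words {wdeg w + real n * d}" for n
    proof (induction n)
      case (Suc n)
      have "opr a ((opr a ^^ n) (gen w)) \<in> words {wdeg w + real (Suc n) * d}"
        by (rule words_linear[OF opr_linear Suc], rule words_mono[OF opr_homogeneous[OF _ assms]])
          (auto simp: algebra_simps)
      then show ?case by simp
    qed (simp add: words_gen w)
    from words_mono[OF this[of p]] show "opr (pm a) (gen w) \<in> words {s. s - wdeg w \<in> {real p * d}}"
      by (auto simp: opr_pm)
  qed
  then have "pm a \<in> {v. v \<in> GL (real p * d)}"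
    by (rule GL.supported_induct) (auto simp: GL.subspace_G)
  then show ?thesis by simp
qed

text \<open>Exchanging the first letter changes the degree by at most \<open>2 * K\<close>, and a
  change of the tail by at most \<open>M\<close> is scaled by \<open>r\<close>. So \<open>y\<close>
  may be any element of \<open>X\<close>, homogeneous or not; the alternative \<open>y = 0\<close>
  arises because a zero tensor says nothing about \<open>c\<close>.\<close>

lemma supported_step:
  assumes K: "\<And>b. b \<in> B \<Longrightarrow> \<bar>deg b\<bar> \<le> K" and M: "M \<ge> 0"
    and u: "u \<in> fst (\<psi> a)"
    and keys: "\<And>y c. (y, c) \<in> Poly_Mapping.keys u \<Longrightarrow> y = 0 \<or> c \<in> GL.supported {-M..M}"
  shows "a \<in> GL.supported {-(2 * K + \<bar>r\<bar> * M)..2 * K + \<bar>r\<bar> * M}"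
proof (rule supportedI)
  let ?D = "{-(2 * K + \<bar>r\<bar> * M)..2 * K + \<bar>r\<bar> * M}"
  fix w assume w: "w \<in> lists B"
  show "opr a (gen w) \<in> words {s. s - wdeg w \<in> ?D}"
  proof (cases w)
    case Nil
    then show ?thesis by (simp add: gen_Nil opr_Nil free.subspace_0[OF subspace_words])
  next
    case (Cons b z)
    then have b: "b \<in> B" and z: "z \<in> lists B" using w by auto
    have est: "deg b' + r * s - wdeg w \<in> ?D" if "b' \<in> B" "\<bar>s - wdeg z\<bar> \<le> M" for b' s
    proof -
      have "\<bar>r * (s - wdeg z)\<bar> \<le> \<bar>r\<bar> * M"
        unfolding abs_mult by (intro mult_left_mono that) simp
      moreover have "deg b' + r * s - wdeg w = (deg b' - deg b) + r * (s - wdeg z)"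
        by (simp add: Cons algebra_simps)
      ultimately show ?thesis using K[OF b] K[OF that(1)] by auto
    qed
    have "lin_ext (\<lambda>(y, c). coord (b * y) * opr c (gen z)) u \<in> words {s. s - wdeg w \<in> ?D}"
    proof (rule lin_ext_in_subspace[OF subspace_words], clarify)
      fix y c assume yc: "(y, c) \<in> Poly_Mapping.keys u"
      show "coord (b * y) * opr c (gen z) \<in> words {s. s - wdeg w \<in> ?D}"
      proof (cases "y = 0")
        case True
        then show ?thesis by (simp add: coord_zero free.subspace_0[OF subspace_words])
      next
        case False
        then have "opr c (gen z) \<in> words {s. s - wdeg z \<in> {-M..M}}"
          using keys[OF yc] by (intro opr_supported z) simp
        then show ?thesis
          by (rule coord_mult_words) (use est in \<open>auto simp: abs_le_iff\<close>)
      qed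
    qed
    moreover have "coord (snd (\<psi> a) b) * gen z \<in> words {s. s - wdeg w \<in> ?D}"
      by (rule coord_mult_words[of _ "{wdeg z}", OF words_gen[OF z]]) (use est[of _ "wdeg z"] M in auto)
    ultimately show ?thesis
      using w unfolding Cons opr_basis_Cons[OF w[unfolded Cons] u] by (intro free.subspace_add[OF subspace_words])
  qed
qed

end

lemma (in self_similar_lie_algebra) graded_alphabet_exists:
  assumes "compatible_gradings sL brk sX \<psi> r GL GX" "finite_dimensional_vector_space sX B'"
  obtains B deg where "graded_alphabet p sL brk pm sX \<psi> B r GL GX deg"
proof -
  interpret GX: graded_space sX GX
    using assms by unfold_locales (simp add: compatible_gradings_def product_grading_def)
  obtain B deg where B: "finite B" "X.independent B" "X.span B = UNIV" "\<And>b. b \<in> B \<Longrightarrow> b \<in> GX (deg b)"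
    using GX.homogeneous_basis[OF assms(2)] by blast
  have "graded_alphabet p sL brk pm sX \<psi> B r GL GX deg"
    by unfold_locales (fact B assms)+
  then show ?thesis by (rule that)
qed

section \<open>Growth of the second grading\<close>

text \<open>Some coordinate of \<open>y\<close> is nonzero, and it belongs to a basis element of the
  same degree; hence only finitely many degrees occur in \<open>X\<close>.\<close>

lemma (in graded_alphabet) GX_degree:
  assumes "y \<in> GX e" "y \<noteq> 0"
  shows "\<exists>b\<in>B. deg b = e"
proof (rule ccontr)
  assume "\<not> ?thesis"
  then have "X.representation B y b = 0" if "b \<in> B" for b
    using that GX.representation_homogeneous[OF finite_B independent_B span_B B_deg assms(1)] by blast
  then have "y = (\<Sum>b\<in>B. sX 0 b)" using basis_expansion[of y] by simp
  with assms(2) show False by simp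
qed

locale doubly_graded = self_similar_lie_algebra p sL brk pm sX \<psi>
  for p :: nat
    and sL :: "'k::field \<Rightarrow> 'l::ab_group_add \<Rightarrow> 'l"
    and brk :: "'l \<Rightarrow> 'l \<Rightarrow> 'l"
    and pm :: "'l \<Rightarrow> 'l"
    and sX :: "'k \<Rightarrow> 'x::comm_ring_1 \<Rightarrow> 'x"
    and \<psi> :: "'l \<Rightarrow> ('k, 'x, 'l) wreath" +
  fixes lam mu :: real
    and L_lam L_mu :: "real \<Rightarrow> 'l set"
    and X_lam X_mu :: "real \<Rightarrow> 'x set"
    and S :: "'l set"
  assumes finite_dim_X: "\<exists>B. finite_dimensional_vector_space sX B"
    and compat_lam: "compatible_gradings sL brk sX \<psi> lam L_lam X_lam"
    and compat_mu: "compatible_gradings sL brk sX \<psi> mu L_mu X_mu"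
    and dilations: "lam > \<bar>mu\<bar>" "\<bar>mu\<bar> > 1"
    and finite_S: "finite S" and S_pos: "S \<subseteq> (\<Union>d\<in>{0<..}. L_lam d)"
    and S_gen: "restricted_lie_subalgebra sL brk pm hull S = UNIV"
begin

sublocale Lam: graded_space sL L_lam
  using compat_lam by unfold_locales (simp add: compatible_gradings_def product_grading_def)

sublocale Mu: graded_space sL L_mu
  using compat_mu by unfold_locales (simp add: compatible_gradings_def product_grading_def)

lemma brk_lam: "a \<in> L_lam d \<Longrightarrow> b \<in> L_lam e \<Longrightarrow> brk a b \<in> L_lam (d + e)"
  and brk_mu: "a \<in> L_mu d \<Longrightarrow> b \<in> L_mu e \<Longrightarrow> brk a b \<in> L_mu (d + e)"
  using compat_lam compat_mu by (simp_all add: compatible_gradings_def product_grading_def)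

lemma pm_lam: "a \<in> L_lam d \<Longrightarrow> pm a \<in> L_lam (real p * d)"
  and pm_mu: "a \<in> L_mu d \<Longrightarrow> pm a \<in> L_mu (real p * d)"
proof -
  obtain B' where B': "finite_dimensional_vector_space sX B'" using finite_dim_X by blast
  obtain B deg where "graded_alphabet p sL brk pm sX \<psi> B lam L_lam X_lam deg"
    using graded_alphabet_exists[OF compat_lam B'] .
  then show "a \<in> L_lam d \<Longrightarrow> pm a \<in> L_lam (real p * d)" by (rule graded_alphabet.pm_homogeneous)
  obtain B deg where "graded_alphabet p sL brk pm sX \<psi> B mu L_mu X_mu deg"
    using graded_alphabet_exists[OF compat_mu B'] .
  then show "a \<in> L_mu d \<Longrightarrow> pm a \<in> L_mu (real p * d)" by (rule graded_alphabet.pm_homogeneous)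
qed

section \<open>Bounds for the second degree in terms of the first\<close>

definition bound :: "real \<Rightarrow> real \<Rightarrow> bool" where
  "bound n M \<longleftrightarrow> Lam.supported {..n} \<subseteq> Mu.supported {-M..M}"

lemma bound_mono: "bound n M \<Longrightarrow> n' \<le> n \<Longrightarrow> M \<le> M' \<Longrightarrow> bound n' M'"
  unfolding bound_def
  using Lam.supported_mono[of "{..n'}" "{..n}"] Mu.supported_mono[of "{-M..M}" "{-M'..M'}"] by force

lemma bound_step: "\<exists>K C. K \<ge> 0 \<and> C \<ge> 0
  \<and> (\<forall>n M. M \<ge> 0 \<longrightarrow> bound ((n + K) / lam) M \<longrightarrow> bound n (C + \<bar>mu\<bar> * M))"
proof -
  obtain B' where B': "finite_dimensional_vector_space sX B'" using finite_dim_X by blast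
  \<comment> \<open>The two gradings get separate bases of \<open>X\<close>. The first basis only
    bounds the degree of \<open>y\<close> from below; the second only bounds the shift of second
    degrees.\<close>
  obtain B deg where "graded_alphabet p sL brk pm sX \<psi> B lam L_lam X_lam deg"
    using graded_alphabet_exists[OF compat_lam B'] .
  then interpret l: graded_alphabet p sL brk pm sX \<psi> B lam L_lam X_lam deg .
  obtain Bm degm where "graded_alphabet p sL brk pm sX \<psi> Bm mu L_mu X_mu degm"
    using graded_alphabet_exists[OF compat_mu B'] .
  then interpret m: graded_alphabet p sL brk pm sX \<psi> Bm mu L_mu X_mu degm .
  define K where "K = (\<Sum>b\<in>B. \<bar>deg b\<bar>)"
  define C where "C = (\<Sum>b\<in>Bm. \<bar>degm b\<bar>)"
  have K: "\<bar>deg b\<bar> \<le> K" if "b \<in> B" for b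
    unfolding K_def by (rule member_le_sum) (use that l.finite_B in auto)
  have C: "\<bar>degm b\<bar> \<le> C" if "b \<in> Bm" for b
    unfolding C_def by (rule member_le_sum) (use that m.finite_B in auto)
  have "bound n (2 * C + \<bar>mu\<bar> * M)" if M: "M \<ge> 0" and b: "bound ((n + K) / lam) M" for n M
    unfolding bound_def
  proof
    fix a assume "a \<in> Lam.supported {..n}"
    then show "a \<in> Mu.supported {-(2 * C + \<bar>mu\<bar> * M)..2 * C + \<bar>mu\<bar> * M}"
    proof (rule Lam.supported_induct[OF _ Mu.subspace_supported])
      fix d x assume d: "d \<in> {..n}" and x: "x \<in> L_lam d"
      obtain u where u: "u \<in> fst (\<psi> x)"
        and hom: "\<And>y c. (y, c) \<in> Poly_Mapping.keys u \<Longrightarrow> \<exists>e f. y \<in> X_lam e \<and> c \<in> L_lam f \<and> d = e + lam * f"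
        using l.psi_homogeneous[OF x] by blast
      show "x \<in> Mu.supported {-(2 * C + \<bar>mu\<bar> * M)..2 * C + \<bar>mu\<bar> * M}"
      proof (rule m.supported_step[OF C M u])
        fix y c assume "(y, c) \<in> Poly_Mapping.keys u"
        then obtain e f where ef: "y \<in> X_lam e" "c \<in> L_lam f" "d = e + lam * f" using hom by blast
        show "y = 0 \<or> c \<in> Mu.supported {-M..M}"
        proof (cases "y = 0")
          case False
          \<comment> \<open>A nonzero \<open>y\<close> has one of the basis degrees, so
            \<open>lam * f = d - e\<close> exceeds \<open>n\<close> by at most
            \<open>K\<close>.\<close>
          then have "-K \<le> e" using l.GX_degree[OF ef(1)] K by fastforce
          then have "lam * f \<le> n + K" using ef(3) d by simp
          then have "f \<le> (n + K) / lam" using dilations by (simp add: field_simps)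
          then have "c \<in> Lam.supported {..(n + K) / lam}"
            using ef(2) by (intro Lam.homogeneous_supported) auto
          then show ?thesis using b by (auto simp: bound_def)
        qed simp
      qed
    qed
  qed
  moreover have "K \<ge> 0" "2 * C \<ge> 0" unfolding K_def C_def by (simp_all add: sum_nonneg)
  ultimately show ?thesis by blast
qed

text \<open>The weight counts generators, and a \<open>p\<close>-power counts \<open>p\<close>
  times. Being a natural number, it supports induction. It is a relation, since one element may be
  obtained with several weights.\<close>

inductive letter :: "nat \<Rightarrow> 'l \<Rightarrow> bool" where
  letter_gen: "s \<in> S \<Longrightarrow> letter 1 s"
| letter_brk: "letter i a \<Longrightarrow> letter j b \<Longrightarrow> letter (i + j) (brk a b)"
| letter_pm: "letter i a \<Longrightarrow> letter (p * i) (pm a)"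

lemma p_ge_2: "p \<ge> 2"
  using L.prime_p prime_ge_2_nat by blast

lemma letter_pos: "letter w b \<Longrightarrow> w > 0"
  by (induction rule: letter.induct) (use p_ge_2 in auto)

text \<open>Weights are positive and \<open>p \<ge> 2\<close>, so a letter outside \<open>S\<close>
  is made from strictly lighter letters.\<close>

lemma finite_letters: "finite {b. letter w b}"
proof (induction w rule: less_induct)
  case (less w)
  have "{b. letter w b} \<subseteq> S \<union> (\<Union>i<w. \<Union>j<w. (\<lambda>(a, b). brk a b) ` ({a. letter i a} \<times> {b. letter j b}))
      \<union> (\<Union>i<w. pm ` {a. letter i a})"
  proof
    fix b assume "b \<in> {b. letter w b}"
    then have "letter w b" by simp
    then show "b \<in> S \<union> (\<Union>i<w. \<Union>j<w. (\<lambda>(a, b). brk a b) ` ({a. letter i a} \<times> {b. letter j b}))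
      \<union> (\<Union>i<w. pm ` {a. letter i a})"
    proof cases
      case (letter_brk i a j b)
      then have "i < w" "j < w" using letter_pos by fastforce+
      with letter_brk show ?thesis by force
    next
      case (letter_pm i a)
      then have "i < w" using letter_pos[of i a] p_ge_2 by simp
      with letter_pm show ?thesis by force
    qed simp
  qed
  moreover have "finite (S \<union> (\<Union>i<w. \<Union>j<w. (\<lambda>(a, b). brk a b) ` ({a. letter i a} \<times> {b. letter j b}))
      \<union> (\<Union>i<w. pm ` {a. letter i a}))"
    using less finite_S by simp
  ultimately show ?case by (rule finite_subset)
qed

text \<open>Weight and first degree both add under brackets and are multiplied by \<open>p\<close>
  under \<open>pm\<close> (this is \<open>pm_lam\<close>), so bounds on the generators propagate to
  all letters.\<close>

lemma letter_degree:
  "\<exists>\<epsilon> D :: real. \<epsilon> > 0 \<and> D > 0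
    \<and> (\<forall>w b. letter w b \<longrightarrow> (\<exists>d. real w * \<epsilon> \<le> d \<and> d \<le> real w * D \<and> b \<in> L_lam d))"
proof -
  obtain ds where ds: "\<And>s. s \<in> S \<Longrightarrow> ds s > 0 \<and> s \<in> L_lam (ds s)"
    using S_pos by (metis UN_E greaterThan_iff subsetD)
  \<comment> \<open>Inserting \<open>1\<close> makes minimum and maximum meaningful for an empty
    \<open>S\<close>.\<close>
  define \<epsilon> where "\<epsilon> = Min (insert 1 (ds ` S))"
  define D where "D = Max (insert 1 (ds ` S))"
  have eps: "\<epsilon> > 0" and D: "D \<ge> 1" using finite_S ds by (auto simp: \<epsilon>_def D_def)
  have "\<exists>d. real w * \<epsilon> \<le> d \<and> d \<le> real w * D \<and> b \<in> L_lam d" if "letter w b" for w b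
    using that
  proof induction
    case (letter_gen s)
    then have "\<epsilon> \<le> ds s" "ds s \<le> D" using finite_S by (auto simp: \<epsilon>_def D_def)
    then show ?case using ds[OF letter_gen] by auto
  next
    case (letter_brk i a j b)
    then obtain d e where h: "i * \<epsilon> \<le> d" "d \<le> i * D" "a \<in> L_lam d" "j * \<epsilon> \<le> e" "e \<le> j * D" "b \<in> L_lam e"
      by blast
    then show ?case using brk_lam[OF h(3,6)] by (intro exI[of _ "d + e"]) (simp add: distrib_right)
  next
    case (letter_pm i a)
    then obtain d where h: "i * \<epsilon> \<le> d" "d \<le> i * D" "a \<in> L_lam d" by blast
    then show ?case using pm_lam[OF h(3)]
      by (intro exI[of _ "real p * d"]) (simp add: mult.assoc mult_left_mono)
  qed
  with eps D show ?thesis by (intro exI[of _ \<epsilon>] exI[of _ D]) auto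
qed

lemma jacobson_sum_in_subspace:
  assumes "L.subspace A" "\<And>a b. a \<in> A \<Longrightarrow> b \<in> A \<Longrightarrow> brk a b \<in> A" "a \<in> A" "b \<in> A"
  shows "jacobson_sum p (+) 0 sL brk a b \<in> A"
  using jacobson_sum_rel[where R = "\<lambda>x y. x \<in> A \<and> y = x", of 0 0 "(+)" "(+)" sL sL brk brk a a b b p] assms
  by (auto simp: L.subspace_def)

text \<open>Although \<open>pm\<close> is not additive, its defect is a combination of brackets,
  which the span absorbs. So the span is a restricted subalgebra containing
  \<open>S\<close>.\<close>

lemma span_letters: "L.span {b. \<exists>w. letter w b} = UNIV"
proof -
  let ?A = "L.span {b. \<exists>w. letter w b}"
  have brk: "brk a b \<in> ?A" if "a \<in> ?A" "b \<in> ?A" for a b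
    using that(1)
  proof (induction rule: L.span_induct_alt)
    case (step c x y)
    from step(1) obtain i where x: "letter i x" by blast
    have "brk x b \<in> ?A" using that(2)
    proof (induction rule: L.span_induct_alt)
      case (step c z y)
      then obtain j where "letter j z" by blast
      then have "brk x z \<in> ?A" using x letter_brk by (intro L.span_base) blast
      then show ?case using step by (simp add: L.brk_plus L.brk_scale L.span_add L.span_scale)
    qed (simp add: L.brk_zero L.span_zero)
    then show ?case using step by (simp add: L.brk_plus L.brk_scale L.span_add L.span_scale)
  qed (simp add: L.brk_zero L.span_zero)
  \<comment> \<open>Membership of \<open>a\<close> is carried along because the Jacobson sum for the
    next summand needs it.\<close>
  have pm: "a \<in> ?A \<and> pm a \<in> ?A" if "a \<in> ?A" for a
    using that
  proof (induction rule: L.span_induct_alt)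
    case base
    have "pm 0 = 0" using L.pm_scale[of 0 0] L.p_pos by (simp add: zero_power)
    then show ?case by (simp add: L.span_zero)
  next
    case (step c x y)
    then obtain i where x: "letter i x" by blast
    have "pm x \<in> ?A" using letter_pm[OF x] by (intro L.span_base) blast
    moreover have cx: "sL c x \<in> ?A" using x by (intro L.span_scale L.span_base) blast
    moreover have "jacobson_sum p (+) 0 sL brk (sL c x) y \<in> ?A"
      by (rule jacobson_sum_in_subspace[OF L.subspace_span brk cx]) (use step in auto)
    ultimately show ?case
      using step by (simp add: L.pm_add L.pm_scale L.span_add L.span_scale)
  qed
  have "restricted_lie_subalgebra sL brk pm hull S \<subseteq> ?A"
  proof (rule hull_minimal)
    show "S \<subseteq> ?A" using letter_gen by (auto intro: L.span_base)
    show "restricted_lie_subalgebra sL brk pm ?A"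
      unfolding restricted_lie_subalgebra_def using brk pm L.subspace_span by blast
  qed
  then show ?thesis using S_gen by auto
qed

lemma bound_exists: "\<exists>M\<ge>0. bound n M"
proof -
  obtain \<epsilon> D where eps: "\<epsilon> > 0" and
    deg: "\<And>w b. letter w b \<Longrightarrow> \<exists>d. real w * \<epsilon> \<le> d \<and> d \<le> real w * D \<and> b \<in> L_lam d"
    using letter_degree by blast
  define T where "T = {b. \<exists>w d. letter w b \<and> real w * \<epsilon> \<le> d \<and> d \<le> n \<and> b \<in> L_lam d}"
  have weight: "w \<le> nat \<lceil>n / \<epsilon>\<rceil>" if "real w * \<epsilon> \<le> n" for w
  proof -
    have "real w \<le> n / \<epsilon>" using that eps by (simp add: field_simps)
    then show ?thesis by linarith
  qed
  have "T \<subseteq> (\<Union>w\<le>nat \<lceil>n / \<epsilon>\<rceil>. {b. letter w b})"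
  proof
    fix b assume "b \<in> T"
    then obtain w d where "letter w b" "real w * \<epsilon> \<le> d" "d \<le> n" by (auto simp: T_def)
    then show "b \<in> (\<Union>w\<le>nat \<lceil>n / \<epsilon>\<rceil>. {b. letter w b})" using weight[of w] by auto
  qed
  then have fin: "finite T" using finite_letters by (meson finite_UN_I finite_atMost finite_subset)
  have T: "Lam.supported {..n} \<subseteq> L.span T"
  proof
    fix a assume a: "a \<in> Lam.supported {..n}"
    \<comment> \<open>Modulo first degrees above \<open>n\<close> every element lies in the span of
      the finite set \<open>T\<close>. When \<open>a\<close> itself lives in degrees at most
      \<open>n\<close>, the remainder has empty support and vanishes.\<close>
    have sub: "L.subspace {v. \<exists>y\<in>L.span T. v - y \<in> Lam.supported {n<..}}"
    proof (rule L.subspaceI)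
      show "0 \<in> {v. \<exists>y\<in>L.span T. v - y \<in> Lam.supported {n<..}}"
        using L.span_zero L.subspace_0[OF Lam.subspace_supported] by force
    next
      fix u v assume "u \<in> {v. \<exists>y\<in>L.span T. v - y \<in> Lam.supported {n<..}}"
        "v \<in> {v. \<exists>y\<in>L.span T. v - y \<in> Lam.supported {n<..}}"
      then obtain y z where "y \<in> L.span T" "z \<in> L.span T"
        "u - y \<in> Lam.supported {n<..}" "v - z \<in> Lam.supported {n<..}" by blast
      then have "y + z \<in> L.span T" "u + v - (y + z) \<in> Lam.supported {n<..}"
        by (simp_all add: L.span_add add_diff_add L.subspace_add[OF Lam.subspace_supported])
      then show "u + v \<in> {v. \<exists>y\<in>L.span T. v - y \<in> Lam.supported {n<..}}" by blast
    next
      fix c v assume "v \<in> {v. \<exists>y\<in>L.span T. v - y \<in> Lam.supported {n<..}}"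
      then obtain y where "y \<in> L.span T" "v - y \<in> Lam.supported {n<..}" by blast
      then have "sL c y \<in> L.span T" "sL c v - sL c y \<in> Lam.supported {n<..}"
        by (simp_all add: L.span_scale L.subspace_scale[OF Lam.subspace_supported] flip: L.scale_right_diff_distrib)
      then show "sL c v \<in> {v. \<exists>y\<in>L.span T. v - y \<in> Lam.supported {n<..}}" by blast
    qed
    have "L.span {b. \<exists>w. letter w b} \<subseteq> {v. \<exists>y\<in>L.span T. v - y \<in> Lam.supported {n<..}}"
    proof (rule L.span_minimal[OF _ sub], clarify)
      fix b w assume b: "letter w b"
      then obtain d where d: "real w * \<epsilon> \<le> d" "b \<in> L_lam d" using deg by blast
      show "\<exists>y\<in>L.span T. b - y \<in> Lam.supported {n<..}"
      proof (cases "d \<le> n")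
        case True
        then have "b \<in> L.span T" using b d by (intro L.span_base) (auto simp: T_def)
        then show ?thesis using L.subspace_0[OF Lam.subspace_supported] by force
      next
        case False
        then have "b - 0 \<in> Lam.supported {n<..}" using d(2) by (auto intro: Lam.homogeneous_supported)
        then show ?thesis using L.span_zero by blast
      qed
    qed
    then obtain y where y: "y \<in> L.span T" "a - y \<in> Lam.supported {n<..}"
      using span_letters by blast
    have "L.span T \<subseteq> Lam.supported {..n}"
      by (rule L.span_minimal[OF _ Lam.subspace_supported]) (auto simp: T_def intro: Lam.homogeneous_supported)
    then have "a - y \<in> Lam.supported {..n}"
      using a y(1) by (intro L.subspace_diff[OF Lam.subspace_supported]) auto
    with y(2) have "a - y \<in> Lam.supported {}" by (simp add: Lam.supported_iff) (meson not_le)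
    then have "a - y \<in> {0}" by (rule Lam.supported_induct) auto
    with y(1) show "a \<in> L.span T" by simp
  qed
  \<comment> \<open>A crude bound: finitely many letters, each with finitely many
    components.\<close>
  define M where "M = (\<Sum>b\<in>T. \<Sum>d\<in>Poly_Mapping.keys (hcomp L_mu b). \<bar>d\<bar>)"
  have "b \<in> Mu.supported {-M..M}" if b: "b \<in> T" for b
  proof -
    have "\<bar>d\<bar> \<le> M" if "d \<in> Poly_Mapping.keys (hcomp L_mu b)" for d
    proof -
      have "\<bar>d\<bar> \<le> (\<Sum>d\<in>Poly_Mapping.keys (hcomp L_mu b). \<bar>d\<bar>)"
        by (rule member_le_sum) (use that in auto)
      also have "\<dots> \<le> M"
        unfolding M_def by (rule member_le_sum[OF b]) (auto simp: fin sum_nonneg)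
      finally show ?thesis .
    qed
    then show ?thesis by (auto simp: Mu.supported_def abs_le_iff minus_le_iff)
  qed
  then have "L.span T \<subseteq> Mu.supported {-M..M}"
    by (intro L.span_minimal Mu.subspace_supported) auto
  moreover have "M \<ge> 0" unfolding M_def by (intro sum_nonneg) auto
  ultimately show ?thesis using T unfolding bound_def by blast
qed

text \<open>Iterating \<open>bound_step\<close> shows that degrees up to \<open>c + \<lambda>\<^sup>j\<close> are bounded by \<open>O(\<bar>\<mu>\<bar>\<^sup>j)\<close>, where \<open>c\<close>
  is the fixed point of \<open>n \<mapsto> (n + K) / \<lambda>\<close>.\<close>

lemma bound_sublinear:
  fixes \<delta> :: real
  assumes "\<delta> > 0"
  shows "\<exists>A\<ge>0. \<forall>n\<ge>0. bound n (A + \<delta> * n)"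
proof -
  obtain K C where K: "K \<ge> 0" and C: "C \<ge> 0"
    and step: "\<And>n M. M \<ge> 0 \<Longrightarrow> bound ((n + K) / lam) M \<Longrightarrow> bound n (C + \<bar>mu\<bar> * M)"
    using bound_step by blast
  have lam: "lam > 1" using dilations by simp
  define c where "c = K / (lam - 1)"
  define q where "q = \<bar>mu\<bar>"
  have q: "q > 1" "q < lam" using dilations by (simp_all add: q_def)
  have c: "c \<ge> 0" "(c + K) / lam = c" using K lam by (auto simp: c_def field_simps)
  obtain M1 where M1: "M1 \<ge> 0" "bound (c + 1) M1" using bound_exists by blast
  \<comment> \<open>\<open>- H\<close> is the fixed point of \<open>M \<mapsto> C + q * M\<close>,
    so \<open>q ^ j * M2 - H\<close> solves the recursion of bounds exactly.\<close>
  define H where "H = C / (q - 1)"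
  have H: "H \<ge> 0" "C = H * (q - 1)" using C q by (auto simp: H_def)
  define M2 where "M2 = M1 + H"
  have "bound (c + lam ^ j) (q ^ j * M2 - H)" for j
  proof (induction j)
    case 0
    then show ?case using M1 by (simp add: M2_def)
  next
    case (Suc j)
    have "q ^ j \<ge> 1" using q by simp
    then have "1 * M2 \<le> q ^ j * M2" using M1(1) H(1) by (intro mult_right_mono) (auto simp: M2_def)
    then have nonneg: "q ^ j * M2 - H \<ge> 0" using M1(1) by (simp add: M2_def)
    have "(c + lam ^ Suc j + K) / lam = c + lam ^ j"
      using c(2) lam by (simp add: field_simps)
    then have "bound (c + lam ^ Suc j) (C + q * (q ^ j * M2 - H))"
      using step[OF nonneg, of "c + lam ^ Suc j"] Suc.IH by (simp add: q_def)
    also have "C + q * (q ^ j * M2 - H) = q ^ Suc j * M2 - H"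
      unfolding H(2) by (simp add: algebra_simps)
    finally show ?case .
  qed
  then have iter: "bound (c + lam ^ j) (q ^ j * M2)" for j
    by (rule bound_mono) (use H in auto)
  have M2: "M2 \<ge> 0" using M1 H by (simp add: M2_def)
  \<comment> \<open>The extra factor \<open>q\<close> pays for rounding \<open>n\<close> up to the
    next \<open>c + lam ^ j\<close>: then \<open>n\<close> is only known to dominate
    \<open>lam ^ (j - 1)\<close>.\<close>
  have "(\<lambda>i. q * M2 * (q / lam) ^ i) \<longlonglongrightarrow> q * M2 * 0"
    using q by (intro tendsto_mult_left LIMSEQ_power_zero) simp
  then have "eventually (\<lambda>i. q * M2 * (q / lam) ^ i < \<delta>) sequentially"
    using assms by (intro order_tendstoD) auto
  then obtain i0 where i0: "\<And>i. i \<ge> i0 \<Longrightarrow> q * M2 * (q / lam) ^ i < \<delta>"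
    by (auto simp: eventually_sequentially)
  \<comment> \<open>The first term absorbs the indices below \<open>i0\<close>, where the limit
    gives nothing yet; \<open>M2\<close> serves \<open>j = 0\<close> and compensates for the
    rounding of \<open>n\<close> in no other case.\<close>
  define A where "A = q * M2 * q ^ i0 + M2"
  have A: "A \<ge> 0" using q M2 by (simp add: A_def)
  have est: "q * M2 * q ^ i \<le> q * M2 * q ^ i0 + \<delta> * lam ^ i" for i
  proof (cases "i \<ge> i0")
    case True
    have "q * M2 * q ^ i = q * M2 * (q / lam) ^ i * lam ^ i" using lam by (simp add: power_divide)
    also have "\<dots> \<le> \<delta> * lam ^ i" using i0[OF True] lam by (intro mult_right_mono) auto
    also have "\<dots> \<le> q * M2 * q ^ i0 + \<delta> * lam ^ i" using q M2 by simp
    finally show ?thesis .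
  next
    case False
    then have "q ^ i \<le> q ^ i0" using q by (intro power_increasing) auto
    then have "q * M2 * q ^ i \<le> q * M2 * q ^ i0" using q M2 by (intro mult_left_mono) auto
    also have "\<dots> \<le> \<dots> + \<delta> * lam ^ i" using assms lam by simp
    finally show ?thesis .
  qed
  have "bound n (A + \<delta> * n)" if n: "n \<ge> 0" for n
  proof -
    obtain k where "n - c < lam ^ k" using real_arch_pow[OF lam] by blast
    then have ex: "n \<le> c + lam ^ k" by simp
    define j where "j = (LEAST j. n \<le> c + lam ^ j)"
    have j: "n \<le> c + lam ^ j" unfolding j_def by (rule LeastI[of _ k]) (rule ex)
    show ?thesis
    proof (cases j)
      case 0
      have "0 \<le> q * M2 * q ^ i0" "0 \<le> \<delta> * n" using q M2 assms n by simp_all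
      then have "M2 \<le> A + \<delta> * n" by (simp add: A_def)
      then show ?thesis using bound_mono[OF iter[of 0]] j 0 by simp
    next
      case (Suc i)
      then have "\<not> n \<le> c + lam ^ i" using not_less_Least[of i "\<lambda>j. n \<le> c + lam ^ j"] by (simp add: j_def)
      then have "lam ^ i \<le> n" using c by simp
      then have "\<delta> * lam ^ i \<le> \<delta> * n" using assms by simp
      then have "q ^ j * M2 \<le> A + \<delta> * n" using est[of i] M2 by (simp add: A_def Suc mult_ac)
      then show ?thesis using bound_mono[OF iter[of j] j] by simp
    qed
  qed
  with A show ?thesis by blast
qed

lemma letter_growth:
  fixes \<delta> :: real
  assumes "\<delta> > 0"
  shows "\<exists>A\<ge>0. \<forall>w b. letter w b \<longrightarrow> b \<in> Mu.supported {-(A + \<delta> * w)..A + \<delta> * w}"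
proof -
  obtain \<epsilon> D where eps: "\<epsilon> > 0" "D > 0" and
    deg: "\<And>w b. letter w b \<Longrightarrow> \<exists>d. real w * \<epsilon> \<le> d \<and> d \<le> real w * D \<and> b \<in> L_lam d"
    using letter_degree by blast
  obtain A where A: "A \<ge> 0" "\<And>n. n \<ge> 0 \<Longrightarrow> bound n (A + \<delta> / D * n)"
    using bound_sublinear[of "\<delta> / D"] eps assms by auto
  have "b \<in> Mu.supported {-(A + \<delta> * w)..A + \<delta> * w}" if l: "letter w b" for w b
  proof -
    obtain d where "d \<le> w * D" "b \<in> L_lam d" using deg[OF l] by blast
    then have "b \<in> Lam.supported {..w * D}" by (intro Lam.homogeneous_supported) auto
    then show ?thesis using A(2)[of "w * D"] eps by (auto simp: bound_def)
  qed
  with A(1) show ?thesis by blast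
qed

end

section \<open>The induced grading of the restricted enveloping algebra\<close>

lemma lookup_single_mult_left:
  "Poly_Mapping.lookup (Poly_Mapping.single e a * f) k = a * Poly_Mapping.lookup f (k - e :: real)"
  for f :: "real \<Rightarrow>\<^sub>0 'b::ring_1"
proof -
  have "k = e + q \<longleftrightarrow> k - e = q" for q by auto
  then show ?thesis
    by (simp add: lookup_mult lookup_single when_mult)
qed

lemma lookup_single_mult_right:
  "Poly_Mapping.lookup (f * Poly_Mapping.single e a) k = Poly_Mapping.lookup f (k - e :: real) * a"
  for f :: "real \<Rightarrow>\<^sub>0 'b::ring_1"
proof -
  have "(\<Sum>q. Poly_Mapping.lookup (Poly_Mapping.single e a) q when k = l + q) = (a when k = l + e)" for l
  proof -
    have "(\<Sum>q. Poly_Mapping.lookup (Poly_Mapping.single e a) q when k = l + q)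
        = (\<Sum>q. (a when k = l + e) when e = q)"
      by (rule arg_cong[where f = Sum_any]) (auto simp: fun_eq_iff when_def lookup_single)
    then show ?thesis by simp
  qed
  then have "Poly_Mapping.lookup (f * Poly_Mapping.single e a) k
      = (\<Sum>l. Poly_Mapping.lookup f l * (a when k = l + e))"
    by (simp add: lookup_mult)
  also have "\<dots> = (\<Sum>l. Poly_Mapping.lookup f l * a when k - e = l)"
    by (rule arg_cong[where f = Sum_any]) (auto simp: fun_eq_iff when_def)
  finally show ?thesis by simp
qed

lemma sum_single_lookup: "(\<Sum>e\<in>Poly_Mapping.keys f. Poly_Mapping.single e (Poly_Mapping.lookup f e)) = f"
proof (rule poly_mapping_eqI)
  fix k
  have "(\<Sum>e\<in>Poly_Mapping.keys f. if e = k then Poly_Mapping.lookup f e else 0) = Poly_Mapping.lookup f k"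
    by (cases "k \<in> Poly_Mapping.keys f") (simp_all add: sum.delta' in_keys_iff)
  then show "Poly_Mapping.lookup (\<Sum>e\<in>Poly_Mapping.keys f. Poly_Mapping.single e (Poly_Mapping.lookup f e)) k
      = Poly_Mapping.lookup f k"
    by (simp add: lookup_sum lookup_single when_def)
qed

lemma lookup_mult_real:
  "Poly_Mapping.lookup (f * g) k
    = (\<Sum>e\<in>Poly_Mapping.keys f. Poly_Mapping.lookup f e * Poly_Mapping.lookup g (k - e :: real))"
  for f :: "real \<Rightarrow>\<^sub>0 'b::ring_1"
proof -
  have "Poly_Mapping.lookup (f * g) k = Poly_Mapping.lookup
      ((\<Sum>e\<in>Poly_Mapping.keys f. Poly_Mapping.single e (Poly_Mapping.lookup f e)) * g) k"
    by (simp only: sum_single_lookup)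
  then show ?thesis
    by (simp add: sum_distrib_right lookup_sum lookup_single_mult_left)
qed

definition coeffs_in :: "'b::ring_1 set \<Rightarrow> (real \<Rightarrow>\<^sub>0 'b) set" where
  "coeffs_in I = {f. \<forall>e. Poly_Mapping.lookup f e \<in> I}"

lemma two_sided_ideal_coeffs_in:
  assumes "two_sided_ideal I"
  shows "two_sided_ideal (coeffs_in I)"
proof -
  note I = two_sided_idealD[OF assms]
  have sum: "(\<Sum>i\<in>S. f i) \<in> I" if "\<And>i. i \<in> S \<Longrightarrow> f i \<in> I" for S :: "real set" and f
    using that by (induction S rule: infinite_finite_induct) (use I(1) add_subgroup_add[OF I(1)] in \<open>auto simp: add_subgroup_def\<close>)
  have "f * g \<in> coeffs_in I" if "f \<in> coeffs_in I \<or> g \<in> coeffs_in I" for f g :: "real \<Rightarrow>\<^sub>0 'a"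
    using that
  proof
    assume "f \<in> coeffs_in I"
    then show ?thesis unfolding coeffs_in_def by (auto simp: lookup_mult_real intro!: sum I(3))
  next
    assume "g \<in> coeffs_in I"
    then show ?thesis unfolding coeffs_in_def by (auto simp: lookup_mult_real intro!: sum I(2))
  qed
  then show ?thesis
    using I(1) unfolding two_sided_ideal_def
    by (auto simp: coeffs_in_def lookup_minus add_subgroup_def)
qed

text \<open>The augmentation, that is, evaluation at \<open>t = 1\<close>.\<close>

definition sum_coeffs :: "(real \<Rightarrow>\<^sub>0 'b::ring_1) \<Rightarrow> 'b" where
  "sum_coeffs f = (\<Sum>e\<in>Poly_Mapping.keys f. Poly_Mapping.lookup f e)"

lemma sum_coeffs_add: "sum_coeffs (f + g) = sum_coeffs f + sum_coeffs g"
proof -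
  let ?S = "Poly_Mapping.keys f \<union> Poly_Mapping.keys g"
  show ?thesis
    using keys_add[of f g] sum_lookup_superset[of ?S f] sum_lookup_superset[of ?S g] sum_lookup_superset[of ?S "f + g"]
    by (simp add: sum_coeffs_def lookup_add sum.distrib)
qed

lemma sum_coeffs_zero: "sum_coeffs 0 = 0"
  and sum_coeffs_single: "sum_coeffs (Poly_Mapping.single e a) = a"
  by (simp_all add: sum_coeffs_def)

lemma sum_coeffs_sum: "sum_coeffs (sum f S) = (\<Sum>i\<in>S. sum_coeffs (f i))"
  by (induction S rule: infinite_finite_induct) (simp_all add: sum_coeffs_zero sum_coeffs_add)

lemma sum_coeffs_mult: "sum_coeffs (f * g) = sum_coeffs f * sum_coeffs g"
proof -
  have "f * g = (\<Sum>e\<in>Poly_Mapping.keys f. Poly_Mapping.single e (Poly_Mapping.lookup f e))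
      * (\<Sum>e\<in>Poly_Mapping.keys g. Poly_Mapping.single e (Poly_Mapping.lookup g e))"
    by (simp only: sum_single_lookup)
  also have "sum_coeffs \<dots> = sum_coeffs f * sum_coeffs g"
    by (simp add: sum_distrib_left sum_distrib_right mult_single sum_coeffs_sum sum_coeffs_single)
      (simp add: sum_coeffs_def sum_distrib_left sum_distrib_right)
  finally show ?thesis .
qed

text \<open>With \<open>pm_G\<close> the relation \<open>a ^ p = pm a\<close> is homogeneous, so
  that the grading can descend to the restricted enveloping algebra. For the self-similar algebra it
  comes from \<open>pm_mu\<close>.\<close>

locale graded_restricted_lie_algebra =
  restricted_lie_algebra p scale brk pm + graded_space scale G
  for p :: nat
    and scale :: "'k::field \<Rightarrow> 'l::ab_group_add \<Rightarrow> 'l"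
    and brk :: "'l \<Rightarrow> 'l \<Rightarrow> 'l"
    and pm :: "'l \<Rightarrow> 'l"
    and G :: "real \<Rightarrow> 'l set" +
  assumes brk_G: "a \<in> G d \<Longrightarrow> b \<in> G e \<Longrightarrow> brk a b \<in> G (d + e)"
    and pm_G: "a \<in> G d \<Longrightarrow> pm a \<in> G (real p * d)"
begin

abbreviation "I \<equiv> uea_ideal p scale brk pm"

lemma ideal_I: "two_sided_ideal I"
  unfolding uea_ideal_def by (rule two_sided_ideal_hull)

lemmas I_subspace = two_sided_ideal_subspace[OF ideal_I]
lemmas I_add = free.subspace_add[OF I_subspace]
lemmas I_diff = free.subspace_diff[OF I_subspace]
lemmas I_group = two_sided_idealD(1)[OF ideal_I]
lemmas I_mult = two_sided_idealD(2,3)[OF ideal_I]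

lemma rel_add: "gen [a + b] - gen [a] - gen [b] \<in> I"
  unfolding uea_ideal_def
  by (rule hull_inc) (auto simp: linearity_relations_def intro!: range_eqI[of _ _ "(a, b)"])

lemma rel_scale: "gen [scale c a] - fscale c (gen [a]) \<in> I"
  unfolding uea_ideal_def
  by (rule hull_inc) (auto simp: linearity_relations_def intro!: range_eqI[of _ _ "(c, a)"])

lemma rel_brk: "gen [a] * gen [b] - gen [b] * gen [a] - gen [brk a b] \<in> I"
  unfolding uea_ideal_def
  by (rule hull_inc, rule UnI1, rule UnI2, rule range_eqI[of _ _ "(a, b)"]) simp

lemma rel_pm: "gen [a] ^ p - gen [pm a] \<in> I"
  unfolding uea_ideal_def by (rule hull_inc) auto

lemma rel_zero: "gen [0] \<in> I"
  using rel_scale[of 0 0] by simp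

lemma rel_sum: "gen [sum f S] - (\<Sum>i\<in>S. gen [f i]) \<in> I"
proof (induction S rule: infinite_finite_induct)
  case (insert i S)
  have "(gen [f i + sum f S] - gen [f i] - gen [sum f S]) + (gen [sum f S] - (\<Sum>i\<in>S. gen [f i])) \<in> I"
    by (intro I_add rel_add insert)
  then show ?case using insert(1,2) by (simp add: diff_diff_eq)
qed (simp_all add: rel_zero)

text \<open>The coaction \<open>a \<mapsto> \<Sum>\<^sub>e t\<^sup>e a\<^sub>e\<close> on the free algebra; its coefficients are the projections to the
  homogeneous components.\<close>

definition comp_gen :: "'l \<Rightarrow> real \<Rightarrow>\<^sub>0 ('l list \<Rightarrow>\<^sub>0 'k)" where
  "comp_gen a = (\<Sum>e\<in>Poly_Mapping.keys (hcomp G a). Poly_Mapping.single e (gen [Poly_Mapping.lookup (hcomp G a) e]))"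

definition const :: "'k \<Rightarrow> real \<Rightarrow>\<^sub>0 ('l list \<Rightarrow>\<^sub>0 'k)" where
  "const c = Poly_Mapping.single 0 (Poly_Mapping.single 0 c)"

definition coact :: "('l list \<Rightarrow>\<^sub>0 'k) \<Rightarrow> real \<Rightarrow>\<^sub>0 ('l list \<Rightarrow>\<^sub>0 'k)" where
  "coact = alg_ext const (\<lambda>as. prod_list (map comp_gen as))"

abbreviation "J \<equiv> coeffs_in I"

lemmas J_ideal = two_sided_ideal_coeffs_in[OF ideal_I]
lemmas J_group = two_sided_idealD(1)[OF J_ideal]
lemmas J_mult = two_sided_idealD(2,3)[OF J_ideal]
lemmas J_add = add_subgroup_add[OF J_group]
lemmas J_neg = add_subgroup_neg[OF J_group]

lemma J_diff: "f \<in> J \<Longrightarrow> g \<in> J \<Longrightarrow> f - g \<in> J"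
  using J_group by (simp add: add_subgroup_def)

lemma J_zero: "0 \<in> J"
  using J_group by (simp add: add_subgroup_def)

lemma J_trans: "f - g \<in> J \<Longrightarrow> g - h \<in> J \<Longrightarrow> f - h \<in> J"
  using J_add[of "f - g" "g - h"] by simp

lemma J_sym: "f - g \<in> J \<Longrightarrow> g - f \<in> J"
  using J_neg[of "f - g"] by simp

lemma J_single: "x \<in> I \<Longrightarrow> Poly_Mapping.single d x \<in> J"
  by (auto simp: coeffs_in_def lookup_single when_def free.subspace_0[OF I_subspace])

lemma lookup_const_mult: "Poly_Mapping.lookup (const c * f) e = fscale c (Poly_Mapping.lookup f e)"
  by (simp add: const_def lookup_single_mult_left fscale_eq_mult)

lemma coact_hom: "alg_hom const (\<lambda>as. prod_list (map comp_gen as))"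
proof unfold_locales
  show "const c * f = f * const c" for c f
    by (rule poly_mapping_eqI)
      (simp add: const_def lookup_single_mult_left lookup_single_mult_right, rule single_0_mult_commute)
  show "const (c * d) = const c * const d" for c d by (simp add: const_def mult_single)
  show "const (c + d) = const c + const d" for c d by (simp add: const_def single_add)
  show "const 1 = 1" by (simp add: const_def)
  show "prod_list (map comp_gen 0) = 1" by (simp add: zero_eq_Nil)
qed (simp add: plus_eq_append)

lemma coact_add: "coact (u + v) = coact u + coact v"
  and coact_diff: "coact (u - v) = coact u - coact v"
  and coact_zero: "coact 0 = 0"
  and coact_mult: "coact (u * v) = coact u * coact v"
  and coact_power: "coact (u ^ n) = coact u ^ n"
  and coact_scale: "coact (fscale c u) = const c * coact u"
  and coact_word: "coact (gen as) = prod_list (map comp_gen as)"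
  unfolding coact_def
  by (rule alg_hom.ext_add[OF coact_hom] alg_hom.ext_diff[OF coact_hom] alg_hom.ext_zero[OF coact_hom]
    alg_hom.ext_mult[OF coact_hom] alg_hom.ext_power[OF coact_hom] alg_hom.ext_scale[OF coact_hom]
    alg_hom.ext_gen[OF coact_hom])+

lemma coact_one: "coact 1 = 1"
  using coact_word[of "[]"] by (simp add: gen_Nil)

lemma coact_gen: "coact (gen [a]) = comp_gen a"
  by (simp add: coact_word)

lemma lookup_comp_gen:
  "Poly_Mapping.lookup (comp_gen a) e
    = (if e \<in> Poly_Mapping.keys (hcomp G a) then gen [Poly_Mapping.lookup (hcomp G a) e] else 0)"
  by (simp add: comp_gen_def lookup_sum lookup_single when_def)

text \<open>Off the support the coefficient is \<open>0\<close> rather than \<open>gen [0]\<close>,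
  and these agree only modulo \<open>I\<close>.\<close>

lemma comp_gen_cong: "Poly_Mapping.lookup (comp_gen a) e - gen [Poly_Mapping.lookup (hcomp G a) e] \<in> I"
proof (cases "e \<in> Poly_Mapping.keys (hcomp G a)")
  case True
  then show ?thesis by (simp add: lookup_comp_gen free.subspace_0[OF I_subspace])
next
  case False
  then show ?thesis
    using free.subspace_neg[OF I_subspace rel_zero] by (simp add: lookup_comp_gen in_keys_iff)
qed

lemma comp_gen_add: "comp_gen (a + b) - (comp_gen a + comp_gen b) \<in> J"
  unfolding coeffs_in_def
proof (clarify, unfold lookup_minus lookup_add)
  fix e
  let ?l = "\<lambda>a. Poly_Mapping.lookup (comp_gen a) e" and ?c = "\<lambda>a. Poly_Mapping.lookup (hcomp G a) e"
  have "(?l (a + b) - gen [?c (a + b)]) + (gen [?c a + ?c b] - gen [?c a] - gen [?c b])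
      - (?l a - gen [?c a]) - (?l b - gen [?c b]) \<in> I"
    by (intro I_add I_diff comp_gen_cong rel_add)
  then show "?l (a + b) - (?l a + ?l b) \<in> I"
    by (simp add: hcomp_add lookup_add diff_diff_eq)
qed

lemma comp_gen_scale: "comp_gen (scale c a) - const c * comp_gen a \<in> J"
  unfolding coeffs_in_def
proof (clarify, unfold lookup_minus lookup_const_mult)
  fix e
  let ?l = "\<lambda>a. Poly_Mapping.lookup (comp_gen a) e" and ?c = "\<lambda>a. Poly_Mapping.lookup (hcomp G a) e"
  have "(?l (scale c a) - gen [?c (scale c a)]) + (gen [scale c (?c a)] - fscale c (gen [?c a]))
      - fscale c (?l a - gen [?c a]) \<in> I"
    by (intro I_add I_diff comp_gen_cong rel_scale free.subspace_scale[OF I_subspace])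
  then show "?l (scale c a) - fscale c (?l a) \<in> I"
    by (simp add: hcomp_scale free.scale_right_diff_distrib)
qed

lemma comp_gen_zero: "comp_gen 0 = 0"
  by (simp add: comp_gen_def hcomp_zero)

lemma comp_gen_homogeneous:
  assumes "a \<in> G d"
  shows "comp_gen a - Poly_Mapping.single d (gen [a]) \<in> J"
  unfolding coeffs_in_def
proof (clarify, unfold lookup_minus)
  fix e
  show "Poly_Mapping.lookup (comp_gen a) e - Poly_Mapping.lookup (Poly_Mapping.single d (gen [a])) e \<in> I"
  proof (cases "e = d")
    case True
    then show ?thesis using comp_gen_cong[of a e] by (simp add: hcomp_homogeneous[OF assms])
  next
    case False
    then show ?thesis
      by (auto simp: lookup_comp_gen hcomp_homogeneous[OF assms] lookup_single free.subspace_0[OF I_subspace]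
        split: if_splits)
  qed
qed

text \<open>Modulo \<open>J\<close> the defect is bilinear in \<open>a\<close> and \<open>b\<close>,
  so both may be taken homogeneous; then it is a Lie relation placed in degree
  \<open>d + e\<close>.\<close>

lemma comp_gen_brk: "comp_gen a * comp_gen b - comp_gen b * comp_gen a - comp_gen (brk a b) \<in> J"
proof -
  let ?E = "\<lambda>a b. comp_gen a * comp_gen b - comp_gen b * comp_gen a - comp_gen (brk a b)"
  let ?A = "\<lambda>a b. comp_gen (a + b) - (comp_gen a + comp_gen b)"
  let ?S = "\<lambda>c a. comp_gen (scale c a) - const c * comp_gen a"
  have comm: "const c * f = f * const c" for c f using alg_hom.h_central[OF coact_hom] .
  have hom: "?E a b \<in> J" if a: "a \<in> G d" and b: "b \<in> G e" for a b d e
  proof -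
    let ?a = "Poly_Mapping.single d (gen [a])" and ?b = "Poly_Mapping.single e (gen [b])"
    let ?ab = "Poly_Mapping.single (d + e) (gen [brk a b])"
    have main: "?a * ?b - ?b * ?a - ?ab \<in> J"
      using J_single[OF rel_brk[of a b], of "d + e"] unfolding mult_single single_diff add.commute[of e d] .
    have "(comp_gen a * comp_gen b - ?a * ?b) - (comp_gen b * comp_gen a - ?b * ?a) - (comp_gen (brk a b) - ?ab) \<in> J"
      by (intro J_diff two_sided_ideal_mult_cong[OF J_ideal] comp_gen_homogeneous a b brk_G)
    from J_add[OF this main] show ?thesis by (simp add: algebra_simps)
  qed
  have right: "subspace {b. ?E a b \<in> J}" for a
  proof (rule subspaceI)
    fix b b' assume "b \<in> {b. ?E a b \<in> J}" "b' \<in> {b. ?E a b \<in> J}"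
    then have h: "?E a b \<in> J" "?E a b' \<in> J" by simp_all
    have "?E a b + ?E a b' + comp_gen a * ?A b b' - ?A b b' * comp_gen a - ?A (brk a b) (brk a b') \<in> J"
      by (rule J_diff[OF J_diff[OF J_add[OF J_add[OF h] J_mult(1)[OF comp_gen_add]]
        J_mult(2)[OF comp_gen_add]] comp_gen_add])
    moreover have "?E a b + ?E a b' + comp_gen a * ?A b b' - ?A b b' * comp_gen a - ?A (brk a b) (brk a b')
        = ?E a (b + b')"
      by (simp add: brk_plus algebra_simps)
    ultimately show "b + b' \<in> {b. ?E a b \<in> J}" by simp
  next
    fix c b assume "b \<in> {b. ?E a b \<in> J}"
    then have h: "?E a b \<in> J" by simp
    have "const c * ?E a b + comp_gen a * ?S c b - ?S c b * comp_gen a - ?S c (brk a b) \<in> J"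
      by (rule J_diff[OF J_diff[OF J_add[OF J_mult(1)[OF h] J_mult(1)[OF comp_gen_scale]]
        J_mult(2)[OF comp_gen_scale]] comp_gen_scale])
    moreover have "comp_gen a * (const c * f) = const c * (comp_gen a * f)" for f
      by (metis comm mult.assoc)
    then have "const c * ?E a b + comp_gen a * ?S c b - ?S c b * comp_gen a - ?S c (brk a b) = ?E a (scale c b)"
      by (simp add: brk_scale algebra_simps)
    ultimately show "scale c b \<in> {b. ?E a b \<in> J}" by simp
  qed (simp add: brk_zero comp_gen_zero J_zero)
  have left: "subspace {a. \<forall>b. ?E a b \<in> J}"
  proof (rule subspaceI, clarify)
    fix b show "?E 0 b \<in> J" by (simp add: brk_zero comp_gen_zero J_zero)
  next
    fix a a' assume a: "a \<in> {a. \<forall>b. ?E a b \<in> J}" "a' \<in> {a. \<forall>b. ?E a b \<in> J}"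
    have "?E (a + a') b \<in> J" for b
    proof -
      have "?E a b + ?E a' b + ?A a a' * comp_gen b - comp_gen b * ?A a a' - ?A (brk a b) (brk a' b) \<in> J"
        by (rule J_diff[OF J_diff[OF J_add[OF J_add J_mult(2)[OF comp_gen_add]]
          J_mult(1)[OF comp_gen_add]] comp_gen_add]) (use a in simp_all)
      moreover have "?E a b + ?E a' b + ?A a a' * comp_gen b - comp_gen b * ?A a a' - ?A (brk a b) (brk a' b)
          = ?E (a + a') b"
        by (simp add: brk_plus algebra_simps)
      ultimately show ?thesis by simp
    qed
    then show "a + a' \<in> {a. \<forall>b. ?E a b \<in> J}" by simp
  next
    fix c a assume a: "a \<in> {a. \<forall>b. ?E a b \<in> J}"
    have "?E (scale c a) b \<in> J" for b
    proof -
      have "const c * ?E a b + ?S c a * comp_gen b - comp_gen b * ?S c a - ?S c (brk a b) \<in> J"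
        by (rule J_diff[OF J_diff[OF J_add[OF J_mult(1) J_mult(2)[OF comp_gen_scale]]
          J_mult(1)[OF comp_gen_scale]] comp_gen_scale]) (use a in simp_all)
      moreover have "comp_gen b * (const c * f) = const c * (comp_gen b * f)" for f
        by (metis comm mult.assoc)
      then have "const c * ?E a b + ?S c a * comp_gen b - comp_gen b * ?S c a - ?S c (brk a b) = ?E (scale c a) b"
        by (simp add: brk_scale algebra_simps)
      ultimately show ?thesis by simp
    qed
    then show "scale c a \<in> {a. \<forall>b. ?E a b \<in> J}" by simp
  qed
  have "a \<in> {a. \<forall>b. ?E a b \<in> J}"
  proof (rule hcomp_induct[OF left], clarify)
    fix d x b assume x: "x \<in> G d"
    have "b \<in> {b. ?E x b \<in> J}"
      by (rule hcomp_induct[OF right]) (use hom[OF x] in blast)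
    then show "?E x b \<in> J" by simp
  qed
  then show ?thesis by simp
qed

text \<open>Both sides are nonlinear, yet the elements for which they agree form a subspace:
  Jacobson's formula governs sums in the group algebra as well as in the Lie algebra. Homogeneous
  elements belong to it by \<open>pm_G\<close>.\<close>

lemma comp_gen_pm: "comp_gen a ^ p - comp_gen (pm a) \<in> J"
proof -
  note char_J = free_algebra_char[OF char]
  have char0: "of_nat p = (0 :: real \<Rightarrow>\<^sub>0 ('l list \<Rightarrow>\<^sub>0 'k))"
    using char_J[where 'a = "'l list"] by (metis single_of_nat single_zero)
  have const_of_nat: "const (of_nat n) * f = of_nat n * f" for n f
    by (simp add: const_def)
  have const_const: "const c * (const d * f) = const (c * d) * f" for c d f
    using alg_hom.h_mult[OF coact_hom] by (simp add: mult.assoc)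
  have const_power: "(const c * f) ^ n = const (c ^ n) * f ^ n" for c f n
  proof (induction n)
    case 0
    show ?case using alg_hom.h_1[OF coact_hom] by simp
  next
    case (Suc n)
    have "(const c * f) ^ Suc n = const c * (f * const (c ^ n)) * f ^ n" by (simp add: Suc mult.assoc)
    also have "f * const (c ^ n) = const (c ^ n) * f" by (rule alg_hom.h_central[OF coact_hom, symmetric])
    finally show ?case by (simp add: const_const mult.assoc)
  qed
  have "subspace {a. comp_gen a ^ p - comp_gen (pm a) \<in> J}"
  proof (rule subspaceI)
    have "pm 0 = 0" using pm_scale[of 0 0] p_pos by (simp add: zero_power)
    then show "0 \<in> {a. comp_gen a ^ p - comp_gen (pm a) \<in> J}"
      using p_pos by (simp add: comp_gen_zero zero_power J_zero)
  next
    fix a b assume "a \<in> {a. comp_gen a ^ p - comp_gen (pm a) \<in> J}" "b \<in> {a. comp_gen a ^ p - comp_gen (pm a) \<in> J}"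
    then have ab: "comp_gen a ^ p - comp_gen (pm a) \<in> J" "comp_gen b ^ p - comp_gen (pm b) \<in> J" by simp_all
    let ?JL = "jacobson_sum p (+) 0 scale brk a b"
    let ?JR = "jacobson_sum p (+) 0 (\<lambda>c f. const c * f) (\<lambda>x y. x * y - y * x) (comp_gen a) (comp_gen b)"
    have jac: "(comp_gen a + comp_gen b) ^ p = comp_gen a ^ p + comp_gen b ^ p + ?JR"
      by (rule jacobson_formula[OF prime_p char char0 const_of_nat const_const])
    \<comment> \<open>The two Jacobson sums correspond because \<open>comp_gen\<close> respects
      sums, multiples and brackets modulo \<open>J\<close>.\<close>
    have jr: "?JR - comp_gen ?JL \<in> J"
    proof (rule jacobson_sum_rel[where R = "\<lambda>x f. f - comp_gen x \<in> J"])
      fix x x' y y' assume *: "x' - comp_gen x \<in> J" "y' - comp_gen y \<in> J"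
      have "(x' - comp_gen x) + (y' - comp_gen y) - (comp_gen (x + y) - (comp_gen x + comp_gen y)) \<in> J"
        by (intro J_add J_diff * comp_gen_add)
      then show "x' + y' - comp_gen (x + y) \<in> J" by (simp add: algebra_simps)
      have "(x' * y' - comp_gen x * comp_gen y) - (y' * x' - comp_gen y * comp_gen x) \<in> J"
        by (intro J_diff two_sided_ideal_mult_cong[OF J_ideal] *)
      from J_add[OF this comp_gen_brk[of x y]]
      show "x' * y' - y' * x' - comp_gen (brk x y) \<in> J" by (simp add: algebra_simps)
    next
      fix c x x' assume *: "x' - comp_gen x \<in> J"
      have "const c * (x' - comp_gen x) - (comp_gen (scale c x) - const c * comp_gen x) \<in> J"
        by (intro J_diff J_mult * comp_gen_scale)
      then show "const c * x' - comp_gen (scale c x) \<in> J" by (simp add: algebra_simps)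
    qed (simp_all add: comp_gen_zero J_zero)
    have "(comp_gen a ^ p - comp_gen (pm a)) + (comp_gen b ^ p - comp_gen (pm b)) + (?JR - comp_gen ?JL)
        - (comp_gen (pm a + pm b) - (comp_gen (pm a) + comp_gen (pm b)))
        - (comp_gen (pm a + pm b + ?JL) - (comp_gen (pm a + pm b) + comp_gen ?JL)) \<in> J"
      by (intro J_add J_diff ab jr comp_gen_add)
    then have "(comp_gen a + comp_gen b) ^ p - comp_gen (pm (a + b)) \<in> J"
      unfolding jac pm_add by (simp add: algebra_simps)
    moreover have "comp_gen (a + b) ^ p - (comp_gen a + comp_gen b) ^ p \<in> J"
      by (rule two_sided_ideal_power_cong[OF J_ideal comp_gen_add])
    ultimately show "a + b \<in> {a. comp_gen a ^ p - comp_gen (pm a) \<in> J}"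
      using J_trans by blast
  next
    fix c a assume a: "a \<in> {a. comp_gen a ^ p - comp_gen (pm a) \<in> J}"
    have "comp_gen (scale c a) ^ p - (const c * comp_gen a) ^ p \<in> J"
      by (rule two_sided_ideal_power_cong[OF J_ideal comp_gen_scale])
    moreover have "(const c * comp_gen a) ^ p - const (c ^ p) * comp_gen (pm a) \<in> J"
      unfolding const_power right_diff_distrib[symmetric] using a by (intro J_mult) simp
    moreover have "const (c ^ p) * comp_gen (pm a) - comp_gen (pm (scale c a)) \<in> J"
      unfolding pm_scale by (rule J_sym[OF comp_gen_scale])
    ultimately show "scale c a \<in> {a. comp_gen a ^ p - comp_gen (pm a) \<in> J}"
      using J_trans by blast
  qed
  then have "a \<in> {a. comp_gen a ^ p - comp_gen (pm a) \<in> J}"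
  proof (rule hcomp_induct, clarify)
    fix d x assume x: "x \<in> G d"
    have pow: "Poly_Mapping.single d y ^ n = Poly_Mapping.single (real n * d) (y ^ n)" for y :: "'l list \<Rightarrow>\<^sub>0 'k" and n
      by (induction n) (simp_all add: mult_single algebra_simps)
    have "comp_gen x ^ p - Poly_Mapping.single d (gen [x]) ^ p \<in> J"
      by (rule two_sided_ideal_power_cong[OF J_ideal comp_gen_homogeneous[OF x]])
    moreover have "Poly_Mapping.single d (gen [x]) ^ p - Poly_Mapping.single (real p * d) (gen [pm x]) \<in> J"
      unfolding pow single_diff[symmetric] by (rule J_single[OF rel_pm])
    moreover have "Poly_Mapping.single (real p * d) (gen [pm x]) - comp_gen (pm x) \<in> J"
      by (rule J_sym[OF comp_gen_homogeneous[OF pm_G[OF x]]])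
    ultimately show "comp_gen x ^ p - comp_gen (pm x) \<in> J"
      using J_trans by blast
  qed
  then show ?thesis by simp
qed

text \<open>The preimage of \<open>J\<close> is a two-sided ideal containing the defining relations.
  Hence homogeneous components are well defined in the quotient.\<close>

lemma coact_I: "u \<in> I \<Longrightarrow> coact u \<in> J"
proof -
  assume u: "u \<in> I"
  have "I \<subseteq> {u. coact u \<in> J}"
    unfolding uea_ideal_def
  proof (rule hull_minimal)
    show "two_sided_ideal {u. coact u \<in> coeffs_in (two_sided_ideal hull (linearity_relations scale
     \<union> range (\<lambda>(a, b). gen [a] * gen [b] - gen [b] * gen [a] - gen [brk a b])
     \<union> range (\<lambda>a. gen [a] ^ p - gen [pm a])))}"
      unfolding uea_ideal_def[symmetric]
      by (auto simp: two_sided_ideal_def coact_zero coact_diff coact_mult J_zero intro: J_diff J_mult)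
  next
    show "linearity_relations scale \<union> range (\<lambda>(a, b). gen [a] * gen [b] - gen [b] * gen [a] - gen [brk a b])
     \<union> range (\<lambda>a. gen [a] ^ p - gen [pm a]) \<subseteq> {u. coact u \<in> coeffs_in (two_sided_ideal hull (linearity_relations scale
     \<union> range (\<lambda>(a, b). gen [a] * gen [b] - gen [b] * gen [a] - gen [brk a b])
     \<union> range (\<lambda>a. gen [a] ^ p - gen [pm a])))}"
      unfolding uea_ideal_def[symmetric]
      using comp_gen_add[unfolded diff_diff_eq[symmetric]] comp_gen_scale comp_gen_brk comp_gen_pm
      by (auto simp: linearity_relations_def coact_diff coact_mult coact_power coact_scale coact_gen)
  qed
  with u show ?thesis by blast
qed

abbreviation proj :: "real \<Rightarrow> ('l list \<Rightarrow>\<^sub>0 'k) \<Rightarrow> ('l list \<Rightarrow>\<^sub>0 'k)" where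
  "proj m u \<equiv> Poly_Mapping.lookup (coact u) m"

text \<open>At \<open>t = 1\<close> the coaction is the identity modulo \<open>I\<close>;
  multiplicativity of \<open>sum_coeffs\<close> reduces this to single letters.\<close>

lemma sum_proj: "u - sum_coeffs (coact u) \<in> I"
proof (induction u rule: free_induct)
  case (gen as)
  show ?case
  proof (induction as)
    case Nil
    show ?case
      using sum_coeffs_single[of 0 "1 :: 'l list \<Rightarrow>\<^sub>0 'k"] by (simp add: coact_one gen_Nil free.subspace_0[OF I_subspace])
  next
    case (Cons a as)
    have "gen [a] - sum_coeffs (comp_gen a) \<in> I"
      using rel_sum[of "Poly_Mapping.lookup (hcomp G a)" "Poly_Mapping.keys (hcomp G a)"]
      by (simp add: comp_gen_def sum_coeffs_sum sum_coeffs_single hcomp_props(2))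
    from two_sided_ideal_mult_cong[OF ideal_I this Cons] show ?case
      unfolding gen_Cons[of a as] coact_mult sum_coeffs_mult coact_gen .
  qed
next
  case (add u v)
  from I_add[OF this] show ?case by (simp add: coact_add sum_coeffs_add add_diff_add)
next
  case (scale c u)
  have "sum_coeffs (coact (fscale c u)) = fscale c (sum_coeffs (coact u))"
    by (simp only: coact_scale sum_coeffs_mult) (simp add: const_def sum_coeffs_single fscale_eq_mult)
  then show ?case
    using free.subspace_scale[OF I_subspace scale] by (simp add: free.scale_right_diff_distrib)
qed (simp add: coact_zero sum_coeffs_zero free.subspace_0[OF I_subspace])

section \<open>Homogeneous subspaces of the enveloping algebra\<close>

definition hwords :: "real \<Rightarrow> ('l list \<Rightarrow>\<^sub>0 'k) set" where
  "hwords m = {gen as | as. \<exists>ds. list_all2 (\<lambda>a e. a \<in> G e) as ds \<and> sum_list ds = m}"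

lemma proj_hwords: "proj m u \<in> free.span (hwords m)"
proof (induction u arbitrary: m rule: free_induct)
  case (gen as)
  show ?case
  proof (induction as arbitrary: m)
    case Nil
    have "gen [] \<in> hwords 0" unfolding hwords_def by auto
    then show ?case
      by (auto simp: coact_one lookup_one when_def free.span_zero gen_Nil intro: free.span_base)
  next
    case (Cons a as)
    have "Poly_Mapping.lookup (comp_gen a) e * proj (m - e) (gen as) \<in> free.span (hwords m)" for e
    proof -
      have "gen [x] * v \<in> free.span (hwords m)" if "v \<in> free.span (hwords (m - e))" "x \<in> G e" for v x
        using that(1)
      proof (induction rule: free.span_induct_alt)
        case base
        show ?case by (simp add: free.span_zero)
      next
        case (step c w v)
        then obtain bs ds where "w = gen bs" "list_all2 (\<lambda>a e. a \<in> G e) bs ds" "sum_list ds = m - e"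
          by (auto simp: hwords_def)
        then have "gen [x] * w = gen (x # bs)" "list_all2 (\<lambda>a e. a \<in> G e) (x # bs) (e # ds)" "sum_list (e # ds) = m"
          using that(2) by (simp_all add: gen_Cons[of x bs])
        then have "gen [x] * w \<in> hwords m" unfolding hwords_def by blast
        then show ?case
          using step by (simp add: distrib_left fscale_mult_right free.span_add free.span_scale free.span_base)
      qed
      from this[OF Cons.IH hcomp_props(1)] show ?thesis
        by (auto simp: lookup_comp_gen free.span_zero)
    qed
    then show ?case
      unfolding gen_Cons[of a as] coact_mult lookup_mult_real coact_gen by (intro free.span_sum)
  qed
next
  case (scale c u)
  then show ?case by (simp add: coact_scale lookup_const_mult free.span_scale)
qed (simp_all add: coact_zero coact_add lookup_add free.span_add free.span_zero)

text \<open>Described by vanishing components rather than as a span, so that intersecting degree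
  sets is immediate; \<open>homogeneous_span_eq\<close> gives the link with the span.\<close>

definition hset :: "real set \<Rightarrow> ('l list \<Rightarrow>\<^sub>0 'k) set" where
  "hset D = {u. \<forall>m. m \<notin> D \<longrightarrow> proj m u \<in> I}"

lemma subspace_hset: "free.subspace (hset D)"
  by (rule free.subspaceI)
    (auto simp: hset_def coact_zero coact_add coact_scale lookup_add lookup_const_mult
      free.subspace_0[OF I_subspace] I_add free.subspace_scale[OF I_subspace])

lemma I_hset: "u \<in> I \<Longrightarrow> u \<in> hset D"
  using coact_I by (auto simp: hset_def coeffs_in_def)

lemma hset_mono: "D \<subseteq> E \<Longrightarrow> hset D \<subseteq> hset E"
  by (auto simp: hset_def)

lemma hset_Int: "u \<in> hset D \<Longrightarrow> u \<in> hset E \<Longrightarrow> u \<in> hset (D \<inter> E)"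
  by (auto simp: hset_def)

lemma hset_mult:
  assumes "u \<in> hset D" "v \<in> hset E" "\<And>d e. d \<in> D \<Longrightarrow> e \<in> E \<Longrightarrow> d + e \<in> F"
  shows "u * v \<in> hset F"
  unfolding hset_def
proof (clarify, unfold coact_mult lookup_mult_real)
  fix m assume m: "m \<notin> F"
  have "proj e u * proj (m - e) v \<in> I" for e
  proof (cases "e \<in> D")
    case True
    then have "m - e \<notin> E" using assms(3)[of e "m - e"] m by auto
    then show ?thesis using assms(2) by (intro I_mult(1)) (auto simp: hset_def)
  next
    case False
    then show ?thesis using assms(1) by (intro I_mult(2)) (auto simp: hset_def)
  qed
  then show "(\<Sum>e\<in>Poly_Mapping.keys (coact u). proj e u * proj (m - e) v) \<in> I"
    by (intro free.subspace_sum[OF I_subspace])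
qed

text \<open>All components lie in \<open>I\<close>, and modulo \<open>I\<close> the element is their
  sum. Every vanishing argument below ends here.\<close>

lemma hset_empty: "u \<in> hset {} \<Longrightarrow> u \<in> I"
proof -
  assume "u \<in> hset {}"
  then have "sum_coeffs (coact u) \<in> I"
    unfolding sum_coeffs_def by (intro free.subspace_sum[OF I_subspace]) (simp add: hset_def)
  from I_add[OF sum_proj[of u] this] show ?thesis by simp
qed

lemma one_hset: "0 \<in> D \<Longrightarrow> 1 \<in> hset D"
  by (auto simp: hset_def coact_one lookup_one when_def free.subspace_0[OF I_subspace])

lemma gen_hset: "a \<in> supported D \<Longrightarrow> gen [a] \<in> hset D"
  by (auto simp: hset_def coact_gen lookup_comp_gen supported_def free.subspace_0[OF I_subspace])

lemma hwords_hset: "m \<in> D \<Longrightarrow> free.span (hwords m) \<subseteq> hset D"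
proof (rule free.span_minimal[OF _ subspace_hset])
  assume m: "m \<in> D"
  have "gen as \<in> hset {sum_list ds}" if "list_all2 (\<lambda>a e. a \<in> G e) as ds" for as ds
    using that
  proof (induction rule: list_all2_induct)
    case Nil
    show ?case using one_hset by (simp add: gen_Nil)
  next
    case (Cons a as e ds)
    have "gen [a] \<in> hset {e}"
      using Cons(1) by (intro gen_hset homogeneous_supported) auto
    from hset_mult[OF this Cons(3)] show ?case by (simp add: gen_Cons[of a as])
  qed
  then show "hwords m \<subseteq> hset D" using hset_mono[of "{m}" D] m by (auto simp: hwords_def)
qed

lemma proj_hset: "m \<in> D \<Longrightarrow> proj m u \<in> hset D"
  using hwords_hset proj_hwords by blast

section \<open>Passage to cosets\<close>

lemma qsubspace_coset_image:
  assumes "free.subspace V"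
  shows "qsubspace I (coset I ` V)"
  using assms unfolding qsubspace_def quotient_space_def
  by (auto simp: lift_ideal_coset[OF ideal_I] free.subspace_add free.subspace_scale free.subspace_0)

lemma qsubalgebra_coset_image:
  assumes "free.subspace V" "\<And>u v. u \<in> V \<Longrightarrow> v \<in> V \<Longrightarrow> u * v \<in> V"
  shows "qsubalgebra I (coset I ` V)"
  unfolding qsubalgebra_def using qsubspace_coset_image[OF assms(1)] assms(2)
  by (auto simp: lift_ideal_coset[OF ideal_I])

lemma qsubspace_preimage:
  assumes "qsubspace I A"
  shows "free.subspace {v. coset I v \<in> A}"
  using assms unfolding qsubspace_def
  by (intro free.subspaceI) (auto simp flip: lift_ideal_coset[OF ideal_I])

lemma induced_homogeneous_subset: "d \<in> D \<Longrightarrow> induced_homogeneous I G d \<subseteq> coset I ` hset D"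
  unfolding induced_homogeneous_def
proof (rule hull_minimal)
  show "qsubspace I (coset I ` hset D)" by (rule qsubspace_coset_image[OF subspace_hset])
  assume "d \<in> D"
  then show "{coset I (gen as) |as. \<exists>ds. list_all2 (\<lambda>a e. a \<in> G e) as ds \<and> sum_list ds = d} \<subseteq> coset I ` hset D"
    using hwords_hset[of d D] free.span_superset[of "hwords d"] by (fastforce simp: hwords_def)
qed

text \<open>One inclusion is minimality of the hull. For the other, \<open>sum_proj\<close> recovers
  an element from its components, and those outside \<open>D\<close> lie in
  \<open>I\<close>.\<close>

lemma homogeneous_span_eq: "homogeneous_span I G D = coset I ` hset D"
proof
  show "homogeneous_span I G D \<subseteq> coset I ` hset D"
    unfolding homogeneous_span_def
    using induced_homogeneous_subset by (intro hull_minimal qsubspace_coset_image[OF subspace_hset]) blast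
  show "coset I ` hset D \<subseteq> homogeneous_span I G D"
    unfolding homogeneous_span_def hull_def
  proof (clarify)
    fix u T assume u: "u \<in> hset D" and T: "qsubspace I T" "(\<Union>d\<in>D. induced_homogeneous I G d) \<subseteq> T"
    let ?V = "{v. coset I v \<in> T}"
    note V = qsubspace_preimage[OF T(1)]
    have "free.span (hwords m) \<subseteq> ?V" if "m \<in> D" for m
    proof (rule free.span_minimal[OF _ V])
      have "coset I (gen as) \<in> induced_homogeneous I G m"
        if "list_all2 (\<lambda>a e. a \<in> G e) as ds" "sum_list ds = m" for as ds
        unfolding induced_homogeneous_def by (rule hull_inc) (use that in blast)
      then show "hwords m \<subseteq> ?V" using T(2) that by (auto simp: hwords_def)
    qed
    then have proj: "proj m u \<in> ?V" if "m \<in> D" for m using proj_hwords that by blast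
    have I: "v \<in> ?V" if "v \<in> I" for v
      using that T(1) coset_eq_0_iff[OF I_group, of v] by (auto simp: qsubspace_def)
    have "sum_coeffs (coact u) \<in> ?V"
      unfolding sum_coeffs_def
    proof (rule free.subspace_sum[OF V])
      fix m show "proj m u \<in> ?V"
        using proj[of m] I u by (cases "m \<in> D") (auto simp: hset_def)
    qed
    from free.subspace_add[OF V I[OF sum_proj[of u]] this] show "coset I u \<in> T" by simp
  qed
qed

lemma qsubalgebra_homogeneous_span:
  assumes "\<And>d e. d \<in> D \<Longrightarrow> e \<in> D \<Longrightarrow> d + e \<in> D"
  shows "qsubalgebra I (homogeneous_span I G D)"
  unfolding homogeneous_span_eq
  by (rule qsubalgebra_coset_image[OF subspace_hset]) (rule hset_mult[OF _ _ assms])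

lemma hset_independent:
  assumes "u \<in> hset D" "v \<in> hset E" "u + v \<in> I" "D \<inter> E = {}"
  shows "u \<in> I" "v \<in> I"
proof -
  have "u + v - v \<in> hset E" using free.subspace_diff[OF subspace_hset I_hset[OF assms(3)] assms(2)] .
  then have "u \<in> hset (D \<inter> E)" using assms(1) by (intro hset_Int) simp_all
  then show u: "u \<in> I" unfolding assms(4) by (rule hset_empty)
  from I_diff[OF assms(3) u] show "v \<in> I" by simp
qed

lemma triangular_decomposition:
  assumes "U \<in> quotient_space I"
  shows "\<exists>!(a, b, c). a \<in> homogeneous_span I G {0<..} \<and> b \<in> homogeneous_span I G {0}
    \<and> c \<in> homogeneous_span I G {..<0} \<and> U = lift2 I (+) (lift2 I (+) a b) c"
proof -
  obtain u where u: "U = coset I u" using assms by (auto simp: quotient_space_def)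
  let ?K = "Poly_Mapping.keys (coact u)"
  let ?part = "\<lambda>D. \<Sum>m\<in>?K \<inter> D. proj m u"
  have part: "?part D \<in> hset D" for D
    by (intro free.subspace_sum[OF subspace_hset] proj_hset) auto
  have "?K = (?K \<inter> {0<..} \<union> ?K \<inter> {0}) \<union> ?K \<inter> {..<0}" by auto
  then have "sum_coeffs (coact u) = (\<Sum>m\<in>(?K \<inter> {0<..} \<union> ?K \<inter> {0}) \<union> ?K \<inter> {..<0}. proj m u)"
    unfolding sum_coeffs_def by (rule sum.cong) simp
  also have "\<dots> = ?part {0<..} + ?part {0} + ?part {..<0}"
    by (subst sum.union_disjoint, simp, simp, force, subst sum.union_disjoint, simp, simp, force, rule refl)
  finally have sum: "u - (?part {0<..} + ?part {0} + ?part {..<0}) \<in> I" using sum_proj[of u] by simp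
  show ?thesis
  proof (rule ex1I[of _ "(coset I (?part {0<..}), coset I (?part {0}), coset I (?part {..<0}))"])
    show "case (coset I (?part {0<..}), coset I (?part {0}), coset I (?part {..<0})) of
      (a, b, c) \<Rightarrow> a \<in> homogeneous_span I G {0<..} \<and> b \<in> homogeneous_span I G {0}
        \<and> c \<in> homogeneous_span I G {..<0} \<and> U = lift2 I (+) (lift2 I (+) a b) c"
      unfolding u homogeneous_span_eq prod.case lift_ideal_coset[OF ideal_I] coset_eq_iff[OF I_group]
      by (intro conjI imageI part sum)
  next
    fix x assume x: "case x of (a, b, c) \<Rightarrow> a \<in> homogeneous_span I G {0<..} \<and> b \<in> homogeneous_span I G {0}
        \<and> c \<in> homogeneous_span I G {..<0} \<and> U = lift2 I (+) (lift2 I (+) a b) c"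
    obtain A B C where xABC: "x = (A, B, C)" by (cases x)
    with x obtain a b c where abc: "a \<in> hset {0<..}" "b \<in> hset {0}" "c \<in> hset {..<0}"
      and ABC: "A = coset I a" "B = coset I b" "C = coset I c"
      and "U = lift2 I (+) (lift2 I (+) A B) C"
      by (auto simp: homogeneous_span_eq)
    then have "u - (a + b + c) \<in> I"
      by (simp add: u lift_ideal_coset[OF ideal_I] coset_eq_iff[OF I_group])
    from I_diff[OF sum this]
    have eq: "(a - ?part {0<..}) + ((b - ?part {0}) + (c - ?part {..<0})) \<in> I"
      by (simp add: algebra_simps)
    have diff: "a - ?part {0<..} \<in> hset {0<..}" "b - ?part {0} \<in> hset {0}" "c - ?part {..<0} \<in> hset {..<0}"
      by (intro free.subspace_diff[OF subspace_hset] abc part)+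
    \<comment> \<open>Uniqueness in two rounds: the positive part is separated from the rest in
      degrees at most \<open>0\<close>, then degree \<open>0\<close> from the negative part.\<close>
    then have bc: "(b - ?part {0}) + (c - ?part {..<0}) \<in> hset {..0}"
      using hset_mono[of "{0}" "{..0}"] hset_mono[of "{..<0}" "{..0}"]
      by (intro free.subspace_add[OF subspace_hset]) force+
    have "{0<..} \<inter> {..0} = ({} :: real set)" by auto
    note 1 = hset_independent[OF diff(1) bc eq this]
    have "{0} \<inter> {..<0} = ({} :: real set)" by auto
    note 2 = hset_independent[OF diff(2,3) 1(2) this]
    show "x = (coset I (?part {0<..}), coset I (?part {0}), coset I (?part {..<0}))"
      using 1(1) 2 by (simp add: xABC ABC coset_eq_iff[OF I_group])
  qed
qed

end

section \<open>Nilpotency\<close>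

lemma free_span_mult:
  fixes S T R :: "('i::monoid_add \<Rightarrow>\<^sub>0 'k::field) set"
  assumes "\<And>x y. x \<in> S \<Longrightarrow> y \<in> T \<Longrightarrow> x * y \<in> free.span R" "u \<in> free.span S" "v \<in> free.span T"
  shows "u * v \<in> free.span R"
  using assms(2)
proof (induction rule: free.span_induct_alt)
  case (step c x u)
  have "x * v \<in> free.span R"
    using assms(3)
  proof (induction rule: free.span_induct_alt)
    case (step d y v)
    then show ?case
      using assms(1)[OF \<open>x \<in> S\<close>] by (simp add: distrib_left fscale_mult_right free.span_add free.span_scale)
  qed (simp add: free.span_zero)
  with step show ?case
    by (simp add: distrib_right fscale_mult_left free.span_add free.span_scale)
qed (simp add: free.span_zero)

section \<open>Words in weighted letters\<close>

context doubly_graded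
begin

sublocale U: graded_restricted_lie_algebra p sL brk pm L_mu
  by unfold_locales (fact brk_mu pm_mu)+

text \<open>Each letter is stored with one of its weights, since the element alone does not
  determine a weight.\<close>

definition lettered :: "(nat \<times> 'l) list \<Rightarrow> bool" where
  "lettered zs \<longleftrightarrow> (\<forall>(w, b)\<in>set zs. letter w b)"

definition weight :: "(nat \<times> 'l) list \<Rightarrow> nat" where
  "weight zs = sum_list (map fst zs)"

definition word :: "(nat \<times> 'l) list \<Rightarrow> ('l list \<Rightarrow>\<^sub>0 'k)" where
  "word zs = gen (map snd zs)"

lemma lettered_append: "lettered (xs @ ys) \<longleftrightarrow> lettered xs \<and> lettered ys"
  and lettered_Cons: "lettered (z # ys) \<longleftrightarrow> letter (fst z) (snd z) \<and> lettered ys"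
  and lettered_mset: "mset xs = mset ys \<Longrightarrow> lettered xs \<longleftrightarrow> lettered ys"
  by (auto simp: lettered_def split_def dest: mset_eq_setD)

lemma weight_append: "weight (xs @ ys) = weight xs + weight ys"
  and weight_Cons: "weight (z # ys) = fst z + weight ys"
  by (simp_all add: weight_def)

lemma weight_mset: "mset xs = mset ys \<Longrightarrow> weight xs = weight ys"
  unfolding weight_def sum_mset_sum_list[symmetric] mset_map by simp

lemma word_append: "word (xs @ ys) = word xs * word ys"
  and word_Cons: "word (z # ys) = gen [snd z] * word ys"
  and word_Nil: "word [] = 1"
  by (simp_all add: word_def gen_append gen_Nil gen_Cons[of "snd z" "map snd ys"])

text \<open>Modulo shorter words of the same weight, letters commute and \<open>p\<close>-th powers of letters can
  be replaced by letters.\<close>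

context
  fixes V :: "('l list \<Rightarrow>\<^sub>0 'k) set" and n W :: nat
  assumes V: "free.subspace V" and I_V: "U.I \<subseteq> V"
    and shorter: "\<And>zs. length zs < n \<Longrightarrow> lettered zs \<Longrightarrow> weight zs = W \<Longrightarrow> word zs \<in> V"
begin

lemma word_swap:
  assumes "length (xs @ z # z' # ys) = n" "lettered (xs @ z # z' # ys)" "weight (xs @ z # z' # ys) = W"
  shows "word (xs @ z # z' # ys) \<in> V \<longleftrightarrow> word (xs @ z' # z # ys) \<in> V"
proof -
  obtain w b w' b' where z: "z = (w, b)" "z' = (w', b')" by (cases z, cases z')
  let ?short = "word (xs @ (w + w', brk b b') # ys)"
  have "?short \<in> V"
    using assms by (intro shorter) (auto simp: z lettered_append lettered_Cons weight_append weight_Cons letter_brk)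
  moreover have "word xs * (gen [b] * gen [b'] - gen [b'] * gen [b] - gen [brk b b']) * word ys \<in> V"
    by (rule subsetD[OF I_V], rule U.I_mult(2), rule U.I_mult(1), rule U.rel_brk)
  moreover have "word xs * (gen [b] * gen [b'] - gen [b'] * gen [b] - gen [brk b b']) * word ys
      = word (xs @ z # z' # ys) - word (xs @ z' # z # ys) - ?short"
    by (simp add: z word_append word_Cons algebra_simps)
  ultimately have "word (xs @ z # z' # ys) - word (xs @ z' # z # ys) - ?short + ?short \<in> V"
    by (intro free.subspace_add[OF V]) simp_all
  then have d: "word (xs @ z # z' # ys) - word (xs @ z' # z # ys) \<in> V" by simp
  show ?thesis
    using free.subspace_add[OF V d, of "word (xs @ z' # z # ys)"]
      free.subspace_diff[OF V _ d, of "word (xs @ z # z' # ys)"] by auto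
qed

lemma word_move_front:
  assumes "length (pre @ xs @ z # ys) = n" "lettered (pre @ xs @ z # ys)" "weight (pre @ xs @ z # ys) = W"
  shows "word (pre @ xs @ z # ys) \<in> V \<longleftrightarrow> word (pre @ z # xs @ ys) \<in> V"
  using assms
proof (induction xs arbitrary: pre)
  case (Cons x xs)
  have "word (pre @ (x # xs) @ z # ys) \<in> V \<longleftrightarrow> word (pre @ x # z # xs @ ys) \<in> V"
    using Cons.IH[of "pre @ [x]"] Cons.prems by simp
  also have "\<dots> \<longleftrightarrow> word (pre @ z # x # xs @ ys) \<in> V"
    using Cons.prems
    by (intro word_swap) (auto simp: lettered_append lettered_Cons weight_append weight_Cons)
  finally show ?case by simp
qed simp

lemma word_collect:
  assumes zs: "length zs = n" "lettered zs" "weight zs = W" and k: "k \<le> count_list zs z"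
  shows "\<exists>rest. mset zs = mset (replicate k z @ rest)
    \<and> (word zs \<in> V \<longleftrightarrow> word (replicate k z @ rest) \<in> V)"
  using k
proof (induction k)
  case 0
  show ?case by (rule exI[of _ zs]) simp
next
  case (Suc k)
  then obtain rest where rest: "mset zs = mset (replicate k z @ rest)"
    "word zs \<in> V \<longleftrightarrow> word (replicate k z @ rest) \<in> V" by auto
  have "count (mset zs) z = k + count (mset rest) z"
    unfolding rest(1) by simp
  then have "count (mset rest) z \<noteq> 0"
    using Suc.prems by (simp add: count_mset)
  then have "z \<in> set rest" by (simp add: count_eq_zero_iff)
  then obtain xs ys where r: "rest = xs @ z # ys" by (meson split_list)
  have "word (replicate k z @ xs @ z # ys) \<in> V \<longleftrightarrow> word (replicate k z @ z # xs @ ys) \<in> V"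
  proof (rule word_move_front)
    show "length (replicate k z @ xs @ z # ys) = n" using rest(1) zs(1) r by (metis size_mset)
    show "lettered (replicate k z @ xs @ z # ys)" using lettered_mset[OF rest(1)] zs(2) r by simp
    show "weight (replicate k z @ xs @ z # ys) = W" using weight_mset[OF rest(1)] zs(3) r by simp
  qed
  then show ?case
    using rest r by (intro exI[of _ "xs @ ys"]) (simp add: replicate_app_Cons_same)
qed

text \<open>Once \<open>p\<close> copies of a letter stand in front, the relation for
  \<open>pm\<close> merges them into one letter of weight \<open>p * w\<close>. The total weight is
  kept, and the word gets shorter because \<open>p \<ge> 2\<close>.\<close>

lemma word_power:
  assumes zs: "length zs = n" "lettered zs" "weight zs = W" and z: "count_list zs z \<ge> p"
  shows "word zs \<in> V"
proof -
  obtain rest where rest: "mset zs = mset (replicate p z @ rest)"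
    "word zs \<in> V \<longleftrightarrow> word (replicate p z @ rest) \<in> V"
    using word_collect[OF zs z] by blast
  obtain w b where wb: "z = (w, b)" by (cases z)
  have len: "n = p + length rest" using rest(1) zs(1) by (metis length_append length_replicate size_mset)
  have let_rest: "lettered (replicate p z @ rest)" using lettered_mset[OF rest(1)] zs(2) by simp
  have b: "letter w b" using let_rest p_ge_2 by (auto simp: lettered_def wb)
  have wt: "weight (replicate k z) = k * w" for k by (induction k) (simp_all add: weight_def wb)
  have pow: "word (replicate k z) = gen [b] ^ k" for k
    by (induction k) (simp_all add: word_Nil word_Cons wb)
  have "word ((p * w, pm b) # rest) \<in> V"
  proof (rule shorter)
    show "length ((p * w, pm b) # rest) < n" using len p_ge_2 by simp
    show "lettered ((p * w, pm b) # rest)" using let_rest letter_pm[OF b] by (simp add: lettered_append lettered_Cons)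
    show "weight ((p * w, pm b) # rest) = W"
      using weight_mset[OF rest(1)] zs(3) by (simp add: weight_append weight_Cons wt)
  qed
  moreover have "(gen [b] ^ p - gen [pm b]) * word rest \<in> V"
    by (rule subsetD[OF I_V], rule U.I_mult(2), rule U.rel_pm)
  ultimately have "(gen [b] ^ p - gen [pm b]) * word rest + word ((p * w, pm b) # rest) \<in> V"
    by (intro free.subspace_add[OF V])
  then have "word (replicate p z @ rest) \<in> V"
    by (simp add: word_append word_Cons pow left_diff_distrib)
  then show ?thesis using rest(2) by simp
qed

end

text \<open>Pigeonhole and induction on the length: a word with too many light letters contains some
  weighted letter \<open>p\<close> times, and \<open>word_power\<close> applies. Letting
  \<open>V\<close> be any subspace above the ideal takes the place of explicit normal forms.\<close>

lemma word_in_subspace: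
  assumes V: "free.subspace V" "U.I \<subseteq> V"
    and few: "\<And>zs. lettered zs \<Longrightarrow> weight zs = W
      \<Longrightarrow> length (filter (\<lambda>z. fst z \<le> w0) zs) \<le> (p - 1) * card {(w, b). w \<le> w0 \<and> letter w b} \<Longrightarrow> word zs \<in> V"
    and "lettered zs" "weight zs = W"
  shows "word zs \<in> V"
  using assms(4,5)
proof (induction "length zs" arbitrary: zs rule: less_induct)
  case less
  let ?small = "{(w, b). w \<le> w0 \<and> letter w b}"
  let ?fs = "filter (\<lambda>z. fst z \<le> w0) zs"
  show ?case
  proof (cases "length ?fs \<le> (p - 1) * card ?small")
    case True
    with less show ?thesis by (intro few)
  next
    case False
    have "?small = (\<Union>w\<le>w0. Pair w ` {b. letter w b})" by auto
    then have fin: "finite ?small" using finite_letters by simp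
    have sub: "set ?fs \<subseteq> ?small" using less.prems(1) by (auto simp: lettered_def)
    have "\<exists>z. count_list ?fs z \<ge> p"
    proof (rule ccontr)
      assume "\<not> ?thesis"
      then have "count_list ?fs z < p" for z by (meson not_le)
      then have "count_list ?fs z \<le> p - 1" for z by (metis Suc_pred' L.p_pos less_Suc_eq_le)
      then have "(\<Sum>z\<in>?small. count_list ?fs z) \<le> of_nat (card ?small) * (p - 1)"
        by (intro sum_bounded_above)
      then show False
        using False sum_count_set[OF sub fin] by (simp add: mult.commute)
    qed
    then obtain z where "count_list ?fs z \<ge> p" by blast
    moreover have "count_list ?fs z \<le> count_list zs z"
      by (induction zs) auto
    ultimately have z: "count_list zs z \<ge> p" by simp
    show ?thesis
      by (rule word_power[OF V _ refl less.prems z]) (rule less.hyps)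
  qed
qed

text \<open>Each letter costs at most \<open>A + \<delta> / 2 * w\<close>. For heavy letters the
  constant is covered by the other half of \<open>\<delta> * w\<close>; only light letters pay
  \<open>A\<close>, and \<open>word_in_subspace\<close> limits their number.\<close>

lemma word_growth:
  fixes \<delta> :: real
  assumes "\<delta> > 0"
  shows "\<exists>c\<ge>0. \<forall>zs. lettered zs \<longrightarrow> word zs \<in> U.hset {-(c + \<delta> * weight zs)..c + \<delta> * weight zs}"
proof -
  obtain A where A: "A \<ge> 0" "\<And>w b. letter w b \<Longrightarrow> b \<in> Mu.supported {-(A + \<delta> / 2 * w)..A + \<delta> / 2 * w}"
    using letter_growth[of "\<delta> / 2"] assms by auto
  \<comment> \<open>Beyond this weight \<open>A\<close> is at most
    \<open>\<delta> / 2 * w\<close>.\<close>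
  define w0 where "w0 = nat \<lceil>2 * A / \<delta>\<rceil>"
  define c where "c = A * real ((p - 1) * card {(w, b). w \<le> w0 \<and> letter w b})"
  let ?few = "\<lambda>zs. real (length (filter (\<lambda>z. fst z \<le> w0) zs))"
  have one: "b \<in> Mu.supported {-(A * ?few [(w, b)] + \<delta> * w)..A * ?few [(w, b)] + \<delta> * w}" if "letter w b" for w b
  proof -
    have "A + \<delta> / 2 * w \<le> A * ?few [(w, b)] + \<delta> * w"
    proof (cases "w \<le> w0")
      case True
      then show ?thesis using assms by simp
    next
      case False
      then have "2 * A / \<delta> \<le> w" unfolding w0_def by linarith
      then show ?thesis using assms False by (simp add: field_simps)
    qed
    then show ?thesis
      using A(2)[OF that] Mu.supported_mono[of "{-(A + \<delta> / 2 * w)..A + \<delta> / 2 * w}"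
        "{-(A * ?few [(w, b)] + \<delta> * w)..A * ?few [(w, b)] + \<delta> * w}"] by auto
  qed
  have few: "word zs \<in> U.hset {-(A * ?few zs + \<delta> * weight zs)..A * ?few zs + \<delta> * weight zs}" if "lettered zs" for zs
    using that
  proof (induction zs)
    case Nil
    show ?case using U.one_hset[of "{0}"] by (simp add: word_Nil weight_def)
  next
    case (Cons z zs)
    obtain w b where z: "z = (w, b)" by (cases z)
    have "gen [b] \<in> U.hset {-(A * ?few [(w, b)] + \<delta> * w)..A * ?few [(w, b)] + \<delta> * w}"
      using Cons.prems by (intro U.gen_hset one) (simp add: z lettered_Cons)
    moreover have "word zs \<in> U.hset {-(A * ?few zs + \<delta> * weight zs)..A * ?few zs + \<delta> * weight zs}"
      using Cons by (simp add: lettered_Cons)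
    ultimately have "gen [b] * word zs \<in> U.hset {-(A * ?few (z # zs) + \<delta> * weight (z # zs))..
        A * ?few (z # zs) + \<delta> * weight (z # zs)}"
      by (rule U.hset_mult) (auto simp: z weight_Cons algebra_simps split: if_splits)
    then show ?case by (simp add: word_Cons z)
  qed
  have "word zs \<in> U.hset {-(c + \<delta> * weight zs)..c + \<delta> * weight zs}" if zs: "lettered zs" for zs
  proof (rule word_in_subspace[OF U.subspace_hset _ _ zs refl, of _ w0])
    show "U.I \<subseteq> U.hset {-(c + \<delta> * weight zs)..c + \<delta> * weight zs}" using U.I_hset by blast
    fix ys assume ys: "lettered ys" "weight ys = weight zs"
      "length (filter (\<lambda>z. fst z \<le> w0) ys) \<le> (p - 1) * card {(w, b). w \<le> w0 \<and> letter w b}"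
    then have "A * ?few ys \<le> c"
      unfolding c_def using A(1) by (intro mult_left_mono) (simp_all only: of_nat_le_iff)
    then have "{-(A * ?few ys + \<delta> * weight ys)..A * ?few ys + \<delta> * weight ys} \<subseteq> {-(c + \<delta> * weight zs)..c + \<delta> * weight zs}"
      using ys(2) by auto
    then show "word ys \<in> U.hset {-(c + \<delta> * weight zs)..c + \<delta> * weight zs}"
      using few[OF ys(1)] U.hset_mono by blast
  qed
  moreover have "c \<ge> 0" using A(1) by (simp add: c_def)
  ultimately show ?thesis by blast
qed

section \<open>The weight filtration\<close>

definition filt :: "nat \<Rightarrow> ('l list \<Rightarrow>\<^sub>0 'k) set" where
  "filt W = free.span ({word zs | zs. lettered zs \<and> weight zs \<le> W} \<union> U.I)"

lemma filt_mono: "W \<le> W' \<Longrightarrow> filt W \<subseteq> filt W'"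
  unfolding filt_def by (rule free.span_mono) auto

lemma filt_word: "lettered zs \<Longrightarrow> weight zs \<le> W \<Longrightarrow> word zs \<in> filt W"
  unfolding filt_def by (rule free.span_base) blast

lemma filt_I: "u \<in> U.I \<Longrightarrow> u \<in> filt W"
  unfolding filt_def by (rule free.span_base) blast

lemma subspace_filt: "free.subspace (filt W)"
  unfolding filt_def by (rule free.subspace_span)

lemma filt_mult: "u \<in> filt W \<Longrightarrow> v \<in> filt W' \<Longrightarrow> u * v \<in> filt (W + W')"
proof (unfold filt_def, rule free_span_mult, fold filt_def)
  fix x y assume xy: "x \<in> {word zs | zs. lettered zs \<and> weight zs \<le> W} \<union> U.I"
    "y \<in> {word zs | zs. lettered zs \<and> weight zs \<le> W'} \<union> U.I"
  show "x * y \<in> filt (W + W')"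
  proof (cases "x \<in> U.I \<or> y \<in> U.I")
    case True
    then have "x * y \<in> U.I" using U.I_mult by blast
    then show ?thesis by (rule filt_I)
  next
    case False
    with xy obtain xs ys where "x = word xs" "y = word ys" "lettered xs" "lettered ys" "weight xs \<le> W" "weight ys \<le> W'"
      by auto
    then show ?thesis
      using filt_word[of "xs @ ys" "W + W'"] by (simp add: lettered_append weight_append word_append)
  qed
qed (simp_all add: filt_def)

lemma filt_exhaustive: "\<exists>W. u \<in> filt W"
proof -
  have add: "\<exists>W. u + v \<in> filt W" if h: "\<exists>W. u \<in> filt W" "\<exists>W. v \<in> filt W" for u v
  proof -
    obtain W W' where "u \<in> filt W" "v \<in> filt W'" using h by blast
    then have "u \<in> filt (W + W')" "v \<in> filt (W + W')"
      using filt_mono[of W "W + W'"] filt_mono[of W' "W + W'"] by auto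
    then show ?thesis using free.subspace_add[OF subspace_filt] by blast
  qed
  have scale: "\<exists>W. fscale c u \<in> filt W" if "\<exists>W. u \<in> filt W" for c u
    using that free.subspace_scale[OF subspace_filt] by blast
  have cong: "\<exists>W. u \<in> filt W" if "u - v \<in> U.I" "\<exists>W. v \<in> filt W" for u v
    using add[of "u - v" v] that filt_I by auto
  have "L.subspace {a. \<exists>W. gen [a] \<in> filt W}"
  proof (rule L.subspaceI)
    show "0 \<in> {a. \<exists>W. gen [a] \<in> filt W}" using filt_I[OF U.rel_zero] by blast
    fix a b assume "a \<in> {a. \<exists>W. gen [a] \<in> filt W}" "b \<in> {a. \<exists>W. gen [a] \<in> filt W}"
    then have "\<exists>W. gen [a] + gen [b] \<in> filt W" using add by blast
    then have "\<exists>W. gen [a + b] \<in> filt W" by (rule cong[rotated]) (use U.rel_add[of a b] in \<open>simp add: diff_diff_eq\<close>)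
    then show "a + b \<in> {a. \<exists>W. gen [a] \<in> filt W}" by simp
  next
    fix c a assume "a \<in> {a. \<exists>W. gen [a] \<in> filt W}"
    then have "\<exists>W. fscale c (gen [a]) \<in> filt W" using scale by blast
    then have "\<exists>W. gen [sL c a] \<in> filt W" by (rule cong[OF U.rel_scale])
    then show "sL c a \<in> {a. \<exists>W. gen [a] \<in> filt W}" by simp
  qed
  moreover have "{b. \<exists>w. letter w b} \<subseteq> {a. \<exists>W. gen [a] \<in> filt W}"
  proof clarify
    fix b w assume "letter w b"
    then have "word [(w, b)] \<in> filt w" by (intro filt_word) (simp_all add: lettered_def weight_def)
    then show "\<exists>W. gen [b] \<in> filt W" by (auto simp: word_def)
  qed
  ultimately have letter: "\<exists>W. gen [a] \<in> filt W" for a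
    using L.span_minimal span_letters by blast
  show ?thesis
  proof (induction u rule: free_induct)
    case (gen as)
    show ?case
    proof (induction as)
      case Nil
      show ?case using filt_word[of "[]" 0] by (auto simp: lettered_def weight_def word_def)
    next
      case (Cons a as)
      then show ?case using letter[of a] filt_mult unfolding gen_Cons[of a as] by blast
    qed
  next
    case zero
    show ?case using free.subspace_0[OF subspace_filt] by blast
  qed (use add scale in blast)+
qed

text \<open>A product of \<open>n\<close> elements lies in degrees \<open>\<ge> n\<eta>\<close> and, by the sublinear growth of degrees,
  in degrees \<open>\<le> n\<eta>/2 + c\<close>. The sign \<open>s\<close> treats both halves at once.\<close>

lemma locally_nilpotent_half:
  fixes s :: real
  assumes D: "D = {d. s * d > 0}" and s: "\<bar>s\<bar> = 1"
  shows "qlocally_nilpotent U.I (homogeneous_span U.I L_mu D)"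
  unfolding qlocally_nilpotent_def U.homogeneous_span_eq
proof (intro allI impI, elim conjE)
  fix F assume "finite F" "F \<subseteq> coset U.I ` U.hset D"
  then obtain F' where F': "F' \<subseteq> U.hset D" "finite F'" "F = coset U.I ` F'"
    by (meson finite_subset_image)
  \<comment> \<open>Only finitely many components occur, so those in \<open>D\<close> keep a
    positive distance from degree \<open>0\<close>; \<open>insert 1\<close> covers the case that
    there are none.\<close>
  have "\<exists>\<eta>>0. f \<in> U.hset {d. s * d \<ge> \<eta>}" if "f \<in> U.hset D" for f
  proof -
    let ?K = "Poly_Mapping.keys (U.coact f) \<inter> D"
    let ?\<eta> = "Min (insert 1 ((\<lambda>d. s * d) ` ?K))"
    have "?\<eta> > 0" by (auto simp: D)
    moreover have "?\<eta> \<le> s * d" if "d \<in> ?K" for d using that by (intro Min_le) auto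
    then have "f \<in> U.hset {d. s * d \<ge> ?\<eta>}"
      using \<open>f \<in> U.hset D\<close> free.subspace_0[OF U.I_subspace] unfolding U.hset_def
      by (auto simp: in_keys_iff) (metis IntI in_keys_iff)
    ultimately show ?thesis by blast
  qed
  then obtain \<eta>f where \<eta>f: "\<And>f. f \<in> F' \<Longrightarrow> \<eta>f f > 0 \<and> f \<in> U.hset {d. s * d \<ge> \<eta>f f}"
    using F'(1) by (metis subsetD)
  obtain Wf where Wf: "\<And>f. f \<in> filt (Wf f)" using filt_exhaustive by metis
  define \<eta> where "\<eta> = Min (insert 1 (\<eta>f ` F'))"
  define W where "W = Max (insert 0 (Wf ` F'))"
  have eta: "\<eta> > 0" using F'(2) \<eta>f by (auto simp: \<eta>_def)
  \<comment> \<open>The two competing bounds for a product of \<open>k\<close> generators: its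
    degree grows at least like \<open>k * \<eta>\<close>, its weight at most like
    \<open>k * W\<close>.\<close>
  define X where "X k = U.hset {d. s * d \<ge> real k * \<eta>} \<inter> filt (k * W)" for k
  have X: "free.subspace (X k)" for k
    unfolding X_def by (intro free.subspace_inter U.subspace_hset subspace_filt)
  have X_mult: "u * v \<in> X (k + l)" if "u \<in> X k" "v \<in> X l" for u v k l
    using that unfolding X_def
    by (auto intro!: U.hset_mult[of u _ v] dest: filt_mult simp: distrib_left distrib_right)
  have F'_X: "f \<in> X 1" if "f \<in> F'" for f
  proof -
    have "\<eta> \<le> \<eta>f f" "Wf f \<le> W" using that F'(2) by (auto simp: \<eta>_def W_def)
    then show ?thesis
      using \<eta>f[OF that] Wf[of f] filt_mono[of "Wf f" W] U.hset_mono[of "{d. s * d \<ge> \<eta>f f}" "{d. s * d \<ge> \<eta>}"]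
      unfolding X_def by force
  qed
  \<comment> \<open>Chosen so that weight \<open>k * W\<close> permits degrees of size at most
    \<open>c + k * \<eta> / 2\<close>; the \<open>+ 2\<close> keeps the denominator positive when
    \<open>W = 0\<close>.\<close>
  define \<delta> where "\<delta> = \<eta> / (2 * real W + 2)"
  have \<delta>: "\<delta> > 0" "\<delta> * real W \<le> \<eta> / 2" using eta by (simp_all add: \<delta>_def field_simps)
  obtain c where c: "c \<ge> 0" "\<And>zs. lettered zs \<Longrightarrow> word zs \<in> U.hset {-(c + \<delta> * weight zs)..c + \<delta> * weight zs}"
    using word_growth[OF \<delta>(1)] by blast
  have filt_hset: "filt V \<subseteq> U.hset {-(c + \<delta> * V)..c + \<delta> * V}" for V
    unfolding filt_def
  proof (rule free.span_minimal[OF _ U.subspace_hset], rule Un_least)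
    show "{word zs | zs. lettered zs \<and> weight zs \<le> V} \<subseteq> U.hset {-(c + \<delta> * V)..c + \<delta> * V}"
    proof clarify
      fix zs assume zs: "lettered zs" "weight zs \<le> V"
      then have "\<delta> * weight zs \<le> \<delta> * V" using \<delta>(1) by simp
      then show "word zs \<in> U.hset {-(c + \<delta> * V)..c + \<delta> * V}"
        using c(2)[OF zs(1)] U.hset_mono[of "{-(c + \<delta> * weight zs)..c + \<delta> * weight zs}"
          "{-(c + \<delta> * V)..c + \<delta> * V}"] by auto
    qed
  qed (use U.I_hset in blast)
  \<comment> \<open>For \<open>k \<ge> M\<close> the number \<open>k * \<eta> / 2\<close> exceeds
    \<open>c\<close>, so the two bounds exclude each other; the \<open>+ 1\<close> makes this
    strict.\<close>
  define M where "M = nat \<lceil>2 * c / \<eta>\<rceil> + 1"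
  have X_I: "u \<in> U.I" if "u \<in> X k" "k \<ge> M" for u k
  proof -
    have "2 * c / \<eta> < real k" using that(2) unfolding M_def by linarith
    then have "c < real k * (\<eta> / 2)" using eta by (simp add: field_simps)
    moreover have "\<delta> * real (k * W) \<le> real k * (\<eta> / 2)"
      using mult_left_mono[OF \<delta>(2), of "real k"] by (simp add: mult_ac)
    ultimately have small: "c + \<delta> * real (k * W) < real k * \<eta>" by simp
    have "u \<in> U.hset ({d. s * d \<ge> real k * \<eta>} \<inter> {-(c + \<delta> * real (k * W))..c + \<delta> * real (k * W)})"
      using that(1) filt_hset[of "k * W"] unfolding X_def by (intro U.hset_Int) auto
    also have "{d. s * d \<ge> real k * \<eta>} \<inter> {-(c + \<delta> * real (k * W))..c + \<delta> * real (k * W)} = {}"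
    proof (rule equals0I)
      fix d assume "d \<in> {d. s * d \<ge> real k * \<eta>} \<inter> {-(c + \<delta> * real (k * W))..c + \<delta> * real (k * W)}"
      then have "s * d \<ge> real k * \<eta>" "\<bar>d\<bar> \<le> c + \<delta> * real (k * W)" by auto
      moreover have "s * d \<le> \<bar>d\<bar>" using s by (metis abs_ge_self abs_mult mult_1)
      ultimately show False using small by linarith
    qed
    finally show ?thesis by (rule U.hset_empty)
  qed
  \<comment> \<open>The sets \<open>X k\<close> are not nested, as larger \<open>k\<close> permits
    more weight. Elements of the generated subalgebra mix products of different lengths, so spans
    over all \<open>k \<ge> n\<close> are needed.\<close>
  define Y where "Y n = free.span (\<Union>k\<in>{n..}. X k)" for n
  have Y_mult: "u * v \<in> Y (m + n)" if "u \<in> Y m" "v \<in> Y n" for u v m n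
    using that unfolding Y_def
  proof (rule free_span_mult[rotated])
    fix x y assume "x \<in> (\<Union>k\<in>{m..}. X k)" "y \<in> (\<Union>k\<in>{n..}. X k)"
    then obtain k l where "x \<in> X k" "y \<in> X l" "m \<le> k" "n \<le> l" by auto
    then show "x * y \<in> free.span (\<Union>k\<in>{m + n..}. X k)"
      using X_mult[of x k y l] by (intro free.span_base UN_I[of "k + l"]) auto
  qed
  have Y_mono: "Y n \<subseteq> Y m" if "m \<le> n" for m n
    unfolding Y_def using that by (intro free.span_mono) force
  have Y_M: "Y M \<subseteq> U.I"
    unfolding Y_def using X_I by (intro free.span_minimal U.I_subspace) auto
  have "qsubalgebra U.I (coset U.I ` Y 1)"
  proof (rule U.qsubalgebra_coset_image)
    show "free.subspace (Y 1)" unfolding Y_def by (rule free.subspace_span)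
    show "u * v \<in> Y 1" if "u \<in> Y 1" "v \<in> Y 1" for u v
      using Y_mult[OF that] Y_mono[of 1 "1 + 1"] by auto
  qed
  moreover have "F \<subseteq> coset U.I ` Y 1"
    unfolding F'(3) Y_def using F'_X by (intro image_mono) (auto intro!: free.span_base)
  ultimately have hull: "qsubalgebra U.I hull F \<subseteq> coset U.I ` Y 1" by (intro hull_minimal)
  \<comment> \<open>\<open>qprod\<close> ends with the unit, so the count of factors starts at
    \<open>0\<close>.\<close>
  have one: "1 \<in> Y 0"
  proof -
    have "1 \<in> X 0"
      unfolding X_def using U.one_hset filt_word[of "[]" 0] by (simp add: lettered_def weight_def word_Nil)
    then show ?thesis unfolding Y_def by (intro free.span_base) auto
  qed
  have prod: "qprod U.I Us \<in> coset U.I ` Y (length Us)" if "set Us \<subseteq> coset U.I ` Y 1" for Us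
    using that
  proof (induction Us)
    case Nil
    show ?case using one by (simp add: qprod_def)
  next
    case (Cons V Us)
    then obtain u v where "V = coset U.I u" "u \<in> Y 1" "qprod U.I Us = coset U.I v" "v \<in> Y (length Us)"
      by auto
    then show ?case
      using Y_mult[of u 1 v "length Us"] by (auto simp: qprod_def lift_ideal_coset[OF U.ideal_I])
  qed
  show "qnilpotent U.I (qsubalgebra U.I hull F)"
    unfolding qnilpotent_def
  proof (intro exI[of _ M] conjI allI impI)
    show "M > 0" by (simp add: M_def)
    fix Us assume "set Us \<subseteq> qsubalgebra U.I hull F \<and> length Us = M"
    then have "qprod U.I Us \<in> coset U.I ` Y M" using prod[of Us] hull by auto
    then show "qprod U.I Us = coset U.I 0"
      using Y_M coset_eq_0_iff[OF U.I_group] by auto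
  qed
qed

lemma locally_nilpotent:
  "qlocally_nilpotent U.I (homogeneous_span U.I L_mu {0<..})"
  "qlocally_nilpotent U.I (homogeneous_span U.I L_mu {..<0})"
  by (rule locally_nilpotent_half[of _ 1], auto)[] (rule locally_nilpotent_half[of _ "- 1"], auto)

text \<open>The subalgebra generated by the single element \<open>u\<close> is nilpotent, and a
  power of \<open>u\<close> is a product in it.\<close>

lemma homogeneous_nil:
  assumes "d \<noteq> 0" "u \<in> induced_homogeneous U.I L_mu d"
  shows "qnil U.I u"
proof -
  obtain D where D: "d \<in> D" "qlocally_nilpotent U.I (homogeneous_span U.I L_mu D)"
  proof (cases "d > 0")
    case True
    then show ?thesis using that[OF _ locally_nilpotent(1)] by simp
  next
    case False
    then show ?thesis using that[OF _ locally_nilpotent(2)] assms(1) by simp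
  qed
  have "u \<in> homogeneous_span U.I L_mu D"
    unfolding U.homogeneous_span_eq by (rule subsetD[OF U.induced_homogeneous_subset[OF D(1)] assms(2)])
  moreover have "finite {u} \<and> {u} \<subseteq> homogeneous_span U.I L_mu D
      \<longrightarrow> qnilpotent U.I (qsubalgebra U.I hull {u})"
    using D(2) unfolding qlocally_nilpotent_def by (rule spec)
  ultimately have "qnilpotent U.I (qsubalgebra U.I hull {u})" by simp
  then obtain n where n: "n > 0"
    and prod: "\<forall>Us. set Us \<subseteq> qsubalgebra U.I hull {u} \<and> length Us = n \<longrightarrow> qprod U.I Us = coset U.I 0"
    unfolding qnilpotent_def by (elim exE conjE)
  have "u \<in> qsubalgebra U.I hull {u}" by (simp add: hull_inc)
  then have "set (replicate n u) \<subseteq> qsubalgebra U.I hull {u}" by auto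
  then have "qprod U.I (replicate n u) = coset U.I 0" using prod by simp
  with n show ?thesis unfolding qnil_def by (intro exI conjI)
qed

end

theorem proposition5p3:
  fixes p :: nat
    and sL :: "'k::field \<Rightarrow> 'l::ab_group_add \<Rightarrow> 'l"
    and brk :: "'l \<Rightarrow> 'l \<Rightarrow> 'l"
    and pm :: "'l \<Rightarrow> 'l"
    and sX :: "'k \<Rightarrow> 'x::comm_ring_1 \<Rightarrow> 'x"
    and \<psi> :: "'l \<Rightarrow> ('k, 'x, 'l) wreath"
    and lam mu :: real
    and L_lam L_mu :: "real \<Rightarrow> 'l set"
    and X_lam X_mu :: "real \<Rightarrow> 'x set"
  assumes self_similar: "self_similar_lie_algebra p sL brk pm sX \<psi>"
    and finite_dim_X: "\<exists>B. finite_dimensional_vector_space sX B"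
    and compat_lam: "compatible_gradings sL brk sX \<psi> lam L_lam X_lam"
    and compat_mu: "compatible_gradings sL brk sX \<psi> mu L_mu X_mu"
    and X_lam_nonpos: "\<forall>d>0. X_lam d = {0}"
    and L_lam_pos: "\<forall>d\<le>0. L_lam d = {0}"
    and dilations: "lam > \<bar>mu\<bar>" "\<bar>mu\<bar> > 1"
    and fin_gen: "\<exists>S. finite S \<and> S \<subseteq> (\<Union>d\<in>{0<..}. L_lam d)
                    \<and> restricted_lie_subalgebra sL brk pm hull S = UNIV"
  shows "let I = uea_ideal p sL brk pm;
             U_pos = homogeneous_span I L_mu {0<..};
             U_zero = homogeneous_span I L_mu {0};
             U_neg = homogeneous_span I L_mu {..<0}
         in qsubalgebra I U_pos \<and> qsubalgebra I U_zero \<and> qsubalgebra I U_neg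
          \<and> (\<forall>u\<in>quotient_space I. \<exists>!(a, b, c). a \<in> U_pos \<and> b \<in> U_zero \<and> c \<in> U_neg
                \<and> u = lift2 I (+) (lift2 I (+) a b) c)
          \<and> qlocally_nilpotent I U_pos \<and> qlocally_nilpotent I U_neg
          \<and> (\<forall>d. d \<noteq> 0 \<longrightarrow> (\<forall>u\<in>induced_homogeneous I L_mu d. qnil I u))"
proof -
  obtain S where S: "finite S" "S \<subseteq> (\<Union>d\<in>{0<..}. L_lam d)" "restricted_lie_subalgebra sL brk pm hull S = UNIV"
    using fin_gen by blast
  interpret self_similar_lie_algebra p sL brk pm sX \<psi> by (rule self_similar)
  interpret doubly_graded p sL brk pm sX \<psi> lam mu L_lam L_mu X_lam X_mu S
    by unfold_locales (fact finite_dim_X compat_lam compat_mu dilations S)+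
  show ?thesis
    unfolding Let_def
  proof (intro conjI ballI allI impI)
    show "qsubalgebra U.I (homogeneous_span U.I L_mu {0<..})"
      "qsubalgebra U.I (homogeneous_span U.I L_mu {0})"
      "qsubalgebra U.I (homogeneous_span U.I L_mu {..<0})"
      by (rule U.qsubalgebra_homogeneous_span, simp)+
  qed (fact U.triangular_decomposition locally_nilpotent | rule homogeneous_nil)+
qed

end
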